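(* Let $E$ be a Radon topological space, let $(P_t)_{t\ge 0}$ be a normal Markov transition function on $(E,\mathcal{E}^u)$ satisfying (HD1), with resolvent $(U^\alpha)_{\alpha>0}$ and canonical realization $X$. Let $N\in\mathcal{E}^u$ be weakly $U$-negligible and let $(\tilde U^\alpha)_{\alpha>0}$ be the restriction of $(U^\alpha)_{\alpha>0}$ to $\tilde E=E\setminus N$, where $\tilde E$ is equipped with the subspace topology of $E$. Then there is a Markov transition function $(\tilde P_t)_{t\ge0}$ on $(\tilde E,\tilde{\mathcal{E}}^u)$ satisfying (HD1) whose resolvent is $(\tilde U^\alpha)_{\alpha>0}$ if and only if $\tilde E$ is quasi-absorbing for $X$. In this case $(\tilde P_t)$ is identical to the restriction of $(P_t)$ to $\tilde E$, i.e. $\tilde P_t(x,B)=P_t(x,B)$ for all $t\ge0$, $x\in\tilde E$ and $B\in\tilde{\mathcal{E}}^u$.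
   Context: A Radon topological space is a space homeomorphic to a universally measurable subset of a compact metric space. $\mathcal{E}$ is the Borel $\sigma$-algebra of $E$ and $\mathcal{E}^u=\bigcap_\mu\overline{\mathcal{E}}^{\mu}$ (intersection of the completions over all finite positive measures $\mu$ on $(E,\mathcal{E})$) is the universally measurable $\sigma$-algebra; a finite measure on $(E,\mathcal{E})$ extends uniquely to $(E,\mathcal{E}^u)$, and one speaks of a measure on $E$. $b\mathcal{M}$ (resp. $p\mathcal{M}$) denotes the bounded (resp. $[0,\infty]$-valued) $\mathcal{M}$-measurable functions. A Markov transition function on $(E,\mathcal{E}^u)$ is a family $(P_t)_{t\ge0}$ of Markov kernels on $(E,\mathcal{E}^u)$ (i.e. $P_t(x,E)=1$) with $P_{t+s}(x,B)=\int_E P_t(x,dy)P_s(y,B)$; it is normal if $P_0(x,B)=1_B(x)$. Its resolvent is $U^\alpha f=\int_0^\infty e^{-\alpha t}P_tf\,dt$, $f\in p\mathcal{E}^u$. (HD1) (for a Markov transition function on a Radon space with its universally measurable $\sigma$-algebra): for every probability measure $\mu$ on $E$ there is an $E$-valued process $(X_t)_{t\ge 0}$, all of whose paths are right continuous, on some filtered probability space $(\Omega,\mathcal{G},\mathcal{G}_t,\mathbf{P})$, with each $X_t$ being $\mathcal{G}_t/\mathcal{E}^u$-measurable, $X_0$ having law $\mu$, and $\mathbf{P}\{f(X_{t+s})\mid\mathcal{G}_t\}=P_sf(X_t)$ for all $t,s\ge0$, $f\in b\mathcal{E}^u$ (where $\mathbf{P}\{\cdot\}$ also denotes expectation). Canonical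 realization $X=(\Omega,\mathcal{F}^u,\mathcal{F}^u_t,X_t,\theta_t,\mathbf{P}^x)$: $\Omega$ is the set of all right continuous maps from $[0,\infty)$ to $E$, $X_t(\omega)=\omega(t)$, $\theta_t\omega(s)=\omega(t+s)$, $\mathcal{F}^u_t=\sigma\{f(X_s):0\le s\le t,f\in\mathcal{E}^u\}$, $\mathcal{F}^u=\sigma\{f(X_s):s\ge 0,f\in\mathcal{E}^u\}$, and $\mathbf{P}^x$ is the probability on $(\Omega,\mathcal{F}^u)$ with $\mathbf{P}^x(X_0=x)=1$ under which $\mathbf{P}^x\{f(X_{t+s})\mid\mathcal{F}^u_t\}=P_sf(X_t)$ for all $t,s\ge0$, $f\in b\mathcal{E}^u$ (Markov property with semigroup $(P_t)$ relative to $(\mathcal{F}^u_t)$). For a probability measure $\mu$ on $E$, $\mathbf{P}^\mu=\int_E\mu(dx)\mathbf{P}^x$. The $\mathbf{P}^\mu$-outer measure of $A\subset\Omega$ is $\inf\{\mathbf{P}^\mu(B):A\subset B\in\mathcal{F}^u\}$; it is full if it equals $1$. For $N\in\mathcal{E}^u$: $N$ is weakly $U$-negligible if $U^\alpha1_N(x)=0$ for one (equivalently all) $\alpha>0$ and all $x\in E\setminus N$; $E\setminus N$ is quasi-absorbing for $X$ if for every initial law $\mu$ carried by $E\setminus N$ the set $\{X_t\in E\setminus N,\ \forall t\ge0\}$ has full $\mathbf{P}^\mu$-outer measure. With $\tilde E=E\setminus N$ carrying the subspace topology (again a Radon space), $\tilde{\mathcal{E}}=\mathcal{E}|_{\tilde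 E}$ and $\tilde{\mathcal{E}}^u=\mathcal{E}^u|_{\tilde E}$ are its Borel and universally measurable $\sigma$-algebras. If $N$ is weakly $U$-negligible, the restriction of $(U^\alpha)$ to $\tilde E$ is the family of kernels on $(\tilde E,\tilde{\mathcal{E}}^u)$ given by $\tilde U^\alpha\tilde f=(U^\alpha f)|_{\tilde E}$, $\tilde f\in p\tilde{\mathcal{E}}^u$, where $f\in p\mathcal{E}^u$ is any extension of $\tilde f$ to $E$. *)

theory Defs
  imports "HOL-Probability.Probability"
begin

section \<open>Borel and universally measurable sets of a topology\<close>

definition borel_of :: "'a topology \<Rightarrow> 'a measure" where
  "borel_of T = sigma (topspace T) {U. openin T U}"

definition universally_measurable_sets :: "'a measure \<Rightarrow> 'a set set" where
  "universally_measurable_sets M =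
     {A. A \<subseteq> space M \<and> (\<forall>\<mu>. finite_measure \<mu> \<and> sets \<mu> = sets M \<longrightarrow> A \<in> sets (completion \<mu>))}"

definition univ_borel :: "'a topology \<Rightarrow> 'a measure" where
  "univ_borel T = sigma (topspace T) (universally_measurable_sets (borel_of T))"

lemma space_borel_of [simp]: "space (borel_of T) = topspace T"
  by (simp add: borel_of_def space_measure_of_conv)

lemma sets_borel_of: "sets (borel_of T) = sigma_sets (topspace T) {U. openin T U}"
  unfolding borel_of_def by (rule sets_measure_of) (auto dest: openin_subset)

lemma space_univ_borel [simp]: "space (univ_borel T) = topspace T"
  by (simp add: univ_borel_def space_measure_of_conv)

lemma sigma_algebra_universally_measurable_sets:
  "sigma_algebra (space M) (universally_measurable_sets M)"
proof -
  have *: "A \<in> sets (completion \<mu>)" if "A \<in> universally_measurable_sets M"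
    "finite_measure \<mu>" "sets \<mu> = sets M" for A \<mu>
    using that by (auto simp: universally_measurable_sets_def)
  have sp: "space \<mu> = space M" if "sets \<mu> = sets M" for \<mu> :: "'a measure"
    using that by (rule sets_eq_imp_space_eq)
  show ?thesis
    unfolding sigma_algebra_iff2
  proof (intro conjI ballI allI impI)
    show "universally_measurable_sets M \<subseteq> Pow (space M)" "{} \<in> universally_measurable_sets M"
      by (auto simp: universally_measurable_sets_def)
    show "space M - s \<in> universally_measurable_sets M" if s: "s \<in> universally_measurable_sets M" for s
    proof -
      have "space M - s \<in> sets (completion \<mu>)" if "finite_measure \<mu>" "sets \<mu> = sets M" for \<mu>
        using sets.compl_sets[OF *[OF s that]] sp[OF that(2)] by simp
      then show ?thesis by (auto simp: universally_measurable_sets_def)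
    qed
    show "\<Union> (range A) \<in> universally_measurable_sets M"
      if A: "range A \<subseteq> universally_measurable_sets M" for A :: "nat \<Rightarrow> _"
    proof -
      have "\<Union> (range A) \<in> sets (completion \<mu>)" if "finite_measure \<mu>" "sets \<mu> = sets M" for \<mu>
        using A *[OF _ that] by (intro sets.countable_UN) auto
      moreover have "\<Union> (range A) \<subseteq> space M"
        using A by (fastforce simp: universally_measurable_sets_def)
      ultimately show ?thesis by (auto simp: universally_measurable_sets_def)
    qed
  qed
qed

lemma sets_univ_borel: "sets (univ_borel T) = universally_measurable_sets (borel_of T)"
proof -
  interpret sigma_algebra "topspace T" "universally_measurable_sets (borel_of T)"
    using sigma_algebra_universally_measurable_sets[of "borel_of T"] by simp
  show ?thesis by (simp add: univ_borel_def sets_measure_of_eq)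
qed

text \<open>A compact metric space has at most continuum many points, so up to isometry its points can
  be taken to be reals, with a metric \<open>d\<close> unrelated to the usual distance; \<open>radon_spaceI\<close> below
  covers compact metric spaces over any type.\<close>

definition radon_space :: "'a topology \<Rightarrow> bool" where
  "radon_space T \<longleftrightarrow>
     (\<exists>(K :: real set) d S. Metric_space K d \<and> compact_space (Metric_space.mtopology K d) \<and>
        S \<in> sets (univ_borel (Metric_space.mtopology K d)) \<and>
        T homeomorphic_space (subtopology (Metric_space.mtopology K d) S))"

lemma universally_measurable_homeomorphic_image:
  assumes j: "homeomorphic_map X Y j" and S: "S \<in> sets (univ_borel X)"
  shows "j ` S \<in> sets (univ_borel Y)"
proof -
  obtain i where ji: "homeomorphic_maps X Y j i"
    using j by (auto simp: homeomorphic_map_maps)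
  have i: "homeomorphic_map Y X i" using ji homeomorphic_maps_map by blast
  have ij: "\<And>x. x \<in> topspace X \<Longrightarrow> i (j x) = x" and j_in: "\<And>x. x \<in> topspace X \<Longrightarrow> j x \<in> topspace Y"
    and ji': "\<And>y. y \<in> topspace Y \<Longrightarrow> j (i y) = y" and i_in: "\<And>y. y \<in> topspace Y \<Longrightarrow> i y \<in> topspace X"
    using ji by (auto simp: homeomorphic_maps_def continuous_map_def)
  have im: "j ` A = i -` A \<inter> topspace Y" if "A \<subseteq> topspace X" for A
    using that ij ji' j_in by (force simp: image_iff)
  have i_meas: "i \<in> borel_of Y \<rightarrow>\<^sub>M borel_of X"
    unfolding borel_of_def[of X]
  proof (rule measurable_measure_of)
    show "i -` U \<inter> space (borel_of Y) \<in> sets (borel_of Y)" if "U \<in> {U. openin X U}" for U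
    proof -
      have "openin Y {y \<in> topspace Y. i y \<in> U}"
        using ji that by (auto simp: homeomorphic_maps_def continuous_map_def)
      moreover have "i -` U \<inter> space (borel_of Y) = {y \<in> topspace Y. i y \<in> U}" by auto
      ultimately show ?thesis by (auto simp: sets_borel_of)
    qed
  qed (use i_in openin_subset in auto)
  have Ssub: "S \<subseteq> topspace X" using sets.sets_into_space[OF S] by simp
  have "j ` S \<in> sets (completion \<mu>)" if fin: "finite_measure \<mu>" and sets: "sets \<mu> = sets (borel_of Y)" for \<mu>
  proof -
    have sp: "space \<mu> = topspace Y" using sets_eq_imp_space_eq[OF sets] by simp
    have im\<mu>: "i \<in> \<mu> \<rightarrow>\<^sub>M borel_of X" using i_meas measurable_cong_sets[OF sets refl] by blast
    define \<nu> where "\<nu> = distr \<mu> (borel_of X) i"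
    have "finite_measure \<nu>" unfolding \<nu>_def by (rule finite_measure.finite_measure_distr[OF fin im\<mu>])
    then have "S \<in> sets (completion \<nu>)"
      using S by (auto simp: sets_univ_borel universally_measurable_sets_def \<nu>_def)
    then obtain A N N' where A: "S = A \<union> N" "N \<subseteq> N'" "N' \<in> null_sets \<nu>" "A \<in> sets \<nu>"
      by (rule sets_completionE)
    have N': "N' \<subseteq> topspace X" using sets.sets_into_space[OF null_setsD2[OF A(3)]] by (simp add: \<nu>_def)
    have "j ` S = j ` A \<union> j ` N" using A(1) by auto
    moreover have "j ` N \<subseteq> j ` N'" using A(2) by auto
    moreover have "j ` N' \<in> null_sets \<mu>"
      using A(3) unfolding \<nu>_def null_sets_distr_iff[OF im\<mu>] im[OF N'] by (simp add: sp)
    moreover have "j ` A \<in> sets \<mu>"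
      using measurable_sets[OF im\<mu>, of A] A(1,4) Ssub im[of A] by (simp add: sp \<nu>_def)
    ultimately show ?thesis by (rule sets_completionI)
  qed
  moreover have "j ` S \<subseteq> topspace Y" using Ssub j_in by auto
  ultimately show ?thesis by (simp add: sets_univ_borel universally_measurable_sets_def)
qed

lemma compact_metric_inj_real:
  assumes "Metric_space K d" and c: "compact_space (Metric_space.mtopology K d)"
  shows "\<exists>j :: 'k \<Rightarrow> real. inj_on j K"
proof -
  interpret Metric_space K d by fact
  have "\<exists>F. finite F \<and> F \<subseteq> K \<and> K \<subseteq> (\<Union>x\<in>F. mball x (1 / real (Suc n)))" for n
    using c compact_space_eq_mcomplete_mtotally_bounded
    unfolding mtotally_bounded_def by simp
  then obtain F where F: "\<And>n. finite (F n)" "\<And>n. F n \<subseteq> K"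
    "\<And>n. K \<subseteq> (\<Union>x\<in>F n. mball x (1 / real (Suc n)))" by metis
  define Q where "Q = (SIGMA n:UNIV. F n)"
  have cQ: "countable Q" unfolding Q_def using F(1) by (auto intro: countable_finite)
  define h where "h = (\<lambda>x. to_nat_on Q ` {(n, c) \<in> Q. x \<in> mball c (1 / real (Suc n))})"
  have "inj_on h K"
  proof (rule inj_onI, rule ccontr)
    fix x y assume x: "x \<in> K" and y: "y \<in> K" and h: "h x = h y" and "x \<noteq> y"
    then have "d x y / 2 > 0" by simp
    then obtain n where n: "1 / real (Suc n) < d x y / 2"
      using nat_approx_posE by blast
    obtain c where c: "c \<in> F n" "x \<in> mball c (1 / real (Suc n))" using F(3)[of n] x by auto
    have "{(n, c) \<in> Q. x \<in> mball c (1 / real (Suc n))} = {(n, c) \<in> Q. y \<in> mball c (1 / real (Suc n))}"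
      by (rule inj_on_image_eq_iff[THEN iffD1, OF inj_on_to_nat_on[OF cQ]])
         (use h in \<open>auto simp: h_def\<close>)
    moreover have "(n, c) \<in> {(n, c) \<in> Q. x \<in> mball c (1 / real (Suc n))}" using c by (auto simp: Q_def)
    ultimately have "y \<in> mball c (1 / real (Suc n))" by blast
    then have "d c x < 1 / real (Suc n)" "d c y < 1 / real (Suc n)" "c \<in> K" using c by auto
    moreover have "d x y \<le> d c x + d c y" using triangle[OF x \<open>c \<in> K\<close> y] commute[of x c] by simp
    ultimately show False using n by linarith
  qed
  moreover obtain k :: "nat set \<Rightarrow> real" where "inj k"
    using nat_sets_lepoll_reals01 unfolding lepoll_def by auto
  ultimately have "inj_on (k \<circ> h) K" by (auto intro!: comp_inj_on intro: inj_on_subset)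
  then show ?thesis by blast
qed

lemma radon_spaceI:
  fixes K :: "'k set"
  assumes K: "Metric_space K d" and c: "compact_space (Metric_space.mtopology K d)"
    and S: "S \<in> sets (univ_borel (Metric_space.mtopology K d))"
    and T: "T homeomorphic_space (subtopology (Metric_space.mtopology K d) S)"
  shows "radon_space T"
proof -
  obtain j :: "'k \<Rightarrow> real" where j: "inj_on j K" using compact_metric_inj_real[OF K c] by blast
  interpret Metric_space K d by (rule K)
  define e where "e = (\<lambda>a b. d (inv_into K j a) (inv_into K j b))"
  interpret E: Metric_space "j ` K" e
  proof -
    show "Metric_space (j ` K) e"
    proof
      show "0 \<le> e x y" "e x y = e y x" for x y by (simp_all add: e_def commute)
      show "(e x y = 0) = (x = y)" if "x \<in> j ` K" "y \<in> j ` K" for x y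
        using that j by (auto simp: e_def)
      show "e x z \<le> e x y + e y z" if "x \<in> j ` K" "y \<in> j ` K" "z \<in> j ` K" for x y z
        using that j by (auto simp: e_def intro!: triangle)
    qed
  qed
  interpret KE: Metric_space12 K d "j ` K" e by unfold_locales
  have h: "homeomorphic_map mtopology E.mtopology j"
    by (rule KE.isometry_imp_homeomorphic_map) (use j in \<open>auto simp: e_def\<close>)
  have Ssub: "S \<subseteq> K" using sets.sets_into_space[OF S] by simp
  have "homeomorphic_map (subtopology mtopology S) (subtopology E.mtopology (j ` S)) j"
    by (rule homeomorphic_map_subtopologies[OF h]) (use Ssub in auto)
  then have "T homeomorphic_space subtopology E.mtopology (j ` S)"
    using T homeomorphic_space_trans homeomorphic_map_imp_homeomorphic_space by blast
  moreover have "compact_space E.mtopology"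
    using c homeomorphic_compact_space homeomorphic_map_imp_homeomorphic_space[OF h] by blast
  moreover have "j ` S \<in> sets (univ_borel E.mtopology)"
    by (rule universally_measurable_homeomorphic_image[OF h S])
  ultimately show ?thesis unfolding radon_space_def using E.Metric_space_axioms by blast
qed

section \<open>Transition functions and resolvents\<close>

text \<open>Only the values \<open>P t x\<close> with \<open>t \<ge> 0\<close> and \<open>x \<in> space M\<close> are meaningful.\<close>

definition markov_transition_function :: "'a measure \<Rightarrow> (real \<Rightarrow> 'a \<Rightarrow> 'a measure) \<Rightarrow> bool" where
  "markov_transition_function M P \<longleftrightarrow>
     (\<forall>t\<ge>0. P t \<in> M \<rightarrow>\<^sub>M prob_algebra M) \<and>
     (\<forall>t\<ge>0. \<forall>s\<ge>0. \<forall>x\<in>space M. \<forall>B\<in>sets M.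
        emeasure (P (t + s) x) B = (\<integral>\<^sup>+y. emeasure (P s y) B \<partial>P t x))"

definition normal_transition_function :: "'a measure \<Rightarrow> (real \<Rightarrow> 'a \<Rightarrow> 'a measure) \<Rightarrow> bool" where
  "normal_transition_function M P \<longleftrightarrow>
     (\<forall>x\<in>space M. \<forall>B\<in>sets M. emeasure (P 0 x) B = indicator B x)"

definition resolvent ::
  "(real \<Rightarrow> 'a \<Rightarrow> 'a measure) \<Rightarrow> real \<Rightarrow> ('a \<Rightarrow> ennreal) \<Rightarrow> 'a \<Rightarrow> ennreal" where
  "resolvent P \<alpha> f x = (\<integral>\<^sup>+t\<in>{0..}. ennreal (exp (- \<alpha> * t)) * (\<integral>\<^sup>+y. f y \<partial>P t x) \<partial>lebesgue)"

definition has_resolvent ::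
  "'a measure \<Rightarrow> (real \<Rightarrow> 'a \<Rightarrow> 'a measure) \<Rightarrow> (real \<Rightarrow> ('a \<Rightarrow> ennreal) \<Rightarrow> 'a \<Rightarrow> ennreal) \<Rightarrow> bool" where
  "has_resolvent M P V \<longleftrightarrow>
     (\<forall>\<alpha>>0. \<forall>f\<in>borel_measurable M. \<forall>x\<in>space M. resolvent P \<alpha> f x = V \<alpha> f x)"

text \<open>\<open>V\<close> is the restriction of \<open>U\<close> to the subspace \<open>topspace T - N\<close>: it may be computed from any
  measurable extension of the given function.\<close>

definition resolvent_restriction ::
  "'a topology \<Rightarrow> 'a set \<Rightarrow> (real \<Rightarrow> ('a \<Rightarrow> ennreal) \<Rightarrow> 'a \<Rightarrow> ennreal) \<Rightarrow>
     (real \<Rightarrow> ('a \<Rightarrow> ennreal) \<Rightarrow> 'a \<Rightarrow> ennreal) \<Rightarrow> bool" where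
  "resolvent_restriction T N U V \<longleftrightarrow>
     (\<forall>\<alpha>>0. \<forall>g\<in>borel_measurable (univ_borel (subtopology T (topspace T - N))).
        \<forall>f\<in>borel_measurable (univ_borel T).
          (\<forall>y\<in>topspace T - N. f y = g y) \<longrightarrow> (\<forall>x\<in>topspace T - N. V \<alpha> g x = U \<alpha> f x))"

definition weakly_negligible ::
  "'a topology \<Rightarrow> (real \<Rightarrow> ('a \<Rightarrow> ennreal) \<Rightarrow> 'a \<Rightarrow> ennreal) \<Rightarrow> 'a set \<Rightarrow> bool" where
  "weakly_negligible T U N \<longleftrightarrow> (\<exists>\<alpha>>0. \<forall>x\<in>topspace T - N. U \<alpha> (indicator N) x = 0)"

section \<open>Right continuous Markov processes\<close>

definition right_continuous_path :: "'a topology \<Rightarrow> (real \<Rightarrow> 'a) \<Rightarrow> bool" where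
  "right_continuous_path T w \<longleftrightarrow>
     (\<forall>t\<ge>0. w t \<in> topspace T) \<and> (\<forall>t\<ge>0. limitin T w (w t) (at_right t))"

definition markov_property ::
  "'a topology \<Rightarrow> (real \<Rightarrow> 'a \<Rightarrow> 'a measure) \<Rightarrow> 'w measure \<Rightarrow> (real \<Rightarrow> 'w measure) \<Rightarrow>
     (real \<Rightarrow> 'w \<Rightarrow> 'a) \<Rightarrow> bool" where
  "markov_property T P M G X \<longleftrightarrow>
     (\<forall>t\<ge>0. \<forall>s\<ge>0. \<forall>f :: 'a \<Rightarrow> real.
        f \<in> borel_measurable (univ_borel T) \<and> bounded (f ` topspace T) \<longrightarrow>
        (AE \<omega> in M. real_cond_exp M (G t) (\<lambda>\<omega>. f (X (t + s) \<omega>)) \<omega> = (\<integral>y. f y \<partial>P s (X t \<omega>))))"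

definition right_markov_realization ::
  "'a topology \<Rightarrow> (real \<Rightarrow> 'a \<Rightarrow> 'a measure) \<Rightarrow> 'a measure \<Rightarrow> 'w measure \<Rightarrow> (real \<Rightarrow> 'w measure) \<Rightarrow>
     (real \<Rightarrow> 'w \<Rightarrow> 'a) \<Rightarrow> bool" where
  "right_markov_realization T P \<mu> M G X \<longleftrightarrow>
     prob_space M \<and>
     (\<forall>t\<ge>0. subalgebra M (G t)) \<and>
     (\<forall>s t. 0 \<le> s \<and> s \<le> t \<longrightarrow> sets (G s) \<subseteq> sets (G t)) \<and>
     (\<forall>t\<ge>0. X t \<in> G t \<rightarrow>\<^sub>M univ_borel T) \<and>
     (\<forall>\<omega>\<in>space M. right_continuous_path T (\<lambda>t. X t \<omega>)) \<and>
     distr M (univ_borel T) (X 0) = \<mu> \<and>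
     markov_property T P M G X"

text \<open>HOL cannot quantify over the type carrying the sample space. The type \<open>real \<Rightarrow> 'a\<close> of
  paths loses nothing: by \<open>hd1I\<close> below, realizations on sample spaces of any type give
  \<open>hd1\<close>.\<close>

definition hd1 :: "'a topology \<Rightarrow> (real \<Rightarrow> 'a \<Rightarrow> 'a measure) \<Rightarrow> bool" where
  "hd1 T P \<longleftrightarrow>
     (\<forall>\<mu>. prob_space \<mu> \<and> sets \<mu> = sets (univ_borel T) \<longrightarrow>
        (\<exists>(M :: (real \<Rightarrow> 'a) measure) G X. right_markov_realization T P \<mu> M G X))"

section \<open>The canonical realization\<close>

text \<open>Maps defined on \<open>[0,\<infinity>)\<close> are represented by functions that are \<open>undefined\<close> at negative
  times.\<close>

definition path_space :: "'a topology \<Rightarrow> (real \<Rightarrow> 'a) set" where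
  "path_space T = {w \<in> extensional {0..}. right_continuous_path T w}"

definition path_filtration :: "'a topology \<Rightarrow> real \<Rightarrow> (real \<Rightarrow> 'a) measure" where
  "path_filtration T t = sigma (path_space T)
     {{w \<in> path_space T. w s \<in> B} | s B. 0 \<le> s \<and> s \<le> t \<and> B \<in> sets (univ_borel T)}"

definition path_algebra :: "'a topology \<Rightarrow> (real \<Rightarrow> 'a) measure" where
  "path_algebra T = sigma (path_space T)
     {{w \<in> path_space T. w s \<in> B} | s B. 0 \<le> s \<and> B \<in> sets (univ_borel T)}"

lemma space_path_filtration [simp]: "space (path_filtration T t) = path_space T"
  by (simp add: path_filtration_def space_measure_of_conv)

lemma space_path_algebra [simp]: "space (path_algebra T) = path_space T"
  by (simp add: path_algebra_def space_measure_of_conv)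

lemma sets_path_filtration:
  "sets (path_filtration T t) = sigma_sets (path_space T)
     {{w \<in> path_space T. w s \<in> B} | s B. 0 \<le> s \<and> s \<le> t \<and> B \<in> sets (univ_borel T)}"
  unfolding path_filtration_def by (rule sets_measure_of) auto

lemma sets_path_algebra:
  "sets (path_algebra T) = sigma_sets (path_space T)
     {{w \<in> path_space T. w s \<in> B} | s B. 0 \<le> s \<and> B \<in> sets (univ_borel T)}"
  unfolding path_algebra_def by (rule sets_measure_of) auto

lemma subalgebra_path_filtration: "subalgebra (path_algebra T) (path_filtration T t)"
  unfolding subalgebra_def sets_path_filtration sets_path_algebra
  by (auto intro!: sigma_sets_mono')

lemma sets_path_filtration_mono:
  "s \<le> t \<Longrightarrow> sets (path_filtration T s) \<subseteq> sets (path_filtration T t)"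
  unfolding sets_path_filtration by (intro sigma_sets_mono') force

lemma measurable_coordinate_filtration:
  assumes "0 \<le> s" "s \<le> t"
  shows "(\<lambda>w. w s) \<in> path_filtration T t \<rightarrow>\<^sub>M univ_borel T"
proof (rule measurableI)
  show "w s \<in> space (univ_borel T)" if "w \<in> space (path_filtration T t)" for w
    using that assms by (auto simp: path_space_def right_continuous_path_def)
  show "(\<lambda>w. w s) -` B \<inter> space (path_filtration T t) \<in> sets (path_filtration T t)"
    if "B \<in> sets (univ_borel T)" for B
  proof -
    have "(\<lambda>w. w s) -` B \<inter> space (path_filtration T t) = {w \<in> path_space T. w s \<in> B}"
      by auto
    also have "\<dots> \<in> sets (path_filtration T t)"
      unfolding sets_path_filtration using assms that by (intro sigma_sets.Basic) blast
    finally show ?thesis .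
  qed
qed

lemma measurable_coordinate:
  assumes "0 \<le> s"
  shows "(\<lambda>w. w s) \<in> path_algebra T \<rightarrow>\<^sub>M univ_borel T"
  using measurable_from_subalg[OF subalgebra_path_filtration measurable_coordinate_filtration[OF assms order_refl]] .

lemma right_markov_realization_path_space:
  assumes P: "markov_transition_function (univ_borel T) P"
    and R: "right_markov_realization T P \<mu> M G X"
  shows "right_markov_realization T P \<mu>
           (distr M (path_algebra T) (\<lambda>\<omega>. \<lambda>t\<in>{0..}. X t \<omega>)) (path_filtration T) (\<lambda>t w. w t)"
proof -
  define p where "p = (\<lambda>\<omega>. \<lambda>t\<in>{0..}. X t \<omega>)"
  define D where "D = distr M (path_algebra T) p"
  interpret M: prob_space M using R by (simp add: right_markov_realization_def)
  have sub: "subalgebra M (G t)" if "t \<ge> 0" for t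
    using R that by (simp add: right_markov_realization_def)
  have mono: "sets (G s) \<subseteq> sets (G t)" if "0 \<le> s" "s \<le> t" for s t
    using R that by (simp add: right_markov_realization_def)
  have X: "X t \<in> G t \<rightarrow>\<^sub>M univ_borel T" if "t \<ge> 0" for t
    using R that by (simp add: right_markov_realization_def)
  have XM: "X t \<in> M \<rightarrow>\<^sub>M univ_borel T" if "t \<ge> 0" for t
    using measurable_from_subalg[OF sub X] that by blast
  have rc: "right_continuous_path T (\<lambda>t. X t \<omega>)" if "\<omega> \<in> space M" for \<omega>
    using R that by (simp add: right_markov_realization_def)
  have mp: "markov_property T P M G X" and law: "distr M (univ_borel T) (X 0) = \<mu>"
    using R by (simp_all add: right_markov_realization_def)
  have p_space: "p \<omega> \<in> path_space T" if "\<omega> \<in> space M" for \<omega>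
  proof -
    have "limitin T (p \<omega>) (p \<omega> t) (at_right t)" if "t \<ge> 0" for t
    proof -
      have "eventually (\<lambda>s. X s \<omega> = p \<omega> s) (at_right t)"
        using that by (auto simp: p_def eventually_at_right_field intro!: exI[of _ "t + 1"])
      moreover have "limitin T (\<lambda>t. X t \<omega>) (p \<omega> t) (at_right t)"
        using rc[OF \<open>\<omega> \<in> space M\<close>] that by (simp add: right_continuous_path_def p_def)
      ultimately show ?thesis
        by (rule limitin_transform_eventually)
    qed
    then show ?thesis
      using rc[OF that] by (auto simp: path_space_def right_continuous_path_def p_def)
  qed
  have p_vimage: "p -` {w \<in> path_space T. w s \<in> B} \<inter> space M = X s -` B \<inter> space M"
    if "0 \<le> s" for s B
    using that p_space by (auto simp: p_def)
  have p_G: "p \<in> G t \<rightarrow>\<^sub>M path_filtration T t" if "t \<ge> 0" for t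
    unfolding path_filtration_def
  proof (rule measurable_measure_of)
    have sp: "space (G t) = space M" using sub[OF that] by (simp add: subalgebra_def)
    then show "p \<in> space (G t) \<rightarrow> path_space T" using p_space by auto
    show "p -` A \<inter> space (G t) \<in> sets (G t)"
      if A: "A \<in> {{w \<in> path_space T. w s \<in> B} | s B. 0 \<le> s \<and> s \<le> t \<and> B \<in> sets (univ_borel T)}" for A
    proof -
      obtain s B where s: "0 \<le> s" "s \<le> t" "B \<in> sets (univ_borel T)"
        and A: "A = {w \<in> path_space T. w s \<in> B}" using A by blast
      have "X s -` B \<inter> space M \<in> sets (G s)"
        using measurable_sets[OF X[OF s(1)] s(3)] sub[OF s(1)] by (simp add: subalgebra_def)
      then show ?thesis using mono[OF s(1,2)] p_vimage[OF s(1)] sp A by auto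
    qed
  qed auto
  have p: "p \<in> M \<rightarrow>\<^sub>M path_algebra T"
    unfolding path_algebra_def
  proof (rule measurable_measure_of)
    show "p \<in> space M \<rightarrow> path_space T" using p_space by auto
    show "p -` A \<inter> space M \<in> sets M"
      if "A \<in> {{w \<in> path_space T. w s \<in> B} | s B. 0 \<le> s \<and> B \<in> sets (univ_borel T)}" for A
      using that measurable_sets[OF XM] p_vimage by auto
  qed auto
  interpret D: prob_space D
    unfolding D_def by (rule M.prob_space_distr[OF p])
  have subD: "subalgebra D (path_filtration T t)" for t
    using subalgebra_path_filtration[of T t] by (simp add: subalgebra_def D_def)
  have "markov_property T P D (path_filtration T) (\<lambda>t w. w t)"
    unfolding markov_property_def
  proof (intro allI impI, elim conjE)
    fix t s :: real and f :: "'a \<Rightarrow> real"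
    assume t: "0 \<le> t" and s: "0 \<le> s" and f: "f \<in> borel_measurable (univ_borel T)"
      and bf: "bounded (f ` topspace T)"
    have ts: "0 \<le> t + s" using t s by simp
    obtain C where C: "\<And>x. x \<in> topspace T \<Longrightarrow> \<bar>f x\<bar> \<le> C"
      using bf by (auto simp: bounded_iff)
    have Ps: "P s \<in> univ_borel T \<rightarrow>\<^sub>M prob_algebra (univ_borel T)"
      using P s by (simp add: markov_transition_function_def)
    define g where "g = (\<lambda>x. \<integral>y. f y \<partial>P s x)"
    have g: "g \<in> borel_measurable (univ_borel T)"
      unfolding g_def
      by (rule measurable_compose[OF measurable_prob_algebraD[OF Ps] integral_measurable_subprob_algebra[OF f]])
    have gC: "\<bar>g x\<bar> \<le> C" if x: "x \<in> topspace T" for x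
    proof -
      have "P s x \<in> space (prob_algebra (univ_borel T))" using measurable_space[OF Ps] x by simp
      then have ps: "prob_space (P s x)" and sps: "sets (P s x) = sets (univ_borel T)"
        by (auto simp: space_prob_algebra)
      interpret Q: prob_space "P s x" by (rule ps)
      have spc: "space (P s x) = topspace T" using sets_eq_imp_space_eq[OF sps] by simp
      have fm: "f \<in> borel_measurable (P s x)" using f measurable_cong_sets[OF sps refl] by blast
      have "integrable (P s x) f"
        using fm C spc by (intro Q.integrable_const_bound[where B = C]) auto
      then have "\<bar>g x\<bar> \<le> (\<integral>y. \<bar>f y\<bar> \<partial>P s x)" unfolding g_def by (intro integral_abs_bound)
      also have "\<dots> \<le> (\<integral>y. C \<partial>P s x)"
        using \<open>integrable (P s x) f\<close> C spc by (intro integral_mono) auto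
      finally show ?thesis by (simp add: Q.prob_space)
    qed
    have Xt: "X u \<omega> \<in> topspace T" if "u \<ge> 0" "\<omega> \<in> space M" for u \<omega>
      using measurable_space[OF XM[OF that(1)] that(2)] by simp
    have fXM: "(\<lambda>\<omega>. f (X (t + s) \<omega>)) \<in> borel_measurable M"
      by (rule measurable_compose[OF XM[OF ts] f])
    have intM: "integrable M (\<lambda>\<omega>. f (X (t + s) \<omega>))"
      using fXM C Xt[OF ts] by (intro M.integrable_const_bound[where B = C]) auto
    have cD: "(\<lambda>w. w u) \<in> D \<rightarrow>\<^sub>M univ_borel T" if "0 \<le> u" for u
      using measurable_coordinate[OF that] by (simp add: D_def)
    have spD: "space D = path_space T" by (simp add: D_def)
    have wT: "w u \<in> topspace T" if "0 \<le> u" "w \<in> space D" for u w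
      using that by (auto simp: spD path_space_def right_continuous_path_def)
    have intD: "integrable D (\<lambda>w. f (w (t + s)))" "integrable D (\<lambda>w. g (w t))"
      using measurable_compose[OF cD[OF ts] f] measurable_compose[OF cD[OF t] g] C gC wT ts t
      by (auto intro!: D.integrable_const_bound[where B = C])
    interpret S: sigma_finite_subalgebra M "G t"
      by (intro finite_measure_subalgebra_is_sigma_finite)
         (simp add: finite_measure_subalgebra_def finite_measure_subalgebra_axioms_def
           M.finite_measure_axioms sub[OF t])
    interpret SD: sigma_finite_subalgebra D "path_filtration T t"
      by (intro finite_measure_subalgebra_is_sigma_finite)
         (simp add: finite_measure_subalgebra_def finite_measure_subalgebra_axioms_def
           D.finite_measure_axioms subD)
    have mpt: "AE \<omega> in M. real_cond_exp M (G t) (\<lambda>\<omega>. f (X (t + s) \<omega>)) \<omega> = g (X t \<omega>)"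
      using mp t s f bf unfolding markov_property_def g_def by blast
    have "(\<integral>w\<in>A. f (w (t + s)) \<partial>D) = (\<integral>w\<in>A. g (w t) \<partial>D)" if A: "A \<in> sets (path_filtration T t)" for A
    proof -
      have AD: "A \<in> sets (path_algebra T)"
        using A subalgebra_path_filtration[of T t] by (auto simp: subalgebra_def)
      have spG: "space (G t) = space M" using sub[OF t] by (simp add: subalgebra_def)
      define B where "B = p -` A \<inter> space M"
      have B: "B \<in> sets (G t)" using measurable_sets[OF p_G[OF t] A] by (simp add: B_def spG)
      then have BM: "B \<in> sets M" using sub[OF t] by (auto simp: subalgebra_def)
      have ind: "indicator A (p \<omega>) = (indicator B \<omega> :: real)" if "\<omega> \<in> space M" for \<omega>
        using that by (auto simp: B_def indicator_def)
      have tr: "(\<integral>w\<in>A. h (w u) \<partial>D) = (\<integral>\<omega>\<in>B. h (X u \<omega>) \<partial>M)"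
        if u: "0 \<le> u" and h: "h \<in> borel_measurable (univ_borel T)" for u and h :: "'a \<Rightarrow> real"
      proof -
        have hm: "(\<lambda>w. indicator A w *\<^sub>R h (w u)) \<in> borel_measurable (path_algebra T)"
          using measurable_compose[OF measurable_coordinate[OF u] h] AD by measurable
        have "(\<integral>w\<in>A. h (w u) \<partial>D) = (\<integral>\<omega>. indicator A (p \<omega>) *\<^sub>R h (p \<omega> u) \<partial>M)"
          unfolding set_lebesgue_integral_def D_def by (rule integral_distr[OF p hm])
        also have "\<dots> = (\<integral>\<omega>\<in>B. h (X u \<omega>) \<partial>M)"
          unfolding set_lebesgue_integral_def
          using u by (intro Bochner_Integration.integral_cong) (simp_all add: ind, simp add: p_def)
        finally show ?thesis .
      qed
      have "(\<integral>w\<in>A. f (w (t + s)) \<partial>D) = (\<integral>\<omega>\<in>B. f (X (t + s) \<omega>) \<partial>M)" by (rule tr[OF ts f])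
      also have "\<dots> = (\<integral>\<omega>\<in>B. real_cond_exp M (G t) (\<lambda>\<omega>. f (X (t + s) \<omega>)) \<omega> \<partial>M)"
        by (rule S.real_cond_exp_intA[OF intM B])
      also have "\<dots> = (\<integral>\<omega>\<in>B. g (X t \<omega>) \<partial>M)"
        unfolding set_lebesgue_integral_def
        using mpt measurable_compose[OF XM[OF t] g] BM
        by (intro integral_cong_AE) (auto simp: borel_measurable_cond_exp2)
      also have "\<dots> = (\<integral>w\<in>A. g (w t) \<partial>D)" by (rule tr[OF t g, symmetric])
      finally show ?thesis .
    qed
    then have "AE w in D. real_cond_exp D (path_filtration T t) (\<lambda>w. f (w (t + s))) w = g (w t)"
      by (intro SD.real_cond_exp_charact intD)
         (auto intro!: measurable_compose[OF measurable_coordinate_filtration[OF t order_refl] g])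
    then show "AE w in D. real_cond_exp D (path_filtration T t) (\<lambda>w. f (w (t + s))) w = (\<integral>y. f y \<partial>P s (w t))"
      by (simp add: g_def)
  qed
  moreover have "distr D (univ_borel T) (\<lambda>w. w 0) = \<mu>"
  proof -
    have "distr D (univ_borel T) (\<lambda>w. w 0) = distr M (univ_borel T) ((\<lambda>w. w 0) \<circ> p)"
      unfolding D_def by (rule distr_distr[OF measurable_coordinate p]) simp
    also have "\<dots> = distr M (univ_borel T) (X 0)"
      by (rule distr_cong) (auto simp: p_def)
    finally show ?thesis using law by simp
  qed
  ultimately have "right_markov_realization T P \<mu> D (path_filtration T) (\<lambda>t w. w t)"
    unfolding right_markov_realization_def
    using D.prob_space_axioms subD
    by (auto simp: D_def path_space_def intro: subsetD[OF sets_path_filtration_mono]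
        measurable_coordinate_filtration)
  then show ?thesis by (simp add: D_def p_def)
qed

lemma hd1I:
  assumes "markov_transition_function (univ_borel T) P"
    and "\<And>\<mu>. prob_space \<mu> \<Longrightarrow> sets \<mu> = sets (univ_borel T) \<Longrightarrow>
           \<exists>(M :: 'w measure) G X. right_markov_realization T P \<mu> M G X"
  shows "hd1 T P"
  unfolding hd1_def using assms right_markov_realization_path_space by blast

definition canonical_realization ::
  "'a topology \<Rightarrow> (real \<Rightarrow> 'a \<Rightarrow> 'a measure) \<Rightarrow> ('a \<Rightarrow> (real \<Rightarrow> 'a) measure) \<Rightarrow> bool" where
  "canonical_realization T P PX \<longleftrightarrow>
     (\<forall>x\<in>topspace T.
        prob_space (PX x) \<and> sets (PX x) = sets (path_algebra T) \<and>
        emeasure (PX x) {w \<in> path_space T. w 0 = x} = 1 \<and>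
        markov_property T P (PX x) (path_filtration T) (\<lambda>t w. w t))"

text \<open>\<open>\<mu> \<bind> PX\<close> is the law \<open>\<integral>\<mu>(dx) PX x\<close> on path space.\<close>

definition quasi_absorbing :: "'a topology \<Rightarrow> ('a \<Rightarrow> (real \<Rightarrow> 'a) measure) \<Rightarrow> 'a set \<Rightarrow> bool" where
  "quasi_absorbing T PX A \<longleftrightarrow>
     (\<forall>\<mu>. prob_space \<mu> \<and> sets \<mu> = sets (univ_borel T) \<and> emeasure \<mu> (topspace T - A) = 0 \<longrightarrow>
        outer_measure_of (\<mu> \<bind> PX) {w \<in> path_space T. \<forall>t\<ge>0. w t \<in> A} = 1)"

end

theory Submission
  imports Defs
begin

text \<open>If a process with right continuous paths in \<open>E - N\<close> has resolvent \<open>U'\<close>, then for continuous \<open>f\<close> and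
  \<open>x \<notin> N\<close> the right continuous functions \<open>t \<mapsto> P t f x\<close> and \<open>t \<mapsto> P' t f x\<close> have the same Laplace transform, so
  \<open>P'\<close> is the restriction of \<open>P\<close>. Hence the law of that process, seen as a process in \<open>E\<close>, is the
  canonical one, and every measurable set of paths that contains all paths in \<open>E - N\<close> has full measure.
  Conversely, if the paths in \<open>E - N\<close> have full outer measure, then the canonical measure has a trace on
  them, and the coordinate process under this trace is a realization of the restriction of \<open>P\<close>.\<close>

section \<open>Universally measurable sets\<close>

text \<open>Three obstacles shape the proof. A resolvent sees a function of time only up to null
  sets of times, so equality at every t needs right continuity; a transition function has none by
  itself, and (HD1) supplies it through a realization started at the point in question. This forces
  continuous test functions, which suffice because the space is metrizable and because, for each
  finite measure, a universally measurable set differs from a Borel set by a null set. Secondly, the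
  set of paths in E - N is an uncountable intersection of events and in general not measurable, so
  it is accessible only through the measurable sets that contain it. Thirdly, E and E - N each carry
  their own universally measurable sets; every passage between the two state spaces rests on
  \<open>sets_univ_borel_subtopology\<close>, by which the smaller \<sigma>-algebra is the trace of
  the larger.\<close>

lemma sets_borel_of_subset_univ_borel: "sets (borel_of T) \<subseteq> sets (univ_borel T)"
  unfolding sets_univ_borel universally_measurable_sets_def
  using sets.sets_into_space by fastforce

lemma openin_sets_univ_borel: "openin T U \<Longrightarrow> U \<in> sets (univ_borel T)"
  using sets_borel_of_subset_univ_borel by (force simp: sets_borel_of)

lemma continuous_map_borel_measurable_univ_borel:
  assumes "continuous_map T euclideanreal f"
  shows "f \<in> borel_measurable (univ_borel T)"
  using assms
  by (intro borel_measurableI)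
     (auto intro!: openin_sets_univ_borel simp: continuous_map_def vimage_def Collect_conj_eq Int_commute)

lemma sets_borel_of_subtopology:
  assumes "S \<subseteq> topspace T"
  shows "sets (borel_of (subtopology T S)) = sets (restrict_space (borel_of T) S)"
proof -
  have "sets (restrict_space (borel_of T) S) = sets (vimage_algebra S (\<lambda>x. x) (borel_of T))"
    using assms restrict_space_eq_vimage_algebra by (metis space_borel_of)
  also have "\<dots> = sets (sigma S {(\<lambda>x. x) -` A \<inter> S | A. A \<in> {U. openin T U}})"
    unfolding borel_of_def using assms openin_subset by (subst vimage_algebra_sigma) blast+
  also have "{(\<lambda>x. x) -` A \<inter> S | A. A \<in> {U. openin T U}} = {U. openin (subtopology T S) U}"
    by (auto simp: openin_subtopology)
  finally show ?thesis using assms by (simp add: borel_of_def Int_absorb1)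
qed

lemma sets_univ_borel_completion:
  \<comment> \<open>Universal measurability speaks of measures on the Borel sets, whereas \<mu>
    lives on the larger \<sigma>-algebra. So \<mu> is first restricted to the Borel sets, and the
    completion of that restriction sandwiches B.\<close>
  assumes B: "B \<in> sets (univ_borel T)" and \<mu>: "finite_measure \<mu>" and s: "sets \<mu> = sets (univ_borel T)"
  obtains A N where "A \<in> sets (borel_of T)" "N \<in> sets (borel_of T)" "A \<subseteq> B" "B - A \<subseteq> N" "emeasure \<mu> N = 0"
proof -
  have sub: "subalgebra \<mu> (borel_of T)"
    using sets_borel_of_subset_univ_borel sets_eq_imp_space_eq[OF s] s by (auto simp: subalgebra_def)
  interpret finite_measure \<mu> by fact
  have "finite_measure (restr_to_subalg \<mu> (borel_of T))"
    using sub sets.top[of "borel_of T"]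
    by (intro finite_measureI) (simp add: space_restr_to_subalg subalgebra_def emeasure_restr_to_subalg[OF sub])
  then have "B \<in> sets (completion (restr_to_subalg \<mu> (borel_of T)))"
    using B sub by (simp add: sets_univ_borel universally_measurable_sets_def sets_restr_to_subalg)
  then obtain A N N' where *: "B = A \<union> N" "N \<subseteq> N'" "N' \<in> null_sets (restr_to_subalg \<mu> (borel_of T))"
    "A \<in> sets (restr_to_subalg \<mu> (borel_of T))" by (rule sets_completionE)
  moreover have "N' \<in> sets (borel_of T)" "emeasure \<mu> N' = 0"
    using *(3) sub by (auto simp: null_sets_def sets_restr_to_subalg emeasure_restr_to_subalg)
  ultimately show ?thesis using that[of A N'] sub by (auto simp: sets_restr_to_subalg)
qed

text \<open>Open sets form an intersection stable generator of the Borel sets. Beyond these, the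
  sandwich found for \<mu> serves \<nu> as well: its error set is Borel, hence null for
  both.\<close>

lemma measure_eqI_univ_borel:
  assumes fin: "finite_measure \<mu>" "finite_measure \<nu>"
    and s: "sets \<mu> = sets (univ_borel T)" "sets \<nu> = sets (univ_borel T)"
    and eq: "\<And>U. openin T U \<Longrightarrow> emeasure \<mu> U = emeasure \<nu> U"
  shows "\<mu> = \<nu>"
proof -
  have sub: "subalgebra \<mu> (borel_of T)" "subalgebra \<nu> (borel_of T)"
    using sets_borel_of_subset_univ_borel sets_eq_imp_space_eq[OF s(1)] sets_eq_imp_space_eq[OF s(2)] s
    by (auto simp: subalgebra_def)
  interpret \<mu>: finite_measure \<mu> by fact
  have "restr_to_subalg \<mu> (borel_of T) = restr_to_subalg \<nu> (borel_of T)"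
  proof (rule measure_eqI_generator_eq[where \<Omega> = "topspace T" and E = "{U. openin T U}" and A = "\<lambda>_. topspace T"])
    show "Int_stable {U. openin T U}" by (auto simp: Int_stable_def)
    show "{U. openin T U} \<subseteq> Pow (topspace T)" using openin_subset by auto
    show "emeasure (restr_to_subalg \<mu> (borel_of T)) X = emeasure (restr_to_subalg \<nu> (borel_of T)) X"
      if "X \<in> {U. openin T U}" for X
      using that eq sub by (auto simp: emeasure_restr_to_subalg sets_borel_of)
    show "emeasure (restr_to_subalg \<mu> (borel_of T)) (topspace T) \<noteq> \<infinity>"
      using sets.top[of "borel_of T"] by (simp add: emeasure_restr_to_subalg sub)
  qed (use sub in \<open>auto simp: sets_restr_to_subalg sets_borel_of\<close>)
  then have borel: "emeasure \<mu> A = emeasure \<nu> A" if "A \<in> sets (borel_of T)" for A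
    using that sub by (metis emeasure_restr_to_subalg)
  show ?thesis
  proof (rule measure_eqI)
    show "sets \<mu> = sets \<nu>" using s by simp
    fix B assume "B \<in> sets \<mu>"
    then have B: "B \<in> sets (univ_borel T)" using s by simp
    obtain A N where AN: "A \<in> sets (borel_of T)" "N \<in> sets (borel_of T)" "A \<subseteq> B" "B - A \<subseteq> N" "emeasure \<mu> N = 0"
      using sets_univ_borel_completion[OF B fin(1) s(1)] by blast
    have ANu: "A \<in> sets (univ_borel T)" "N \<in> sets (univ_borel T)"
      using AN sets_borel_of_subset_univ_borel by auto
    have "emeasure m B = emeasure m A" if m: "sets m = sets (univ_borel T)" "emeasure m N = 0" for m
    proof (rule antisym)
      have "emeasure m B \<le> emeasure m (A \<union> N)" using AN ANu m by (intro emeasure_mono) auto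
      also have "\<dots> = emeasure m A" using ANu m by (intro emeasure_Un_null_set) auto
      finally show "emeasure m B \<le> emeasure m A" .
      show "emeasure m A \<le> emeasure m B" using AN B m by (intro emeasure_mono) auto
    qed
    from this[OF s(1)] this[OF s(2)] borel AN show "emeasure \<mu> B = emeasure \<nu> B" by metis
  qed
qed

text \<open>Measures are moved along the inclusion: those on S are pushed forward to T for one
  inclusion of \<sigma>-algebras, those on T are restricted to S for the other.\<close>

lemma sets_univ_borel_subtopology:
  assumes S: "S \<in> sets (univ_borel T)"
  shows "sets (univ_borel (subtopology T S)) = sets (restrict_space (univ_borel T) S)"
proof -
  have ST: "S \<subseteq> topspace T" using sets.sets_into_space[OF S] by simp
  have tS: "topspace (subtopology T S) = S" using ST by (simp add: Int_absorb1)
  have inc: "(\<lambda>x. x) \<in> m \<rightarrow>\<^sub>M borel_of T" if "sets m = sets (borel_of (subtopology T S))" for m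
  proof -
    have "(\<lambda>x. x) \<in> restrict_space (borel_of T) S \<rightarrow>\<^sub>M borel_of T" by (rule measurable_restrict_space1) simp
    then show ?thesis using measurable_cong_sets[OF _ refl] that sets_borel_of_subtopology[OF ST] by metis
  qed
  have sub: "B \<in> sets (univ_borel (subtopology T S))" if B: "B \<in> sets (univ_borel T)" "B \<subseteq> S" for B
  proof -
    have "B \<in> sets (completion m)" if m: "finite_measure m" "sets m = sets (borel_of (subtopology T S))" for m
    proof -
      let ?n = "distr m (borel_of T) (\<lambda>x. x)"
      have spm: "space m = S" using sets_eq_imp_space_eq[OF m(2)] tS by simp
      have "finite_measure ?n" using m inc by (intro finite_measure.finite_measure_distr)
      then have "B \<in> sets (completion ?n)"
        using B by (simp add: sets_univ_borel universally_measurable_sets_def)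
      then obtain A N N' where *: "B = A \<union> N" "N \<subseteq> N'" "N' \<in> null_sets ?n" "A \<in> sets ?n"
        by (rule sets_completionE)
      have "A \<inter> S \<in> sets m" using measurable_sets[OF inc[OF m(2)], of A] *(4) spm by (simp add: vimage_def Int_def)
      moreover have "N' \<inter> S \<in> null_sets m"
        using *(3) unfolding null_sets_distr_iff[OF inc[OF m(2)]] by (simp add: spm)
      moreover have "B = (A \<inter> S) \<union> N" using * B(2) by auto
      moreover have "N \<subseteq> N' \<inter> S" using * B(2) by auto
      ultimately show ?thesis using sets_completionI by metis
    qed
    then show ?thesis using B(2) tS by (simp add: sets_univ_borel universally_measurable_sets_def)
  qed
  have sup: "B \<in> sets (univ_borel T)" if B: "B \<in> sets (univ_borel (subtopology T S))" for B
  proof -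
    have BS: "B \<subseteq> S" using sets.sets_into_space[OF B] tS by simp
    have "B \<in> sets (completion m)" if m: "finite_measure m" "sets m = sets (borel_of T)" for m
    proof -
      have Sm: "S \<in> sets (completion m)"
        using S m by (simp add: sets_univ_borel universally_measurable_sets_def)
      \<comment> \<open>\<open>S\<close> need not be Borel, but the completion of \<open>m\<close>
        measures it; hence the completion, and not \<open>m\<close>, is restricted to
        \<open>S\<close>.\<close>
      interpret m: finite_measure m by (rule m(1))
      let ?r = "restrict_space (completion m) S"
      have bm: "sets (borel_of T) \<subseteq> sets (completion m)" using m(2) by auto
      have inc': "(\<lambda>x. x) \<in> ?r \<rightarrow>\<^sub>M borel_of (subtopology T S)"
      proof (rule measurableI)
        show "x \<in> space ?r \<Longrightarrow> x \<in> space (borel_of (subtopology T S))" for x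
          using tS by (simp add: space_restrict_space)
        fix A assume "A \<in> sets (borel_of (subtopology T S))"
        then obtain C where "C \<in> sets (borel_of T)" "A = S \<inter> C"
          unfolding sets_borel_of_subtopology[OF ST] sets_restrict_space by auto
        then show "(\<lambda>x. x) -` A \<inter> space ?r \<in> sets ?r"
          using bm sets_eq_imp_space_eq[OF m(2)] ST
          by (auto simp: sets_restrict_space space_restrict_space intro!: image_eqI[of _ _ C])
      qed
      let ?n = "distr ?r (borel_of (subtopology T S)) (\<lambda>x. x)"
      have "finite_measure ?r"
      proof (intro finite_measureI)
        have "S \<subseteq> space m" using sets.sets_into_space[OF Sm] by simp
        then show "emeasure ?r (space ?r) \<noteq> \<infinity>"
          using Sm by (simp add: emeasure_restrict_space space_restrict_space Int_absorb2)
      qed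
      then have "finite_measure ?n" using inc' by (rule finite_measure.finite_measure_distr)
      then have "B \<in> sets (completion ?n)"
        using B by (simp add: sets_univ_borel universally_measurable_sets_def)
      then obtain A N N' where *: "B = A \<union> N" "N \<subseteq> N'" "N' \<in> null_sets ?n" "A \<in> sets ?n"
        by (rule sets_completionE)
      have srs: "sets ?r \<subseteq> sets (completion m)" by (rule sets_restrict_space_subset[OF Sm])
      have "S \<subseteq> space m" using sets.sets_into_space[OF Sm] by simp
      then have "(\<lambda>x. x) -` A \<inter> space ?r = A" using *(1) BS by (auto simp: space_restrict_space)
      then have "A \<in> sets (completion m)"
        using measurable_sets[OF inc', of A] *(4) srs by auto
      moreover have "(\<lambda>x. x) -` N' \<inter> space ?r \<in> null_sets ?r"
        using *(3) unfolding null_sets_distr_iff[OF inc'] by blast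
      then have "N' \<inter> space ?r \<in> null_sets (completion m)"
        using Sm by (simp add: null_sets_restrict_space)
      then have "N \<in> null_sets (completion m)"
        using *(1,2) BS Sm sets.sets_into_space[OF Sm]
        by (intro null_sets_completion_subset[of N "N' \<inter> space ?r"]) (auto simp: space_restrict_space)
      ultimately show ?thesis using *(1) by auto
    qed
    then show ?thesis using BS ST by (simp add: sets_univ_borel[of T] universally_measurable_sets_def)
  qed
  have iff: "B \<in> sets (restrict_space (univ_borel T) S) \<longleftrightarrow> B \<subseteq> S \<and> B \<in> sets (univ_borel T)" for B
    using S ST by (intro sets_restrict_space_iff) (simp add: Int_absorb2)
  have "B \<subseteq> S" if "B \<in> sets (univ_borel (subtopology T S))" for B
    using sets.sets_into_space[OF that] tS by simp
  with sub sup show ?thesis unfolding set_eq_iff iff by blast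
qed

section \<open>Measures determined by continuous functions\<close>

lemma radon_space_imp_metrizable: "radon_space T \<Longrightarrow> metrizable_space T"
  unfolding radon_space_def
  using Metric_space.metrizable_space_mtopology homeomorphic_metrizable_space metrizable_space_subtopology
  by blast

text \<open>An open set of a metrizable space is an increasing union of closed sets, so Urysohn
  functions converge pointwise to its indicator, and dominated convergence gives its
  measure.\<close>

lemma measure_eqI_continuous_map:
  assumes T: "metrizable_space T"
    and fin: "finite_measure \<mu>" "finite_measure \<nu>"
    and s: "sets \<mu> = sets (univ_borel T)" "sets \<nu> = sets (univ_borel T)"
    and eq: "\<And>f. continuous_map T euclideanreal f \<Longrightarrow> (\<And>x. x \<in> topspace T \<Longrightarrow> 0 \<le> f x \<and> f x \<le> 1) \<Longrightarrow>
       (\<integral>x. f x \<partial>\<mu>) = (\<integral>x. f x \<partial>\<nu>)"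
  shows "\<mu> = \<nu>"
proof (rule measure_eqI_univ_borel[OF fin s])
  fix U assume U: "openin T U"
  then obtain C where C: "\<And>n. closedin T (C n)" "\<And>n. C n \<subseteq> C (Suc n)" "\<Union> (range C) = U"
    using open_imp_fsigma_in[OF T U] unfolding fsigma_in_ascending by blast
  have "\<exists>f. continuous_map T (top_of_set {0..1}) f \<and> f ` (topspace T - U) \<subseteq> {0} \<and> f ` C n \<subseteq> {1::real}" for n
  proof -
    have "normal_space T" by (rule metrizable_imp_normal_space[OF T])
    moreover have "closedin T (topspace T - U)" using U by auto
    moreover have "disjnt (topspace T - U) (C n)" using C(3) by (auto simp: disjnt_def)
    ultimately show ?thesis using C(1) unfolding normal_space_iff_Urysohn by blast
  qed
  then obtain f where f: "\<And>n. continuous_map T (top_of_set {0..1}) (f n)"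
    "\<And>n. f n ` (topspace T - U) \<subseteq> {0}" "\<And>n. f n ` C n \<subseteq> {1::real}" by metis
  have fc: "continuous_map T euclideanreal (f n)" and f01: "x \<in> topspace T \<Longrightarrow> 0 \<le> f n x \<and> f n x \<le> 1" for n x
    using f(1)[of n] by (auto simp: continuous_map_in_subtopology)
  have lim: "(\<lambda>n. f n x) \<longlonglongrightarrow> indicator U x" if x: "x \<in> topspace T" for x
  proof (cases "x \<in> U")
    case True
    then obtain k where k: "x \<in> C k" using C(3) by auto
    have "x \<in> C n" if "k \<le> n" for n using lift_Suc_mono_le[of C k n] C(2) that k by blast
    then have "f n x = 1" if "k \<le> n" for n using f(3)[of n] that by blast
    then show ?thesis using True by (intro tendsto_eventually) (auto simp: eventually_sequentially)
  next
    case False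
    then have "f n x = 0" for n using f(2)[of n] x by blast
    then show ?thesis using False by simp
  qed
  have conv: "(\<lambda>n. \<integral>x. f n x \<partial>m) \<longlonglongrightarrow> measure m U"
    if m: "finite_measure m" "sets m = sets (univ_borel T)" for m
  proof -
    interpret finite_measure m by fact
    have sp: "space m = topspace T" using sets_eq_imp_space_eq[OF m(2)] by simp
    have Um: "U \<in> sets m" using openin_sets_univ_borel[OF U] m by simp
    have "(\<lambda>n. \<integral>x. f n x \<partial>m) \<longlonglongrightarrow> (\<integral>x. indicator U x \<partial>m)"
    proof (rule integral_dominated_convergence[where w = "\<lambda>_. 1"])
      show "f n \<in> borel_measurable m" for n
        using continuous_map_borel_measurable_univ_borel[OF fc] measurable_cong_sets[OF m(2) refl] by blast
      show "AE x in m. (\<lambda>n. f n x) \<longlonglongrightarrow> indicator U x" using lim sp by (intro AE_I2) auto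
      show "AE x in m. norm (f n x) \<le> 1" for n using f01 sp by (intro AE_I2) auto
    qed (use Um in auto)
    then show ?thesis using Um sets.sets_into_space[OF Um] by (simp add: Int_absorb2)
  qed
  have "(\<integral>x. f n x \<partial>\<mu>) = (\<integral>x. f n x \<partial>\<nu>)" for n by (rule eq[OF fc f01])
  then have "measure \<mu> U = measure \<nu> U"
    using LIMSEQ_unique conv[OF fin(1) s(1)] conv[OF fin(2) s(2)] by simp
  then show "emeasure \<mu> U = emeasure \<nu> U"
    using fin by (simp add: finite_measure.emeasure_eq_measure)
qed

section \<open>Uniqueness of Laplace transforms\<close>

text \<open>By right continuity f is the limit of step functions that sample it on ever finer grids,
  each time at a grid point strictly to the right.\<close>

lemma borel_measurable_right_continuous:
  fixes f :: "real \<Rightarrow> real"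
  assumes "\<And>t. 0 \<le> t \<Longrightarrow> (f \<longlongrightarrow> f t) (at_right t)"
  shows "(\<lambda>t. indicator {0..} t * f t) \<in> borel_measurable borel"
proof (rule borel_measurable_LIMSEQ_real)
  \<comment> \<open>The \<open>+ 1\<close> makes the sampling point strictly larger than t even when
    t lies on the grid, as convergence along \<open>at_right t\<close> requires.\<close>
  define r where "r n t = (of_int \<lfloor>real (Suc n) * t\<rfloor> + 1) / real (Suc n)" for n and t :: real
  fix t :: real
  show "(\<lambda>n. indicator {0..} t * f (r n t)) \<longlonglongrightarrow> indicator {0..} t * f t"
  proof (cases "0 \<le> t")
    case True
    have r: "t < r n t" "r n t \<le> t + 1 / real (Suc n)" for n
    proof -
      have "real (Suc n) * t < of_int \<lfloor>real (Suc n) * t\<rfloor> + 1" by linarith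
      then show "t < r n t" unfolding r_def by (simp add: pos_less_divide_eq mult.commute)
      have "of_int \<lfloor>real (Suc n) * t\<rfloor> + 1 \<le> real (Suc n) * t + 1" by linarith
      then have "r n t \<le> (real (Suc n) * t + 1) / real (Suc n)"
        unfolding r_def by (intro divide_right_mono) auto
      also have "\<dots> = t + 1 / real (Suc n)" by (simp add: add_divide_distrib)
      finally show "r n t \<le> t + 1 / real (Suc n)" .
    qed
    have "(\<lambda>n. t + 1 / real (Suc n)) \<longlonglongrightarrow> t + 0"
      by (rule tendsto_add[OF tendsto_const LIMSEQ_Suc[OF lim_1_over_n]])
    then have lim: "(\<lambda>n. t + 1 / real (Suc n)) \<longlonglongrightarrow> t" by simp
    have "(\<lambda>n. r n t) \<longlonglongrightarrow> t"
    proof (rule tendsto_sandwich[OF _ _ tendsto_const lim])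
      show "\<forall>\<^sub>F n in sequentially. t \<le> r n t" using r(1) less_imp_le by (intro always_eventually) blast
      show "\<forall>\<^sub>F n in sequentially. r n t \<le> t + 1 / real (Suc n)" using r(2) by (intro always_eventually) blast
    qed
    moreover have "\<forall>\<^sub>F n in sequentially. r n t \<in> {t<..} \<and> r n t \<noteq> t"
      using r(1) by (intro always_eventually) (metis greaterThan_iff less_irrefl)
    ultimately have "filterlim (\<lambda>n. r n t) (at_right t) sequentially"
      unfolding filterlim_at by blast
    then have "(\<lambda>n. f (r n t)) \<longlonglongrightarrow> f t"
      by (rule filterlim_compose[OF assms[OF True]])
    then show ?thesis by (intro tendsto_intros)
  qed simp
next
  fix n
  \<comment> \<open>The approximant depends on t only through an integer, and every map out of
    \<open>count_space UNIV\<close> is measurable.\<close>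
  have "(\<lambda>t. f ((of_int \<lfloor>real (Suc n) * t\<rfloor> + 1) / real (Suc n))) \<in> borel_measurable borel"
    by (rule measurable_compose[where N="count_space UNIV" and f="\<lambda>t. \<lfloor>real (Suc n) * t\<rfloor>"
      and g = "\<lambda>k. f ((of_int k + 1) / real (Suc n))"]) auto
  then show "(\<lambda>t. indicator {0..} t * f ((of_int \<lfloor>real (Suc n) * t\<rfloor> + 1) / real (Suc n))) \<in> borel_measurable borel"
    by (intro borel_measurable_times) auto
qed

lemma integrable_exp_half_line:
  assumes "(a::real) > 0"
  shows "integrable lborel (\<lambda>t. indicator {0..} t * exp (- a * t))"
proof -
  have "integrable lborel (\<lambda>t. indicator {0<..} t * exp (- a * t))"
    using integrable_I0i_exp_mscale[OF assms] by (simp add: set_integrable_def mult.commute)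
  moreover have "AE t in lborel. indicator {0<..} t * exp (- a * t) = indicator {0..} t * exp (- a * t)"
    using AE_lborel_singleton[of 0] by eventually_elim (auto simp: indicator_def)
  ultimately show ?thesis by (subst integrable_cong_AE[symmetric]) auto
qed

text \<open>Under \<open>u = exp (- t)\<close> the Laplace transform at the integers gives the moments of a bounded
  signed measure on \<open>[0, 1]\<close>.\<close>

lemma laplace_orthogonal_continuous:
  fixes h :: "real \<Rightarrow> real"
  assumes h: "h \<in> borel_measurable lborel" and C: "\<And>t. \<bar>h t\<bar> \<le> C"
    and L: "\<And>n. (\<integral>t. indicator {0..} t * exp (- real (Suc n) * t) * h t \<partial>lborel) = 0"
    and g: "continuous_on UNIV g"
  shows "(\<integral>t. indicator {0..} t * exp (- t) * h t * g (exp (- t)) \<partial>lborel) = 0"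
proof -
  let ?w = "\<lambda>t. indicator {0..} t * exp (- t) :: real"
  have w: "integrable lborel ?w" using integrable_exp_half_line[of 1] by simp
  have C0: "0 \<le> C" using C[of 0] by linarith
  have gm[measurable]: "g \<in> borel_measurable borel" by (rule borel_measurable_continuous_onI[OF g])
  have hm[measurable]: "h \<in> borel_measurable borel" using h by simp
  have wh: "integrable lborel (\<lambda>t. ?w t * h t)"
    by (rule Bochner_Integration.integrable_bound[OF integrable_mult_right[OF w, of C]])
       (use C C0 in \<open>auto simp: abs_mult indicator_def mult.commute intro: mult_right_mono\<close>)
  have bound: "integrable lborel (\<lambda>t. ?w t * h t * k (exp (- t)))"
    if k: "continuous_on UNIV k" for k :: "real \<Rightarrow> real"
  proof -
    have [measurable]: "k \<in> borel_measurable borel" by (rule borel_measurable_continuous_onI[OF k])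
    \<comment> \<open>Only [0, 1] matters, since exp (- t) lies there for t >= 0 and the weight
      vanishes for t < 0.\<close>
    have "compact (k ` {0..1})" using k by (intro compact_continuous_image) (auto intro: continuous_on_subset)
    then obtain B where B: "\<And>x. x \<in> {0..1} \<Longrightarrow> \<bar>k x\<bar> \<le> B"
      by (meson compact_imp_bounded bounded_real imageI)
    have B0: "0 \<le> B" using B[of 0] by auto
    show ?thesis
    proof (rule Bochner_Integration.integrable_bound[OF integrable_mult_right[OF w, of "C * B"]])
      show "AE t in lborel. norm (?w t * h t * k (exp (- t))) \<le> norm (C * B * ?w t)"
      proof (rule AE_I2)
        fix t :: real
        show "norm (?w t * h t * k (exp (- t))) \<le> norm (C * B * ?w t)"
        proof (cases "0 \<le> t")
          case True
          have "\<bar>h t\<bar> * \<bar>k (exp (- t))\<bar> \<le> C * B"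
            using True C C0 by (intro mult_mono B) auto
          then show ?thesis using True C0 B0 by (simp add: abs_mult mult.commute mult.left_commute)
        qed simp
      qed
    qed measurable
  qed
  have poly: "(\<integral>t. ?w t * h t * (\<Sum>i\<le>n. a i * exp (- t) ^ i) \<partial>lborel) = 0" for n and a :: "nat \<Rightarrow> real"
  proof -
    have "(\<integral>t. ?w t * h t * (\<Sum>i\<le>n. a i * exp (- t) ^ i) \<partial>lborel)
        = (\<integral>t. (\<Sum>i\<le>n. a i * (?w t * h t * exp (- t) ^ i)) \<partial>lborel)"
      by (intro Bochner_Integration.integral_cong) (auto simp: sum_distrib_left mult_ac)
    also have "\<dots> = (\<Sum>i\<le>n. \<integral>t. a i * (?w t * h t * exp (- t) ^ i) \<partial>lborel)"
      by (intro Bochner_Integration.integral_sum integrable_mult_right bound continuous_intros)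
    also have "\<dots> = (\<Sum>i\<le>n. a i * (\<integral>t. indicator {0..} t * exp (- real (Suc i) * t) * h t \<partial>lborel))"
    \<comment> \<open>One factor exp (- t) comes from the weight and i from the monomial, so the
      i-th moment is the transform at \<open>Suc i\<close>.\<close>
    proof (intro sum.cong refl)
      fix i
      have "?w t * h t * exp (- t) ^ i = indicator {0..} t * exp (- real (Suc i) * t) * h t" for t
      proof -
        have "exp (- t) ^ i = exp (real i * - t)" by (rule exp_of_nat_mult[symmetric])
        moreover have "exp (- real (Suc i) * t) = exp (- t) * exp (real i * - t)"
          by (simp add: exp_add[symmetric] left_diff_distrib)
        ultimately show ?thesis by (simp only: mult_ac)
      qed
      then show "(\<integral>t. a i * (?w t * h t * exp (- t) ^ i) \<partial>lborel)
        = a i * (\<integral>t. indicator {0..} t * exp (- real (Suc i) * t) * h t \<partial>lborel)" by (simp only: integral_mult_right_zero)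
    qed
    finally show ?thesis using L by simp
  qed
  let ?I = "\<integral>t. ?w t * h t * g (exp (- t)) \<partial>lborel"
  define W where "W = (\<integral>t. C * ?w t \<partial>lborel)"
  have W0: "0 \<le> W" unfolding W_def using C0 by (intro Bochner_Integration.integral_nonneg) auto
  have le: "\<bar>?I\<bar> \<le> e" if e: "0 < e" for e
  proof -
    \<comment> \<open>\<open>W\<close> bounds the integral of the weighted |h|; with
      \<open>W + 1\<close> the quotient makes sense also when \<open>W\<close> is 0.\<close>
    define e' where "e' = e / (W + 1)"
    have e': "0 < e'" using e W0 by (simp add: e'_def)
    obtain p where p: "real_polynomial_function p" "\<And>x. x \<in> {0..1} \<Longrightarrow> \<bar>g x - p x\<bar> < e'"
      using Stone_Weierstrass_real_polynomial_function[of "{0..1::real}" g e'] g e'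
      by (metis compact_Icc continuous_on_subset top_greatest)
    obtain a n where a: "p = (\<lambda>x. \<Sum>i\<le>n. a i * x ^ i)"
      using p(1) real_polynomial_function_iff_sum by blast
    have pc: "continuous_on UNIV p" unfolding a by (intro continuous_intros)
    have "\<bar>?I\<bar> = \<bar>\<integral>t. ?w t * h t * g (exp (- t)) - ?w t * h t * p (exp (- t)) \<partial>lborel\<bar>"
      using poly[where a=a and n=n]
      by (subst Bochner_Integration.integral_diff[OF bound[OF g] bound[OF pc]]) (simp add: a)
    also have "\<dots> \<le> (\<integral>t. e' * (C * ?w t) \<partial>lborel)"
      unfolding real_norm_def[symmetric]
    proof (rule Bochner_Integration.integral_norm_bound_integral)
      show "integrable lborel (\<lambda>t. ?w t * h t * g (exp (- t)) - ?w t * h t * p (exp (- t)))"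
        by (intro Bochner_Integration.integrable_diff bound g pc)
      show "integrable lborel (\<lambda>t. e' * (C * ?w t))" by (intro integrable_mult_right w)
      fix t :: real
      show "norm (?w t * h t * g (exp (- t)) - ?w t * h t * p (exp (- t))) \<le> e' * (C * ?w t)"
      proof (cases "0 \<le> t")
        case True
        have "\<bar>h t\<bar> * \<bar>g (exp (- t)) - p (exp (- t))\<bar> \<le> C * e'"
          using True C C0 p(2)[of "exp (- t)"] by (intro mult_mono) auto
        moreover have "?w t * h t * g (exp (- t)) - ?w t * h t * p (exp (- t))
           = exp (- t) * (h t * (g (exp (- t)) - p (exp (- t))))"
          using True by (simp add: algebra_simps)
        ultimately show ?thesis using True by (simp add: abs_mult mult_ac)
      qed simp
    qed
    also have "\<dots> = e' * W" unfolding W_def by (rule integral_mult_right_zero)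
    also have "\<dots> \<le> e"
    proof -
      have "e' * W \<le> e' * (W + 1)" using e' by (intro mult_left_mono) auto
      also have "\<dots> = e" using W0 by (simp add: e'_def)
      finally show ?thesis .
    qed
    finally show ?thesis .
  qed
  have "\<bar>?I\<bar> \<le> 0" by (rule field_le_epsilon) (simp only: le add_0_left)
  then show ?thesis by simp
qed

text \<open>The transforms at positive integers already make the difference of the two functions
  orthogonal to all continuous functions of exp (- t). If the difference were nonzero at s, right
  continuity would give it a strict sign on an interval to the right of s, and a bump supported
  there would contradict orthogonality.\<close>

lemma laplace_right_continuous_eq:
  fixes \<phi> \<psi> :: "real \<Rightarrow> real"
  assumes rc: "\<And>t. 0 \<le> t \<Longrightarrow> (\<phi> \<longlongrightarrow> \<phi> t) (at_right t)" "\<And>t. 0 \<le> t \<Longrightarrow> (\<psi> \<longlongrightarrow> \<psi> t) (at_right t)"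
    and bd: "\<And>t. 0 \<le> t \<Longrightarrow> 0 \<le> \<phi> t" "\<And>t. 0 \<le> t \<Longrightarrow> \<phi> t \<le> 1"
       "\<And>t. 0 \<le> t \<Longrightarrow> 0 \<le> \<psi> t" "\<And>t. 0 \<le> t \<Longrightarrow> \<psi> t \<le> 1"
    and L: "\<And>\<alpha>. 0 < \<alpha> \<Longrightarrow> (\<integral>\<^sup>+t\<in>{0..}. ennreal (exp (- \<alpha> * t)) * ennreal (\<phi> t) \<partial>lebesgue)
       = (\<integral>\<^sup>+t\<in>{0..}. ennreal (exp (- \<alpha> * t)) * ennreal (\<psi> t) \<partial>lebesgue)"
    and s: "0 \<le> s"
  shows "\<phi> s = \<psi> s"
proof -
  \<comment> \<open>Nothing is known at negative times; extension by 0 yields measurability and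
    bounds on the whole line.\<close>
  define H where "H f t = indicator {0..} t * f t" for f :: "real \<Rightarrow> real" and t
  have Hm: "H f \<in> borel_measurable borel" if "\<And>t. 0 \<le> t \<Longrightarrow> (f \<longlongrightarrow> f t) (at_right t)" for f
    unfolding H_def using borel_measurable_right_continuous[OF that] .
  define h where "h t = H \<phi> t - H \<psi> t" for t
  have [measurable]: "H \<phi> \<in> borel_measurable borel" "H \<psi> \<in> borel_measurable borel"
    using Hm rc by auto
  have hm: "h \<in> borel_measurable lborel" unfolding h_def by simp
  have H01: "0 \<le> H f t" "H f t \<le> 1" if "\<And>t. 0 \<le> t \<Longrightarrow> 0 \<le> f t" "\<And>t. 0 \<le> t \<Longrightarrow> f t \<le> 1" for f t
    using that by (auto simp: H_def indicator_def)
  have hC: "\<bar>h t\<bar> \<le> 1" for t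
    using H01[of \<phi> t] H01[of \<psi> t] bd by (auto simp: h_def abs_le_iff)
  have int: "integrable lborel (\<lambda>t. indicator {0..} t * exp (- a * t) * f t)"
    if "0 < a" "f \<in> borel_measurable borel" "\<And>t. 0 \<le> f t" "\<And>t. f t \<le> 1" for f :: "real \<Rightarrow> real" and a
  proof (rule Bochner_Integration.integrable_bound[OF integrable_exp_half_line[OF that(1)]])
    show "AE t in lborel. norm (indicator {0..} t * exp (- a * t) * f t)
        \<le> norm (indicator {0..} t * exp (- a * t))"
    proof (rule AE_I2)
      fix t
      have "\<bar>f t\<bar> \<le> 1" using that(3,4)[of t] by simp
      then show "norm (indicator {0..} t * exp (- a * t) * f t) \<le> norm (indicator {0..} t * exp (- a * t))"
        by (auto simp: abs_mult intro: mult_left_le)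
    qed
  qed (use that(2) in measurable)
  \<comment> \<open>The hypothesis compares nonnegative integrals over \<open>lebesgue\<close>, but
    taking differences requires real integrals. Completion does not change a nonnegative integral,
    so \<open>lborel\<close> may be used instead.\<close>
  have nn: "(\<integral>t. indicator {0..} t * exp (- a * t) * H f t \<partial>lborel)
     = enn2real (\<integral>\<^sup>+t\<in>{0..}. ennreal (exp (- a * t)) * ennreal (f t) \<partial>lebesgue)"
    if "H f \<in> borel_measurable borel" "0 < a" "\<And>t. 0 \<le> t \<Longrightarrow> 0 \<le> f t" for f a
  proof -
    have "(\<integral>t. indicator {0..} t * exp (- a * t) * H f t \<partial>lborel)
        = enn2real (\<integral>\<^sup>+t. ennreal (indicator {0..} t * exp (- a * t) * H f t) \<partial>lborel)"
    proof (rule integral_eq_nn_integral)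
      show "(\<lambda>t. indicator {0..} t * exp (- a * t) * H f t) \<in> borel_measurable lborel"
        using that(1) by measurable
      show "AE t in lborel. 0 \<le> indicator {0..} t * exp (- a * t) * H f t"
        using that(3) by (intro AE_I2) (simp add: H_def indicator_def)
    qed
    also have "(\<integral>\<^sup>+t. ennreal (indicator {0..} t * exp (- a * t) * H f t) \<partial>lborel)
       = (\<integral>\<^sup>+t. ennreal (indicator {0..} t * exp (- a * t) * H f t) \<partial>lebesgue)"
      by (rule nn_integral_completion[symmetric])
    also have "\<dots> = (\<integral>\<^sup>+t\<in>{0..}. ennreal (exp (- a * t)) * ennreal (f t) \<partial>lebesgue)"
      using that(3) by (intro nn_integral_cong) (simp add: H_def indicator_def ennreal_mult)
    finally show ?thesis .
  qed
  have L0: "(\<integral>t. indicator {0..} t * exp (- real (Suc n) * t) * h t \<partial>lborel) = 0" for n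
  proof -
    have "(\<integral>t. indicator {0..} t * exp (- real (Suc n) * t) * h t \<partial>lborel)
      = (\<integral>t. indicator {0..} t * exp (- real (Suc n) * t) * H \<phi> t
           - indicator {0..} t * exp (- real (Suc n) * t) * H \<psi> t \<partial>lborel)"
      by (simp add: h_def right_diff_distrib del: of_nat_Suc)
    also have "\<dots> = 0"
    proof (subst Bochner_Integration.integral_diff)
      have n0: "0 < real (Suc n)" by simp
      show "integrable lborel (\<lambda>t. indicator {0..} t * exp (- real (Suc n) * t) * H \<phi> t)"
        by (rule int[OF n0]) (use bd H01[of \<phi>] in auto)
      show "integrable lborel (\<lambda>t. indicator {0..} t * exp (- real (Suc n) * t) * H \<psi> t)"
        by (rule int[OF n0]) (use bd H01[of \<psi>] in auto)
      show "(\<integral>t. indicator {0..} t * exp (- real (Suc n) * t) * H \<phi> t \<partial>lborel)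
          - (\<integral>t. indicator {0..} t * exp (- real (Suc n) * t) * H \<psi> t \<partial>lborel) = 0"
        using nn[OF _ n0, of \<phi>] nn[OF _ n0, of \<psi>] L[OF n0] bd by simp
    qed
    finally show ?thesis .
  qed
  have orth: "(\<integral>t. indicator {0..} t * exp (- t) * h t * g (exp (- t)) \<partial>lborel) = 0"
    if "continuous_on UNIV g" for g
    by (rule laplace_orthogonal_continuous[OF hm hC L0 that])
  \<comment> \<open>\<sigma> = 1 and \<sigma> = - 1 handle the two possible signs of h s; \<epsilon>
    will be half of its absolute value.\<close>
  have pos: "\<not> \<epsilon> < \<sigma> * h s" if \<epsilon>: "0 < \<epsilon>" and \<sigma>: "\<bar>\<sigma>\<bar> = 1" for \<epsilon> \<sigma> :: real
  proof
    assume a: "\<epsilon> < \<sigma> * h s"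
    have "((\<lambda>t. \<sigma> * (\<phi> t - \<psi> t)) \<longlongrightarrow> \<sigma> * (\<phi> s - \<psi> s)) (at_right s)"
      using s by (intro tendsto_intros rc)
    then have "\<forall>\<^sub>F t in at_right s. \<epsilon> < \<sigma> * (\<phi> t - \<psi> t)"
      using a s by (intro order_tendstoD) (auto simp: h_def H_def)
    then obtain b where b: "s < b" "\<And>t. s < t \<Longrightarrow> t < b \<Longrightarrow> \<epsilon> < \<sigma> * (\<phi> t - \<psi> t)"
      by (auto simp: eventually_at_right_field)
    \<comment> \<open>In the variable u = exp (- t) this bump is positive exactly for exp (- b) < u
      < exp (- s), that is, for s < t < b.\<close>
    define g where "g u = max 0 ((u - exp (- b)) * (exp (- s) - u))" for u :: real
    have gc: "continuous_on UNIV g" unfolding g_def by (intro continuous_intros)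
    have gm[measurable]: "g \<in> borel_measurable borel" by (rule borel_measurable_continuous_onI[OF gc])
    have g0: "g (exp (- t)) = 0" if t: "\<not> (s < t \<and> t < b)" for t
    proof -
      consider "t \<le> s" | "b \<le> t" using t by linarith
      then have "(exp (- t) - exp (- b)) * (exp (- s) - exp (- t)) \<le> 0"
      proof cases
        case 1
        then show ?thesis using b(1) by (intro mult_nonneg_nonpos) auto
      next
        case 2
        then show ?thesis using b(1) by (intro mult_nonpos_nonneg) auto
      qed
      then show ?thesis by (simp add: g_def)
    qed
    have gpos: "0 < g (exp (- t))" if "s < t" "t < b" for t
      using that by (auto simp: g_def less_max_iff_disj)
    define k where "k t = \<sigma> * (indicator {0..} t * exp (- t) * h t * g (exp (- t)))" for t
    have kpos: "0 < k t" if "s < t" "t < b" for t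
    proof -
      have "k t = exp (- t) * (\<sigma> * (\<phi> t - \<psi> t)) * g (exp (- t))"
        using that s by (simp add: k_def h_def H_def mult_ac)
      moreover have "0 < \<sigma> * (\<phi> t - \<psi> t)" using b(2)[OF that] \<epsilon> by linarith
      ultimately show ?thesis using gpos[OF that] by simp
    qed
    have k0: "k t = 0" if "\<not> (s < t \<and> t < b)" for t using g0[OF that] by (simp add: k_def)
    have knn: "0 \<le> k t" for t using kpos[of t] k0[of t] by fastforce
    have hm'[measurable]: "h \<in> borel_measurable borel" using hm by simp
    have km[measurable]: "k \<in> borel_measurable borel" unfolding k_def by measurable
    have gle: "\<bar>g (exp (- t))\<bar> \<le> 1" if "0 \<le> t" for t
    proof (cases "s < t \<and> t < b")
      case True
      have "(exp (- t) - exp (- b)) * (exp (- s) - exp (- t)) \<le> 1 * 1"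
        using True s by (intro mult_mono) (auto simp: algebra_simps intro: order.trans[of _ 1])
      then show ?thesis by (auto simp: g_def)
    qed (simp add: g0)
    have kint: "integrable lborel k"
    proof (rule Bochner_Integration.integrable_bound)
      show "integrable lborel (\<lambda>t. indicator {0..} t * exp (- 1 * t) :: real)"
        by (rule integrable_exp_half_line) simp
      show "AE t in lborel. norm (k t) \<le> norm (indicator {0..} t * exp (- 1 * t) :: real)"
      proof (rule AE_I2)
        fix t
        have "\<bar>h t\<bar> * \<bar>g (exp (- t))\<bar> \<le> 1 * 1" if "0 \<le> t" using hC gle[OF that] by (intro mult_mono) auto
        then show "norm (k t) \<le> norm (indicator {0..} t * exp (- 1 * t) :: real)"
          using \<sigma> by (cases "0 \<le> t") (auto simp: k_def abs_mult mult.assoc)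
      qed
    qed measurable
    have "(\<integral>t. k t \<partial>lborel) = 0" unfolding k_def using orth[OF gc] by simp
    \<comment> \<open>A nonnegative function with integral 0 vanishes almost everywhere, but
      \<open>k\<close> is positive on an interval of length b - s > 0.\<close>
    then have "AE t in lborel. k t = 0" using integral_nonneg_eq_0_iff_AE[OF kint] knn by simp
    then have "AE t in lborel. t \<notin> {s<..<b}" by eventually_elim (use kpos in force)
    then have "{s<..<b} \<in> null_sets lborel" by (subst AE_iff_null_sets) auto
    then show False using b(1) by (auto simp: null_sets_def)
  qed
  have "h s = 0"
  proof (rule ccontr)
    assume "h s \<noteq> 0"
    then show False using pos[of "h s / 2" 1] pos[of "- h s / 2" "- 1"] by (cases "0 < h s") auto
  qed
  then show ?thesis using s by (simp add: h_def H_def)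
qed

section \<open>Markov processes and their laws\<close>

text \<open>The Markov property is put in integrated form, with nonnegative functions in place of
  bounded ones. No integrability has to be checked, f may be unbounded, and the identity passes to
  mixtures over starting points, to trace measures and to larger state spaces by rewriting
  integrals, without conditional expectations.\<close>

locale markov_process =
  fixes S :: "'a measure" and P :: "real \<Rightarrow> 'a \<Rightarrow> 'a measure"
    and M :: "'w measure" and G :: "real \<Rightarrow> 'w measure" and X :: "real \<Rightarrow> 'w \<Rightarrow> 'a"
  assumes filtration: "0 \<le> t \<Longrightarrow> subalgebra M (G t)"
    and filtration_mono: "0 \<le> s \<Longrightarrow> s \<le> t \<Longrightarrow> sets (G s) \<subseteq> sets (G t)"
    and adapted: "0 \<le> t \<Longrightarrow> X t \<in> G t \<rightarrow>\<^sub>M S"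
    and markov: "0 \<le> t \<Longrightarrow> 0 \<le> s \<Longrightarrow> A \<in> sets (G t) \<Longrightarrow> f \<in> borel_measurable S \<Longrightarrow>
      (\<integral>\<^sup>+\<omega>\<in>A. f (X (t + s) \<omega>) \<partial>M) = (\<integral>\<^sup>+\<omega>\<in>A. (\<integral>\<^sup>+y. f y \<partial>P s (X t \<omega>)) \<partial>M)"
begin

lemma measurable_process: "0 \<le> t \<Longrightarrow> X t \<in> M \<rightarrow>\<^sub>M S"
  using measurable_from_subalg[OF filtration adapted] by blast

lemma space_filtration: "0 \<le> t \<Longrightarrow> space (G t) = space M"
  using filtration by (simp add: subalgebra_def)

lemma sets_filtration: "0 \<le> t \<Longrightarrow> A \<in> sets (G t) \<Longrightarrow> A \<in> sets M"
  using filtration by (auto simp: subalgebra_def)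

end

section \<open>Transition kernels and the two forms of the Markov property\<close>

lemma markov_transition_function_subprob:
  "markov_transition_function S P \<Longrightarrow> 0 \<le> t \<Longrightarrow> P t \<in> S \<rightarrow>\<^sub>M subprob_algebra S"
  unfolding markov_transition_function_def by (blast intro: measurable_prob_algebraD)

lemma markov_transition_function_at:
  assumes "markov_transition_function S P" "0 \<le> t" "x \<in> space S"
  shows "prob_space (P t x)" "sets (P t x) = sets S" "space (P t x) = space S"
proof -
  have "P t \<in> S \<rightarrow>\<^sub>M prob_algebra S" using assms(1,2) by (simp add: markov_transition_function_def)
  then have "P t x \<in> space (prob_algebra S)" using assms(3) by (rule measurable_space)
  then show "prob_space (P t x)" "sets (P t x) = sets S" by (auto simp: space_prob_algebra)
  then show "space (P t x) = space S" using sets_eq_imp_space_eq by blast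
qed

lemma markov_transition_function_nn_integral_measurable:
  assumes "markov_transition_function S P" "0 \<le> t" "f \<in> borel_measurable S"
  shows "(\<lambda>x. \<integral>\<^sup>+y. f y \<partial>P t x) \<in> borel_measurable S"
  using measurable_compose[OF markov_transition_function_subprob[OF assms(1,2)]
      nn_integral_measurable_subprob_algebra[OF assms(3)]] .

text \<open>Conditional expectations cover only bounded functions, so they are used for indicators
  alone. These give an equality of measures, and that equality can be integrated against any
  nonnegative f.\<close>

lemma markov_property_imp_markov_process:
  assumes P: "markov_transition_function (univ_borel T) P"
    and M: "prob_space M"
    and filtration: "\<And>t. 0 \<le> t \<Longrightarrow> subalgebra M (G t)"
    and filtration_mono: "\<And>s t. 0 \<le> s \<Longrightarrow> s \<le> t \<Longrightarrow> sets (G s) \<subseteq> sets (G t)"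
    and adapted: "\<And>t. 0 \<le> t \<Longrightarrow> X t \<in> G t \<rightarrow>\<^sub>M univ_borel T"
    and mp: "markov_property T P M G X"
  shows "markov_process (univ_borel T) P M G X"
proof
  fix t s :: real and A and f :: "'a \<Rightarrow> ennreal"
  assume t: "0 \<le> t" and s: "0 \<le> s" and A: "A \<in> sets (G t)" and f: "f \<in> borel_measurable (univ_borel T)"
  interpret prob_space M by fact
  interpret C: sigma_finite_subalgebra M "G t"
    by (intro finite_measure_subalgebra_is_sigma_finite)
       (simp add: finite_measure_subalgebra_def finite_measure_subalgebra_axioms_def
         finite_measure_axioms filtration[OF t])
  let ?S = "univ_borel T"
  have X: "X u \<in> M \<rightarrow>\<^sub>M ?S" if "0 \<le> u" for u
    using measurable_from_subalg[OF filtration adapted] that by blast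
  have ts: "0 \<le> t + s" using t s by simp
  have AM[measurable]: "A \<in> sets M" using A filtration[OF t] by (auto simp: subalgebra_def)
  note Ps = markov_transition_function_at[OF P s]
  have [measurable]: "X t \<in> M \<rightarrow>\<^sub>M ?S" "X (t + s) \<in> M \<rightarrow>\<^sub>M ?S" "P s \<in> ?S \<rightarrow>\<^sub>M subprob_algebra ?S"
    using X t ts markov_transition_function_subprob[OF P s] by auto
  have XT: "X t \<omega> \<in> space ?S" if "\<omega> \<in> space M" for \<omega> using measurable_space[OF X[OF t] that] .
  have eq: "(\<integral>\<^sup>+\<omega>\<in>A. indicator B (X (t + s) \<omega>) \<partial>M) = (\<integral>\<^sup>+\<omega>\<in>A. emeasure (P s (X t \<omega>)) B \<partial>M)"
    if B[measurable]: "B \<in> sets ?S" for B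
  proof -
    let ?f = "indicator B :: 'a \<Rightarrow> real"
    let ?g = "\<lambda>x. measure (P s x) B"
    have bf: "bounded (?f ` topspace T)" by (intro boundedI[of _ 1]) (auto simp: indicator_def)
    have fm: "?f \<in> borel_measurable ?S" by measurable
    have gm: "?g \<in> borel_measurable ?S" by measurable
    have g1: "?g (X t \<omega>) \<le> 1" if "\<omega> \<in> space M" for \<omega>
      using prob_space.prob_le_1[OF Ps(1)[OF XT[OF that]]] .
    have int: "(\<integral>y. ?f y \<partial>P s (X t \<omega>)) = ?g (X t \<omega>)" if "\<omega> \<in> space M" for \<omega>
      using Ps(2,3)[OF XT[OF that]] sets.sets_into_space[OF B] by (simp add: Int_absorb2)
    have "AE \<omega> in M. real_cond_exp M (G t) (\<lambda>\<omega>. ?f (X (t + s) \<omega>)) \<omega> = (\<integral>y. ?f y \<partial>P s (X t \<omega>))"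
      using mp t s fm bf unfolding markov_property_def by blast
    then have ae: "AE \<omega> in M. real_cond_exp M (G t) (\<lambda>\<omega>. ?f (X (t + s) \<omega>)) \<omega> = ?g (X t \<omega>)"
      using AE_space by eventually_elim (simp only: int)
    have fi: "integrable M (\<lambda>\<omega>. ?f (X (t + s) \<omega>))"
      by (rule integrable_const_bound[where B = 1]) (auto simp: indicator_def)
    have "(\<integral>\<omega>\<in>A. ?f (X (t + s) \<omega>) \<partial>M) = (\<integral>\<omega>\<in>A. real_cond_exp M (G t) (\<lambda>\<omega>. ?f (X (t + s) \<omega>)) \<omega> \<partial>M)"
      by (rule C.real_cond_exp_intA[OF fi A])
    also have "\<dots> = (\<integral>\<omega>\<in>A. ?g (X t \<omega>) \<partial>M)"
      unfolding set_lebesgue_integral_def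
      using ae by (intro integral_cong_AE) (auto simp: borel_measurable_cond_exp2)
    finally have *: "(\<integral>\<omega>. indicator A \<omega> * ?f (X (t + s) \<omega>) \<partial>M) = (\<integral>\<omega>. indicator A \<omega> * ?g (X t \<omega>) \<partial>M)"
      by (simp add: set_lebesgue_integral_def)
    have "(\<integral>\<^sup>+\<omega>\<in>A. indicator B (X (t + s) \<omega>) \<partial>M) = (\<integral>\<^sup>+\<omega>. ennreal (indicator A \<omega> * ?f (X (t + s) \<omega>)) \<partial>M)"
      by (intro nn_integral_cong) (auto simp: indicator_def)
    also have "\<dots> = ennreal (\<integral>\<omega>. indicator A \<omega> * ?f (X (t + s) \<omega>) \<partial>M)"
      by (intro nn_integral_eq_integral integrable_const_bound[where B = 1]) (auto simp: indicator_def)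
    also have "\<dots> = ennreal (\<integral>\<omega>. indicator A \<omega> * ?g (X t \<omega>) \<partial>M)" by (simp only: *)
    also have "\<dots> = (\<integral>\<^sup>+\<omega>. ennreal (indicator A \<omega> * ?g (X t \<omega>)) \<partial>M)"
      using g1 by (intro nn_integral_eq_integral[symmetric] integrable_const_bound[where B = 1])
        (auto simp: indicator_def)
    also have "\<dots> = (\<integral>\<^sup>+\<omega>\<in>A. emeasure (P s (X t \<omega>)) B \<partial>M)"
      using finite_measure.emeasure_eq_measure[OF prob_space.finite_measure[OF Ps(1)[OF XT]]]
      by (intro nn_integral_cong) (auto simp: indicator_def)
    finally show ?thesis .
  qed
  \<comment> \<open>Weighting by the indicator of A absorbs the conditioning event: the claim
    becomes that under ?D the law of X (t + s) is the law of X t followed by the kernel P s.\<close>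
  let ?D = "density M (indicator A)"
  have D: "(\<integral>\<^sup>+x. h x \<partial>distr ?D ?S (X u)) = (\<integral>\<^sup>+\<omega>\<in>A. h (X u \<omega>) \<partial>M)"
    if u: "0 \<le> u" and h[measurable]: "h \<in> borel_measurable ?S" for u h
  proof -
    have [measurable]: "X u \<in> M \<rightarrow>\<^sub>M ?S" by (rule X[OF u])
    have "(\<integral>\<^sup>+x. h x \<partial>distr ?D ?S (X u)) = (\<integral>\<^sup>+\<omega>. h (X u \<omega>) \<partial>?D)"
      by (rule nn_integral_distr) measurable
    also have "\<dots> = (\<integral>\<^sup>+\<omega>. indicator A \<omega> * h (X u \<omega>) \<partial>M)"
      by (rule nn_integral_density) measurable
    finally show ?thesis by (simp add: mult.commute)
  qed
  have ne: "space (distr ?D ?S (X t)) \<noteq> {}" using XT not_empty by auto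
  have "distr ?D ?S (X (t + s)) = distr ?D ?S (X t) \<bind> P s"
  proof (rule measure_eqI)
    show "sets (distr ?D ?S (X (t + s))) = sets (distr ?D ?S (X t) \<bind> P s)"
      using sets_bind[OF _ ne, of "P s" ?S] Ps(2) by simp
    fix B assume "B \<in> sets (distr ?D ?S (X (t + s)))"
    then have B[measurable]: "B \<in> sets ?S" by simp
    have "emeasure (distr ?D ?S (X (t + s))) B = (\<integral>\<^sup>+\<omega>. indicator B \<omega> \<partial>distr ?D ?S (X (t + s)))"
      by simp
    also have "\<dots> = (\<integral>\<^sup>+\<omega>\<in>A. indicator B (X (t + s) \<omega>) \<partial>M)" by (rule D[OF ts]) measurable
    also have "\<dots> = (\<integral>\<^sup>+\<omega>\<in>A. emeasure (P s (X t \<omega>)) B \<partial>M)" by (rule eq[OF B])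
    also have "\<dots> = (\<integral>\<^sup>+x. emeasure (P s x) B \<partial>distr ?D ?S (X t))" by (rule D[OF t, symmetric]) measurable
    also have "\<dots> = emeasure (distr ?D ?S (X t) \<bind> P s) B"
      using ne by (intro emeasure_bind[symmetric, where N = ?S]) auto
    finally show "emeasure (distr ?D ?S (X (t + s))) B = emeasure (distr ?D ?S (X t) \<bind> P s) B" .
  qed
  then have "(\<integral>\<^sup>+x. f x \<partial>distr ?D ?S (X (t + s))) = (\<integral>\<^sup>+x. \<integral>\<^sup>+y. f y \<partial>P s x \<partial>distr ?D ?S (X t))"
    using f by (simp add: nn_integral_bind[where B = ?S])
  then show "(\<integral>\<^sup>+\<omega>\<in>A. f (X (t + s) \<omega>) \<partial>M) = (\<integral>\<^sup>+\<omega>\<in>A. (\<integral>\<^sup>+y. f y \<partial>P s (X t \<omega>)) \<partial>M)"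
    using D[OF ts f] D[OF t markov_transition_function_nn_integral_measurable[OF P s f]] by simp
qed (use filtration filtration_mono adapted in auto)

text \<open>A function bounded by C becomes nonnegative after adding C, and the kernels, having mass
  1, carry the constant through unchanged.\<close>

lemma markov_process_imp_markov_property:
  assumes P: "markov_transition_function (univ_borel T) P"
    and M: "prob_space M" and mp: "markov_process (univ_borel T) P M G X"
  shows "markov_property T P M G X"
  unfolding markov_property_def
proof (intro allI impI, elim conjE)
  fix t s :: real and f :: "'a \<Rightarrow> real"
  assume t: "0 \<le> t" and s: "0 \<le> s" and f: "f \<in> borel_measurable (univ_borel T)"
    and bf: "bounded (f ` topspace T)"
  interpret prob_space M by fact
  interpret markov_process "univ_borel T" P M G X by fact
  let ?S = "univ_borel T"
  interpret C: sigma_finite_subalgebra M "G t"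
    by (intro finite_measure_subalgebra_is_sigma_finite)
       (simp add: finite_measure_subalgebra_def finite_measure_subalgebra_axioms_def
         finite_measure_axioms filtration[OF t])
  have ts: "0 \<le> t + s" using t s by simp
  note Ps = markov_transition_function_at[OF P s]
  obtain C where C: "\<And>x. x \<in> topspace T \<Longrightarrow> \<bar>f x\<bar> \<le> C"
    using bf by (auto simp: bounded_iff)
  have [measurable]: "X t \<in> M \<rightarrow>\<^sub>M ?S" "X (t + s) \<in> M \<rightarrow>\<^sub>M ?S" "P s \<in> ?S \<rightarrow>\<^sub>M subprob_algebra ?S"
    "f \<in> borel_measurable ?S"
    using measurable_process t ts markov_transition_function_subprob[OF P s] f by auto
  have XT: "X u \<omega> \<in> topspace T" if "\<omega> \<in> space M" "0 \<le> u" for \<omega> u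
    using measurable_space[OF measurable_process[OF that(2)] that(1)] by simp
  define g where "g x = (\<integral>y. f y \<partial>P s x)" for x
  have gm: "g \<in> borel_measurable ?S" unfolding g_def
    by (rule measurable_compose[OF markov_transition_function_subprob[OF P s] integral_measurable_subprob_algebra[OF f]])
  have shift: "(\<integral>\<^sup>+y. ennreal (f y + C) \<partial>P s x) = ennreal (g x + C)" "\<bar>g x\<bar> \<le> C" if x: "x \<in> topspace T" for x
  proof -
    interpret Q: prob_space "P s x" using Ps(1) x by simp
    have sp: "space (P s x) = topspace T" using Ps(3) x by simp
    have fi: "integrable (P s x) f"
      using C sp Ps(2)[of x] x
      by (intro Q.integrable_const_bound[where B = C]) (auto simp: measurable_cong_sets[OF Ps(2) refl] f)
    have "(\<integral>\<^sup>+y. ennreal (f y + C) \<partial>P s x) = ennreal (\<integral>y. f y + C \<partial>P s x)"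
      using fi C sp by (intro nn_integral_eq_integral) (fastforce simp: abs_le_iff)+
    also have "(\<integral>y. f y + C \<partial>P s x) = g x + C" using fi by (simp add: g_def Q.prob_space)
    finally show "(\<integral>\<^sup>+y. ennreal (f y + C) \<partial>P s x) = ennreal (g x + C)" .
    have "\<bar>g x\<bar> \<le> (\<integral>y. \<bar>f y\<bar> \<partial>P s x)" unfolding g_def by (rule integral_abs_bound)
    also have "\<dots> \<le> (\<integral>y. C \<partial>P s x)" using fi C sp by (intro integral_mono) auto
    finally show "\<bar>g x\<bar> \<le> C" by (simp add: Q.prob_space)
  qed
  note [measurable] = gm
  have fi: "integrable M (\<lambda>\<omega>. f (X (t + s) \<omega>))"
    using C XT ts by (intro integrable_const_bound[where B = C]) auto
  have gi: "integrable M (\<lambda>\<omega>. g (X t \<omega>))"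
    using shift(2) XT t by (intro integrable_const_bound[where B = C]) auto
  have "(\<integral>\<omega>\<in>A. f (X (t + s) \<omega>) \<partial>M) = (\<integral>\<omega>\<in>A. g (X t \<omega>) \<partial>M)" if A: "A \<in> sets (G t)" for A
  proof -
    have AM[measurable]: "A \<in> sets M" using sets_filtration[OF t A] .
    \<comment> \<open>Recovers a real integral from that of the shifted function. The correction C *
      measure M A is the same for f (X (t + s)) and g (X t), hence cancels.\<close>
    have nn: "(\<integral>\<omega>\<in>A. h \<omega> \<partial>M) = enn2real (\<integral>\<^sup>+\<omega>\<in>A. ennreal (h \<omega> + C) \<partial>M) - C * measure M A"
      if h: "integrable M h" "\<And>\<omega>. \<omega> \<in> space M \<Longrightarrow> \<bar>h \<omega>\<bar> \<le> C" for h
    proof -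
      have hm[measurable]: "h \<in> borel_measurable M" using h(1) by auto
      have si: "set_integrable M A h" "set_integrable M A (\<lambda>_. C)"
        unfolding set_integrable_def by (intro integrable_mult_indicator AM h(1) integrable_const)+
      have "(\<integral>\<^sup>+\<omega>\<in>A. ennreal (h \<omega> + C) \<partial>M) = (\<integral>\<^sup>+\<omega>. ennreal (indicator A \<omega> * (h \<omega> + C)) \<partial>M)"
        by (intro nn_integral_cong) (auto simp: indicator_def)
      also have "enn2real \<dots> = (\<integral>\<omega>. indicator A \<omega> * (h \<omega> + C) \<partial>M)"
        using h(2) by (intro integral_eq_nn_integral[symmetric]) (fastforce simp: abs_le_iff)+
      also have "\<dots> = (\<integral>\<omega>\<in>A. h \<omega> + C \<partial>M)" by (simp add: set_lebesgue_integral_def)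
      also have "\<dots> = (\<integral>\<omega>\<in>A. h \<omega> \<partial>M) + (\<integral>\<omega>\<in>A. C \<partial>M)" using si by (rule set_integral_add)
      also have "(\<integral>\<omega>\<in>A. C \<partial>M) = C * measure M A"
        by (simp add: set_lebesgue_integral_def)
      finally show ?thesis by simp
    qed
    have "(\<integral>\<^sup>+\<omega>\<in>A. ennreal (f (X (t + s) \<omega>) + C) \<partial>M)
        = (\<integral>\<^sup>+\<omega>\<in>A. (\<integral>\<^sup>+y. ennreal (f y + C) \<partial>P s (X t \<omega>)) \<partial>M)"
      by (rule markov[OF t s A]) measurable
    also have "\<dots> = (\<integral>\<^sup>+\<omega>\<in>A. ennreal (g (X t \<omega>) + C) \<partial>M)"
      using shift(1) XT t by (intro nn_integral_cong) simp
    finally show ?thesis using nn[OF fi] nn[OF gi] C shift(2) XT t ts by simp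
  qed
  then have "AE \<omega> in M. real_cond_exp M (G t) (\<lambda>\<omega>. f (X (t + s) \<omega>)) \<omega> = g (X t \<omega>)"
    by (intro C.real_cond_exp_charact fi gi measurable_compose[OF adapted[OF t] gm])
  then show "AE \<omega> in M. real_cond_exp M (G t) (\<lambda>\<omega>. f (X (t + s) \<omega>)) \<omega> = (\<integral>y. f y \<partial>P s (X t \<omega>))"
    by (simp add: g_def)
qed

text \<open>Quantifying \<open>\<Phi>\<close> before the process gives both uniqueness of the law and measurability in the
  starting point.\<close>

lemma markov_process_fdd:
  assumes P: "markov_transition_function S P"
    and F: "finite F" "F \<subseteq> {0..}" and B: "\<And>t. t \<in> F \<Longrightarrow> B t \<in> sets S"
    and m: "0 \<le> m" "\<And>t. t \<in> F \<Longrightarrow> t \<le> m" and f: "f \<in> borel_measurable S"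
  shows "\<exists>\<Phi>\<in>borel_measurable S. \<forall>(M :: 'w measure) G X. markov_process S P M G X \<longrightarrow>
     (\<integral>\<^sup>+\<omega>\<in>{\<omega> \<in> space M. \<forall>t\<in>F. X t \<omega> \<in> B t}. f (X m \<omega>) \<partial>M) = (\<integral>\<^sup>+\<omega>. \<Phi> (X 0 \<omega>) \<partial>M)"
  using F B m f
\<comment> \<open>The largest time b is removed at each step: conditioning at b replaces the
  terminal function f at time m by a terminal function at time b. Therefore m and f must
  vary.\<close>
proof (induction F arbitrary: m f rule: finite_linorder_max_induct)
  case empty
  show ?case
  proof (intro bexI allI impI)
    show "(\<lambda>x. \<integral>\<^sup>+y. f y \<partial>P m x) \<in> borel_measurable S"
      using empty(3,5) by (intro markov_transition_function_nn_integral_measurable[OF P])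
    fix M :: "'w measure" and G X assume "markov_process S P M G X"
    then interpret markov_process S P M G X .
    have "space M \<in> sets (G 0)" using sets.top[of "G 0"] space_filtration[of 0] by simp
    then have "(\<integral>\<^sup>+\<omega>\<in>space M. f (X (0 + m) \<omega>) \<partial>M) = (\<integral>\<^sup>+\<omega>\<in>space M. (\<integral>\<^sup>+y. f y \<partial>P m (X 0 \<omega>)) \<partial>M)"
      using empty(3,5) by (intro markov) auto
    then show "(\<integral>\<^sup>+\<omega>\<in>{\<omega> \<in> space M. \<forall>t\<in>{}. X t \<omega> \<in> B t}. f (X m \<omega>) \<partial>M)
        = (\<integral>\<^sup>+\<omega>. (\<integral>\<^sup>+y. f y \<partial>P m (X 0 \<omega>)) \<partial>M)"
      by (simp cong: nn_integral_cong)
  qed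
next
  case (insert b F)
  define h where "h y = indicator (B b) y * (\<integral>\<^sup>+z. f z \<partial>P (m - b) y)" for y
  have b: "0 \<le> b" "b \<le> m" "B b \<in> sets S" using insert.prems(1,2,4) by auto
  have h: "h \<in> borel_measurable S" unfolding h_def
    using markov_transition_function_nn_integral_measurable[OF P _ insert.prems(5), of "m - b"] b
    by (intro borel_measurable_times_ennreal borel_measurable_indicator) auto
  have sub: "F \<subseteq> {0..}" "\<And>t. t \<in> F \<Longrightarrow> B t \<in> sets S" "\<And>t. t \<in> F \<Longrightarrow> t \<le> b"
    using insert.prems(1,2) insert.hyps(2) by (auto simp: less_imp_le)
  obtain \<Phi> where \<Phi>: "\<Phi> \<in> borel_measurable S" and eq: "\<And>(M :: 'w measure) G X. markov_process S P M G X \<Longrightarrow>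
     (\<integral>\<^sup>+\<omega>\<in>{\<omega> \<in> space M. \<forall>t\<in>F. X t \<omega> \<in> B t}. h (X b \<omega>) \<partial>M) = (\<integral>\<^sup>+\<omega>. \<Phi> (X 0 \<omega>) \<partial>M)"
    using insert.IH[OF sub(1,2) b(1) sub(3) h] by blast
  show ?case
  proof (intro bexI[OF _ \<Phi>] allI impI)
    fix M :: "'w measure" and G X assume MP: "markov_process S P M G X"
    then interpret markov_process S P M G X .
    let ?A = "{\<omega> \<in> space M. \<forall>t\<in>insert b F. X t \<omega> \<in> B t}"
    have "{\<omega> \<in> space (G b). \<forall>t\<in>insert b F. X t \<omega> \<in> B t} \<in> sets (G b)"
    proof (rule sets.sets_Collect_finite_All)
      fix t assume t: "t \<in> insert b F"
      then have t': "0 \<le> t" "t \<le> b" "B t \<in> sets S" using sub(1) sub(2,3)[of t] b by auto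
      have "X t -` B t \<inter> space (G t) \<in> sets (G t)" using adapted[OF t'(1)] t'(3) by (rule measurable_sets)
      moreover have "X t -` B t \<inter> space (G t) = {\<omega> \<in> space (G b). X t \<omega> \<in> B t}"
        using space_filtration t'(1) b(1) by auto
      ultimately show "{\<omega> \<in> space (G b). X t \<omega> \<in> B t} \<in> sets (G b)"
        using filtration_mono[OF t'(1,2)] by auto
    qed (use insert.hyps in auto)
    then have A: "?A \<in> sets (G b)" using space_filtration b(1) by simp
    have "(\<integral>\<^sup>+\<omega>\<in>?A. f (X (b + (m - b)) \<omega>) \<partial>M) = (\<integral>\<^sup>+\<omega>\<in>?A. (\<integral>\<^sup>+y. f y \<partial>P (m - b) (X b \<omega>)) \<partial>M)"
      using b insert.prems(5) by (intro markov A) auto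
    \<comment> \<open>The constraint at time b has moved into \<open>h\<close>, so only those at the
      times in F remain.\<close>
    also have "\<dots> = (\<integral>\<^sup>+\<omega>\<in>{\<omega> \<in> space M. \<forall>t\<in>F. X t \<omega> \<in> B t}. h (X b \<omega>) \<partial>M)"
      by (intro nn_integral_cong) (auto simp: h_def indicator_def)
    finally show "(\<integral>\<^sup>+\<omega>\<in>?A. f (X m \<omega>) \<partial>M) = (\<integral>\<^sup>+\<omega>. \<Phi> (X 0 \<omega>) \<partial>M)"
      using eq[OF MP] by simp
  qed
qed

section \<open>Cylinder sets and uniqueness of path laws\<close>

definition cylinder_sets :: "'a topology \<Rightarrow> (real \<Rightarrow> 'a) set set" where
  "cylinder_sets T = {{w \<in> path_space T. \<forall>t\<in>F. w t \<in> B t} | F B.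
     finite F \<and> F \<subseteq> {0..} \<and> (\<forall>t\<in>F. B t \<in> sets (univ_borel T))}"

lemma path_in_topspace: "w \<in> path_space T \<Longrightarrow> 0 \<le> t \<Longrightarrow> w t \<in> topspace T"
  by (simp add: path_space_def right_continuous_path_def)

text \<open>The one-time events generating \<open>path_algebra\<close> are not closed under
  intersection. Allowing finitely many times repairs this, as uniqueness of laws and measurability
  of kernels require.\<close>

lemma Int_stable_cylinder_sets: "Int_stable (cylinder_sets T)"
proof (rule Int_stableI)
  fix A A' assume "A \<in> cylinder_sets T" "A' \<in> cylinder_sets T"
  then obtain F B F' B' where F: "finite F" "F \<subseteq> {0..}" "\<forall>t\<in>F. B t \<in> sets (univ_borel T)"
      "A = {w \<in> path_space T. \<forall>t\<in>F. w t \<in> B t}"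
    and F': "finite F'" "F' \<subseteq> {0..}" "\<forall>t\<in>F'. B' t \<in> sets (univ_borel T)"
      "A' = {w \<in> path_space T. \<forall>t\<in>F'. w t \<in> B' t}"
    unfolding cylinder_sets_def by blast
  \<comment> \<open>A time missing from one of the two index sets gets the value
    \<open>topspace T\<close>, which imposes no constraint on a path.\<close>
  define C where "C t = (if t \<in> F then B t else topspace T) \<inter> (if t \<in> F' then B' t else topspace T)" for t
  have "A \<inter> A' = {w \<in> path_space T. \<forall>t\<in>F \<union> F'. w t \<in> C t}"
  proof (rule set_eqI, rule iffI)
    fix w assume w: "w \<in> A \<inter> A'"
    then have "w t \<in> C t" if "t \<in> F \<union> F'" for t
      using path_in_topspace[of w T t] F(2) F'(2) that unfolding F(4) F'(4) C_def by auto
    then show "w \<in> {w \<in> path_space T. \<forall>t\<in>F \<union> F'. w t \<in> C t}" using w F(4) by blast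
  next
    fix w assume w: "w \<in> {w \<in> path_space T. \<forall>t\<in>F \<union> F'. w t \<in> C t}"
    then have C: "w t \<in> C t" if "t \<in> F \<union> F'" for t using that by blast
    have "w t \<in> B t" if "t \<in> F" for t using C[of t] that by (simp add: C_def)
    moreover have "w t \<in> B' t" if "t \<in> F'" for t using C[of t] that by (simp add: C_def)
    ultimately show "w \<in> A \<inter> A'" using w F(4) F'(4) by blast
  qed
  moreover have "\<forall>t\<in>F \<union> F'. C t \<in> sets (univ_borel T)"
    using F(3) F'(3) sets.top[of "univ_borel T"] by (auto simp: C_def)
  ultimately show "A \<inter> A' \<in> cylinder_sets T"
    using F(1,2) F'(1,2) unfolding cylinder_sets_def by blast
qed

lemma sets_path_algebra_cylinder: "sets (path_algebra T) = sigma_sets (path_space T) (cylinder_sets T)"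
proof
  show "sets (path_algebra T) \<subseteq> sigma_sets (path_space T) (cylinder_sets T)"
    unfolding sets_path_algebra
  proof (intro sigma_sets_mono' subsetI)
    fix A assume "A \<in> {{w \<in> path_space T. w s \<in> B} | s B. 0 \<le> s \<and> B \<in> sets (univ_borel T)}"
    then obtain s B where "0 \<le> s" "B \<in> sets (univ_borel T)" "A = {w \<in> path_space T. w s \<in> B}" by blast
    then show "A \<in> cylinder_sets T"
      unfolding cylinder_sets_def by (intro CollectI exI[of _ "{s}"] exI[of _ "\<lambda>_. B"]) auto
  qed
  have "A \<in> sets (path_algebra T)" if "A \<in> cylinder_sets T" for A
  proof -
    obtain F B where F: "finite F" "F \<subseteq> {0..}" "\<forall>t\<in>F. B t \<in> sets (univ_borel T)"
      "A = {w \<in> space (path_algebra T). \<forall>t\<in>F. w t \<in> B t}"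
      using \<open>A \<in> cylinder_sets T\<close> unfolding cylinder_sets_def by auto
    show ?thesis unfolding F(4)
    proof (rule sets.sets_Collect_finite_All[OF _ F(1)])
      fix t assume "t \<in> F"
      then have t: "0 \<le> t" "B t \<in> sets (univ_borel T)" using F by auto
      have "(\<lambda>w. w t) -` B t \<inter> space (path_algebra T) = {w \<in> space (path_algebra T). w t \<in> B t}" by auto
      then show "{w \<in> space (path_algebra T). w t \<in> B t} \<in> sets (path_algebra T)"
        using measurable_sets[OF measurable_coordinate[OF t(1)] t(2)] by simp
    qed
  qed
  then show "sigma_sets (path_space T) (cylinder_sets T) \<subseteq> sets (path_algebra T)"
    using sets.sigma_sets_subset[of "cylinder_sets T" "path_algebra T"] by auto
qed

lemma markov_process_cylinder:
  assumes P: "markov_transition_function (univ_borel T) P" and A: "A \<in> cylinder_sets T"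
  shows "\<exists>\<Phi>\<in>borel_measurable (univ_borel T). \<forall>D G. sets D = sets (path_algebra T) \<longrightarrow>
     markov_process (univ_borel T) P D G (\<lambda>t w. w t) \<longrightarrow> emeasure D A = (\<integral>\<^sup>+w. \<Phi> (w 0) \<partial>D)"
proof -
  obtain F B where F: "finite F" "F \<subseteq> {0..}" "\<forall>t\<in>F. B t \<in> sets (univ_borel T)"
    "A = {w \<in> path_space T. \<forall>t\<in>F. w t \<in> B t}"
    using A unfolding cylinder_sets_def by blast
  \<comment> \<open>The terminal function will be the constant 1, so any time beyond F may serve as
    terminal time; inserting 0 covers the empty F.\<close>
  have m: "0 \<le> Max (insert 0 F)" "\<And>t. t \<in> F \<Longrightarrow> t \<le> Max (insert 0 F)" using F(1) by auto
  have B: "t \<in> F \<Longrightarrow> B t \<in> sets (univ_borel T)" for t using F(3) by simp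
  have "\<exists>\<Phi>\<in>borel_measurable (univ_borel T). \<forall>(D :: (real \<Rightarrow> 'a) measure) G X.
       markov_process (univ_borel T) P D G X \<longrightarrow>
       (\<integral>\<^sup>+\<omega>\<in>{\<omega> \<in> space D. \<forall>t\<in>F. X t \<omega> \<in> B t}. 1 \<partial>D) = (\<integral>\<^sup>+\<omega>. \<Phi> (X 0 \<omega>) \<partial>D)"
    by (rule markov_process_fdd[OF P F(1,2) B m]) simp_all
  then obtain \<Phi> where \<Phi>: "\<Phi> \<in> borel_measurable (univ_borel T)"
    "\<And>(D :: (real \<Rightarrow> 'a) measure) G X. markov_process (univ_borel T) P D G X \<Longrightarrow>
       (\<integral>\<^sup>+\<omega>\<in>{\<omega> \<in> space D. \<forall>t\<in>F. X t \<omega> \<in> B t}. 1 \<partial>D) = (\<integral>\<^sup>+\<omega>. \<Phi> (X 0 \<omega>) \<partial>D)"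
    by blast
  show ?thesis
  proof (intro bexI[OF _ \<Phi>(1)] allI impI)
    fix D :: "(real \<Rightarrow> 'a) measure" and G
    assume s: "sets D = sets (path_algebra T)" and mp: "markov_process (univ_borel T) P D G (\<lambda>t w. w t)"
    have sp: "space D = path_space T" using sets_eq_imp_space_eq[OF s] by simp
    have "A \<in> sets D" using A unfolding s sets_path_algebra_cylinder by (rule sigma_sets.Basic)
    then have "emeasure D A = (\<integral>\<^sup>+w\<in>A. 1 \<partial>D)" by simp
    then show "emeasure D A = (\<integral>\<^sup>+w. \<Phi> (w 0) \<partial>D)"
      using \<Phi>(2)[OF mp] unfolding F(4) sp by simp
  qed
qed

text \<open>On a cylinder both measures integrate one and the same function of the initial state,
  and the initial laws agree. The filtrations may differ, since that function does not depend on
  them.\<close>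

lemma markov_process_law_unique:
  assumes P: "markov_transition_function (univ_borel T) P"
    and D: "sets D1 = sets (path_algebra T)" "sets D2 = sets (path_algebra T)" "finite_measure D1"
    and mp: "markov_process (univ_borel T) P D1 G1 (\<lambda>t w. w t)" "markov_process (univ_borel T) P D2 G2 (\<lambda>t w. w t)"
    and init: "distr D1 (univ_borel T) (\<lambda>w. w 0) = distr D2 (univ_borel T) (\<lambda>w. w 0)"
  shows "D1 = D2"
proof (rule measure_eqI_generator_eq[OF Int_stable_cylinder_sets[of T], where \<Omega> = "path_space T" and A = "\<lambda>_. path_space T"])
  show "cylinder_sets T \<subseteq> Pow (path_space T)" by (auto simp: cylinder_sets_def)
  show "sets D1 = sigma_sets (path_space T) (cylinder_sets T)" "sets D2 = sigma_sets (path_space T) (cylinder_sets T)"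
    using D sets_path_algebra_cylinder by auto
  show "range (\<lambda>_. path_space T) \<subseteq> cylinder_sets T"
    by (auto simp: cylinder_sets_def intro!: exI[of _ "{}"])
  show "emeasure D1 (path_space T) \<noteq> \<infinity>" using D(3) by (simp add: finite_measure.emeasure_finite)
  fix A assume "A \<in> cylinder_sets T"
  then obtain \<Phi> where \<Phi>: "\<Phi> \<in> borel_measurable (univ_borel T)"
    "\<And>D G. sets D = sets (path_algebra T) \<Longrightarrow>
     markov_process (univ_borel T) P D G (\<lambda>t w. w t) \<Longrightarrow> emeasure D A = (\<integral>\<^sup>+w. \<Phi> (w 0) \<partial>D)"
    using markov_process_cylinder[OF P] by meson
  have "emeasure D A = (\<integral>\<^sup>+x. \<Phi> x \<partial>distr D (univ_borel T) (\<lambda>w. w 0))"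
    if "sets D = sets (path_algebra T)" "markov_process (univ_borel T) P D G (\<lambda>t w. w t)" for D G
  proof -
    have "(\<integral>\<^sup>+x. \<Phi> x \<partial>distr D (univ_borel T) (\<lambda>w. w 0)) = (\<integral>\<^sup>+w. \<Phi> (w 0) \<partial>D)"
      by (rule nn_integral_distr[OF markov_process.measurable_process[OF that(2) order_refl]])
         (simp add: \<Phi>(1))
    then show ?thesis using \<Phi>(2)[OF that] by simp
  qed
  then show "emeasure D1 A = emeasure D2 A" using D mp init by metis
qed simp

section \<open>The canonical realization: kernel property and mixtures over initial laws\<close>

lemma canonical_realization_at:
  assumes P: "markov_transition_function (univ_borel T) P" and PX: "canonical_realization T P PX"
    and x: "x \<in> topspace T"
  shows "prob_space (PX x)" "sets (PX x) = sets (path_algebra T)" "space (PX x) = path_space T"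
    "AE w in PX x. w 0 = x"
    "markov_process (univ_borel T) P (PX x) (path_filtration T) (\<lambda>t w. w t)"
proof -
  show p: "prob_space (PX x)" and s: "sets (PX x) = sets (path_algebra T)"
    using PX x by (auto simp: canonical_realization_def)
  show sp: "space (PX x) = path_space T" using sets_eq_imp_space_eq[OF s] by simp
  interpret prob_space "PX x" by fact
  have 1: "emeasure (PX x) {w \<in> path_space T. w 0 = x} = 1"
    using PX x by (auto simp: canonical_realization_def)
  then have "prob {w \<in> path_space T. w 0 = x} = 1" by (simp add: emeasure_eq_measure)
  \<comment> \<open>Measurability of this event comes for free: \<open>emeasure\<close> is 0 outside
    the \<sigma>-algebra, so a set of measure 1 belongs to it.\<close>
  then have "AE w in PX x. w \<in> {w \<in> path_space T. w 0 = x}" by (rule AE_prob_1)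
  then show "AE w in PX x. w 0 = x" by eventually_elim simp
  show "markov_process (univ_borel T) P (PX x) (path_filtration T) (\<lambda>t w. w t)"
  proof (rule markov_property_imp_markov_process[OF P p])
    show "subalgebra (PX x) (path_filtration T t)" for t
      using subalgebra_path_filtration[of T t] s sp by (simp add: subalgebra_def)
    show "markov_property T P (PX x) (path_filtration T) (\<lambda>t w. w t)"
      using PX x by (auto simp: canonical_realization_def)
  qed (auto intro: measurable_coordinate_filtration subsetD[OF sets_path_filtration_mono])
qed

text \<open>The definition of \<open>canonical_realization\<close> asks for no measurability in the
  starting point. It follows from the formula for cylinder probabilities and is what gives
  \<open>\<mu> \<bind> PX\<close> its meaning.\<close>

lemma canonical_realization_kernel:
  assumes P: "markov_transition_function (univ_borel T) P" and PX: "canonical_realization T P PX"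
  shows "PX \<in> univ_borel T \<rightarrow>\<^sub>M subprob_algebra (path_algebra T)"
proof (rule measurable_subprob_algebra_generated[OF sets_path_algebra_cylinder Int_stable_cylinder_sets])
  note at = canonical_realization_at[OF P PX]
  show "cylinder_sets T \<subseteq> Pow (path_space T)" by (auto simp: cylinder_sets_def)
  show "subprob_space (PX x)" "sets (PX x) = sets (path_algebra T)" if "x \<in> space (univ_borel T)" for x
    using at[of x] that by (auto intro: prob_space_imp_subprob_space)
  show cyl: "(\<lambda>x. emeasure (PX x) A) \<in> borel_measurable (univ_borel T)" if A: "A \<in> cylinder_sets T" for A
  proof -
    obtain \<Phi> where \<Phi>: "\<Phi> \<in> borel_measurable (univ_borel T)"
      "\<And>D G. sets D = sets (path_algebra T) \<Longrightarrow>
       markov_process (univ_borel T) P D G (\<lambda>t w. w t) \<Longrightarrow> emeasure D A = (\<integral>\<^sup>+w. \<Phi> (w 0) \<partial>D)"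
      using markov_process_cylinder[OF P A] by meson
    have "emeasure (PX x) A = \<Phi> x" if x: "x \<in> topspace T" for x
    proof -
      interpret prob_space "PX x" by (rule at(1)[OF x])
      have "emeasure (PX x) A = (\<integral>\<^sup>+w. \<Phi> (w 0) \<partial>PX x)" by (rule \<Phi>(2)[OF at(2,5)[OF x]])
      \<comment> \<open>Under \<open>PX x\<close> the start is almost surely x, so the integrand is
        the constant \<Phi> x.\<close>
      also have "\<dots> = (\<integral>\<^sup>+w. \<Phi> x \<partial>PX x)"
        using at(4)[OF x] by (intro nn_integral_cong_AE) (auto elim: eventually_mono)
      finally show ?thesis by (simp add: emeasure_space_1)
    qed
    then show ?thesis using \<Phi>(1) by (subst measurable_cong[of _ _ \<Phi>]) simp_all
  qed
  have "path_space T \<in> cylinder_sets T" by (auto simp: cylinder_sets_def intro!: exI[of _ "{}"])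
  then show "(\<lambda>x. emeasure (PX x) (path_space T)) \<in> borel_measurable (univ_borel T)" by (rule cyl)
qed

text \<open>The integrated Markov identity is linear in the underlying measure: it holds under every
  \<open>PX x\<close>, hence after integration over x with respect to \<mu>.\<close>

lemma canonical_realization_bind:
  assumes P: "markov_transition_function (univ_borel T) P" and PX: "canonical_realization T P PX"
    and \<mu>: "prob_space \<mu>" "sets \<mu> = sets (univ_borel T)"
  shows "prob_space (\<mu> \<bind> PX)" "sets (\<mu> \<bind> PX) = sets (path_algebra T)"
    "markov_process (univ_borel T) P (\<mu> \<bind> PX) (path_filtration T) (\<lambda>t w. w t)"
    "distr (\<mu> \<bind> PX) (univ_borel T) (\<lambda>w. w 0) = \<mu>"
proof -
  note at = canonical_realization_at[OF P PX]
  interpret \<mu>: prob_space \<mu> by fact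
  have sp\<mu>: "space \<mu> = topspace T" using sets_eq_imp_space_eq[OF \<mu>(2)] by simp
  have K: "PX \<in> \<mu> \<rightarrow>\<^sub>M subprob_algebra (path_algebra T)"
    using canonical_realization_kernel[OF P PX] measurable_cong_sets[OF \<mu>(2) refl] by blast
  have ne: "space \<mu> \<noteq> {}" by (rule \<mu>.not_empty)
  show s: "sets (\<mu> \<bind> PX) = sets (path_algebra T)"
    using at(2) sp\<mu> ne by (intro sets_bind) auto
  then have sp: "space (\<mu> \<bind> PX) = path_space T" using sets_eq_imp_space_eq[OF s] by simp
  have nn: "(\<integral>\<^sup>+w. f w \<partial>(\<mu> \<bind> PX)) = (\<integral>\<^sup>+x. \<integral>\<^sup>+w. f w \<partial>PX x \<partial>\<mu>)" if "f \<in> borel_measurable (path_algebra T)" for f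
    by (rule nn_integral_bind[OF that K])
  have em: "emeasure (\<mu> \<bind> PX) A = (\<integral>\<^sup>+x. emeasure (PX x) A \<partial>\<mu>)" if "A \<in> sets (path_algebra T)" for A
    by (rule emeasure_bind[OF ne K that])
  show "prob_space (\<mu> \<bind> PX)"
  proof
    have "emeasure (\<mu> \<bind> PX) (path_space T) = (\<integral>\<^sup>+x. emeasure (PX x) (path_space T) \<partial>\<mu>)"
      using em[of "path_space T"] sets.top[of "path_algebra T"] by simp
    also have "\<dots> = (\<integral>\<^sup>+x. 1 \<partial>\<mu>)"
      using at sp\<mu> by (intro nn_integral_cong) (metis prob_space.emeasure_space_1)
    finally show "emeasure (\<mu> \<bind> PX) (space (\<mu> \<bind> PX)) = 1" by (simp add: sp \<mu>.emeasure_space_1)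
  qed
  have c: "(\<lambda>w. w t) \<in> (\<mu> \<bind> PX) \<rightarrow>\<^sub>M univ_borel T" if "0 \<le> t" for t
    using measurable_coordinate[OF that] measurable_cong_sets[OF s refl] by blast
  show "markov_process (univ_borel T) P (\<mu> \<bind> PX) (path_filtration T) (\<lambda>t w. w t)"
  proof
    show "subalgebra (\<mu> \<bind> PX) (path_filtration T t)" for t
      using subalgebra_path_filtration[of T t] s sp by (simp add: subalgebra_def)
    fix t s :: real and A and f :: "'a \<Rightarrow> ennreal"
    assume t: "0 \<le> t" and s: "0 \<le> s" and A: "A \<in> sets (path_filtration T t)" and f: "f \<in> borel_measurable (univ_borel T)"
    have AM: "A \<in> sets (path_algebra T)" using A subalgebra_path_filtration[of T t] by (auto simp: subalgebra_def)
    have bm: "(\<lambda>w. h (w u) * indicator A w) \<in> borel_measurable (path_algebra T)"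
      if "0 \<le> u" "h \<in> borel_measurable (univ_borel T)" for u and h :: "'a \<Rightarrow> ennreal"
      using AM measurable_compose[OF measurable_coordinate[OF that(1)] that(2)]
      by (intro borel_measurable_times_ennreal) auto
    have "(\<integral>\<^sup>+w\<in>A. f (w (t + s)) \<partial>(\<mu> \<bind> PX)) = (\<integral>\<^sup>+x. (\<integral>\<^sup>+w\<in>A. f (w (t + s)) \<partial>PX x) \<partial>\<mu>)"
      using t s f by (intro nn bm) auto
    also have "\<dots> = (\<integral>\<^sup>+x. (\<integral>\<^sup>+w\<in>A. (\<integral>\<^sup>+y. f y \<partial>P s (w t)) \<partial>PX x) \<partial>\<mu>)"
      by (rule nn_integral_cong) (simp add: markov_process.markov[OF at(5) t s A f] sp\<mu>)
    also have "\<dots> = (\<integral>\<^sup>+w\<in>A. (\<integral>\<^sup>+y. f y \<partial>P s (w t)) \<partial>(\<mu> \<bind> PX))"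
      by (intro nn[symmetric] bm t markov_transition_function_nn_integral_measurable[OF P s f])
    finally show "(\<integral>\<^sup>+w\<in>A. f (w (t + s)) \<partial>(\<mu> \<bind> PX)) = (\<integral>\<^sup>+w\<in>A. (\<integral>\<^sup>+y. f y \<partial>P s (w t)) \<partial>(\<mu> \<bind> PX))" .
  qed (auto intro: measurable_coordinate_filtration subsetD[OF sets_path_filtration_mono])
  show "distr (\<mu> \<bind> PX) (univ_borel T) (\<lambda>w. w 0) = \<mu>"
  proof (rule measure_eqI)
    fix B assume "B \<in> sets (distr (\<mu> \<bind> PX) (univ_borel T) (\<lambda>w. w 0))"
    then have B: "B \<in> sets (univ_borel T)" by simp
    have A: "(\<lambda>w. w 0) -` B \<inter> path_space T \<in> sets (path_algebra T)"
      using measurable_sets[OF measurable_coordinate[of 0] B] by simp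
    have "emeasure (distr (\<mu> \<bind> PX) (univ_borel T) (\<lambda>w. w 0)) B
        = (\<integral>\<^sup>+x. emeasure (PX x) ((\<lambda>w. w 0) -` B \<inter> path_space T) \<partial>\<mu>)"
      using em[OF A] B c[of 0] by (simp add: emeasure_distr sp)
    also have "\<dots> = (\<integral>\<^sup>+x. indicator B x \<partial>\<mu>)"
    proof (rule nn_integral_cong)
      fix x assume "x \<in> space \<mu>"
      then have x: "x \<in> topspace T" by (simp add: sp\<mu>)
      interpret prob_space "PX x" by (rule at(1)[OF x])
      have "emeasure (PX x) ((\<lambda>w. w 0) -` B \<inter> path_space T) = (\<integral>\<^sup>+w. indicator B (w 0) \<partial>PX x)"
      proof -
        have "emeasure (PX x) ((\<lambda>w. w 0) -` B \<inter> path_space T)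
            = (\<integral>\<^sup>+w. indicator ((\<lambda>w. w 0) -` B \<inter> path_space T) w \<partial>PX x)"
          using A at(2)[OF x] by (intro nn_integral_indicator[symmetric]) simp
        also have "\<dots> = (\<integral>\<^sup>+w. indicator B (w 0) \<partial>PX x)"
          using at(3)[OF x] by (intro nn_integral_cong) (simp add: indicator_def)
        finally show ?thesis .
      qed
      also have "\<dots> = (\<integral>\<^sup>+w. indicator B x \<partial>PX x)"
        using at(4)[OF x] by (intro nn_integral_cong_AE) (auto elim: eventually_mono)
      finally show "emeasure (PX x) ((\<lambda>w. w 0) -` B \<inter> path_space T) = indicator B x"
        by (simp add: emeasure_space_1)
    qed
    finally show "emeasure (distr (\<mu> \<bind> PX) (univ_borel T) (\<lambda>w. w 0)) B = emeasure \<mu> B"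
      using B \<mu>(2) by simp
  qed (simp add: \<mu>(2))
qed

section \<open>Restriction to a subspace\<close>

text \<open>Since A has full outer measure, the trace of a measurable set C on A has outer measure
  equal to the measure of C. Thus the outer measure is countably additive on traces, although A
  itself need not be measurable.\<close>

lemma trace_measure:
  assumes D: "prob_space D" and A: "A \<subseteq> space D" and full: "outer_measure_of D A = 1"
  obtains Q where "space Q = A" "sets Q = sets (restrict_space D A)" "(\<lambda>x. x) \<in> Q \<rightarrow>\<^sub>M D" "distr Q D (\<lambda>x. x) = D"
proof -
  interpret D: prob_space D by fact
  let ?R = "restrict_space D A"
  have spR: "space ?R = A" using A by (auto simp: space_restrict_space)
  have out: "outer_measure_of D (A \<inter> C) = emeasure D C" if C: "C \<in> sets D" for C
  proof (rule antisym)
    have "outer_measure_of D (A \<inter> C) \<le> outer_measure_of D C" by (rule outer_measure_of_mono) auto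
    then show "outer_measure_of D (A \<inter> C) \<le> emeasure D C" using C by simp
    have AC: "A \<inter> C \<subseteq> space D" using A by auto
    obtain E where E: "E \<in> sets D" "A \<inter> C \<subseteq> E" "outer_measure_of D (A \<inter> C) = emeasure D E"
      using bexE[OF outer_measure_of_attain[OF AC]] by (metis (no_types))
    \<comment> \<open>Adding the complement of C turns a cover E of the trace into a cover of all of
      A, whose measure is therefore at least 1. Hence E is no smaller than C in measure.\<close>
    have "1 \<le> emeasure D (E \<union> (space D - C))"
      unfolding full[symmetric] outer_measure_of_def using E C A by (intro INF_lower) auto
    then have "1 \<le> D.prob (E \<union> (space D - C))" by (simp add: D.emeasure_eq_measure)
    also have "\<dots> \<le> D.prob E + D.prob (space D - C)" using E C by (intro measure_Un_le) auto
    also have "D.prob (space D - C) = 1 - D.prob C" by (rule D.prob_compl[OF C])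
    finally show "emeasure D C \<le> outer_measure_of D (A \<inter> C)"
      unfolding E(3) by (simp add: D.emeasure_eq_measure)
  qed
  define Q where "Q = measure_of A (sets ?R) (outer_measure_of D)"
  have sR: "sigma_algebra A (sets ?R)" using sets.sigma_algebra_axioms[of ?R] spR by simp
  have sQ: "sets Q = sets ?R" and spQ: "space Q = A"
    unfolding Q_def using sR by (simp_all add: sigma_algebra.sets_measure_of_eq sigma_algebra.space_measure_of_eq)
  have eQ: "emeasure Q (A \<inter> C) = emeasure D C" if C: "C \<in> sets D" for C
  proof -
    have "emeasure Q (A \<inter> C) = outer_measure_of D (A \<inter> C)"
      unfolding Q_def
    proof (rule emeasure_measure_of_sigma[OF sR])
      show "positive (sets ?R) (outer_measure_of D)" by (simp add: positive_def)
      show "countably_additive (sets ?R) (outer_measure_of D)"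
      proof (rule countably_additiveI)
        fix B :: "nat \<Rightarrow> _" assume B: "range B \<subseteq> sets ?R" "disjoint_family B"
        then have "\<forall>i. \<exists>C. C \<in> sets D \<and> B i = A \<inter> C" by (auto simp: sets_restrict_space)
        then obtain C where C: "\<And>i. C i \<in> sets D" "\<And>i. B i = A \<inter> C i" by metis
        \<comment> \<open>The sets \<open>C i\<close> may overlap outside A even though their traces
          are disjoint; \<open>disjointed\<close> removes the overlap and leaves the traces
          unchanged.\<close>
        have dC: "disjointed C i \<in> sets D" for i
          using C(1) sets.range_disjointed_sets[of C D] by auto
        have Bd: "B i = A \<inter> disjointed C i" for i
        proof -
          have "B i \<inter> B j = {}" if "j < i" for j using B(2) that by (auto simp: disjoint_family_on_def)
          then have "x \<notin> C j" if "x \<in> A" "x \<in> C i" "j < i" for x j using C(2) that by blast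
          then show ?thesis unfolding C(2) disjointed_def by auto
        qed
        have "(\<Sum>i. outer_measure_of D (B i)) = (\<Sum>i. emeasure D (disjointed C i))"
          unfolding Bd by (simp add: out[OF dC])
        also have "\<dots> = emeasure D (\<Union>i. disjointed C i)"
          using dC disjoint_family_disjointed by (intro suminf_emeasure) auto
        also have "\<dots> = outer_measure_of D (A \<inter> (\<Union>i. disjointed C i))"
          using dC by (intro out[symmetric]) auto
        also have "A \<inter> (\<Union>i. disjointed C i) = (\<Union>i. B i)" using Bd by auto
        finally show "(\<Sum>i. outer_measure_of D (B i)) = outer_measure_of D (\<Union>i. B i)" .
      qed
      show "A \<inter> C \<in> sets ?R" using C by (auto simp: sets_restrict_space)
    qed
    then show ?thesis using out[OF C] by simp
  qed
  have id: "(\<lambda>x. x) \<in> Q \<rightarrow>\<^sub>M D"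
    using measurable_restrict_space1[of "\<lambda>x. x" D D A] measurable_cong_sets[OF sQ refl] by auto
  have "distr Q D (\<lambda>x. x) = D"
  proof (rule measure_eqI)
    fix C assume "C \<in> sets (distr Q D (\<lambda>x. x))"
    then have C: "C \<in> sets D" by simp
    then show "emeasure (distr Q D (\<lambda>x. x)) C = emeasure D C"
      using eQ[OF C] by (simp add: emeasure_distr[OF id C] spQ Int_commute)
  qed simp
  with spQ sQ id show ?thesis by (rule that)
qed

section \<open>One-time laws and right continuity in time\<close>

lemma markov_process_marginal:
  assumes P: "markov_transition_function S P" and mp: "markov_process S P M G X"
    and init: "distr M S (X 0) = return S x" and x: "x \<in> space S" and t: "0 \<le> t"
  shows "distr M S (X t) = P t x"
proof (rule measure_eqI)
  interpret markov_process S P M G X by fact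
  fix B assume "B \<in> sets (distr M S (X t))"
  then have B: "B \<in> sets S" by simp
  have "emeasure (distr M S (X t)) B = (\<integral>\<^sup>+y. indicator B y \<partial>distr M S (X t))" using B by simp
  also have "\<dots> = (\<integral>\<^sup>+\<omega>. indicator B (X t \<omega>) \<partial>M)"
    using B measurable_process[OF t] by (intro nn_integral_distr) auto
  also have "\<dots> = (\<integral>\<^sup>+\<omega>\<in>space M. indicator B (X (0 + t) \<omega>) \<partial>M)" by (simp cong: nn_integral_cong)
  also have "\<dots> = (\<integral>\<^sup>+\<omega>\<in>space M. (\<integral>\<^sup>+y. indicator B y \<partial>P t (X 0 \<omega>)) \<partial>M)"
    using t B sets.top[of "G 0"] space_filtration[of 0] by (intro markov) auto
  also have "\<dots> = (\<integral>\<^sup>+\<omega>. (\<integral>\<^sup>+y. indicator B y \<partial>P t (X 0 \<omega>)) \<partial>M)" by (simp cong: nn_integral_cong)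
  also have "\<dots> = (\<integral>\<^sup>+z. (\<integral>\<^sup>+y. indicator B y \<partial>P t z) \<partial>distr M S (X 0))"
    using B by (intro nn_integral_distr[symmetric] measurable_process)
      (auto intro: markov_transition_function_nn_integral_measurable[OF P t])
  also have "\<dots> = (\<integral>\<^sup>+y. indicator B y \<partial>P t x)"
    unfolding init using x B by (intro nn_integral_return markov_transition_function_nn_integral_measurable[OF P t]) auto
  also have "\<dots> = emeasure (P t x) B" using B markov_transition_function_at(2)[OF P t x] by simp
  finally show "emeasure (distr M S (X t)) B = emeasure (P t x) B" .
qed (simp add: markov_transition_function_at(2)[OF P t x])

lemma right_continuous_expectation:
  fixes f :: "'a \<Rightarrow> real"
  assumes M: "prob_space M" and X: "\<And>t. 0 \<le> t \<Longrightarrow> X t \<in> M \<rightarrow>\<^sub>M univ_borel T"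
    and rc: "\<And>\<omega>. \<omega> \<in> space M \<Longrightarrow> right_continuous_path T (\<lambda>t. X t \<omega>)"
    and f: "continuous_map T euclideanreal f" "\<And>x. x \<in> topspace T \<Longrightarrow> 0 \<le> f x \<and> f x \<le> 1"
    and t: "0 \<le> t"
  shows "((\<lambda>s. \<integral>x. f x \<partial>distr M (univ_borel T) (X s)) \<longlongrightarrow> (\<integral>x. f x \<partial>distr M (univ_borel T) (X t))) (at_right t)"
\<comment> \<open>Dominated convergence is applied along sequences decreasing to t;
  \<open>t + 1\<close> is just some point to the right of t.\<close>
proof (rule tendsto_at_right_sequentially[of t "t + 1"])
  interpret prob_space M by fact
  have fm: "f \<in> borel_measurable (univ_borel T)" by (rule continuous_map_borel_measurable_univ_borel[OF f(1)])
  have eq: "(\<integral>x. f x \<partial>distr M (univ_borel T) (X s)) = (\<integral>\<omega>. f (X s \<omega>) \<partial>M)" if "0 \<le> s" for s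
    by (rule integral_distr[OF X[OF that] fm])
  fix u :: "nat \<Rightarrow> real" assume u: "\<And>n. t < u n" "u \<longlonglongrightarrow> t"
  have u0: "0 \<le> u n" for n using u(1)[of n] t by linarith
  have "(\<lambda>n. \<integral>\<omega>. f (X (u n) \<omega>) \<partial>M) \<longlonglongrightarrow> (\<integral>\<omega>. f (X t \<omega>) \<partial>M)"
  proof (rule integral_dominated_convergence[where w = "\<lambda>_. 1"])
    show "(\<lambda>\<omega>. f (X t \<omega>)) \<in> borel_measurable M" "(\<lambda>\<omega>. f (X (u n) \<omega>)) \<in> borel_measurable M" for n
      using measurable_compose[OF X fm] t u0 by auto
    show "AE \<omega> in M. norm (f (X (u n) \<omega>)) \<le> 1" for n
      using f(2) measurable_space[OF X[OF u0]] by (intro AE_I2) (simp add: abs_le_iff)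
    show "AE \<omega> in M. (\<lambda>n. f (X (u n) \<omega>)) \<longlonglongrightarrow> f (X t \<omega>)"
    proof (rule AE_I2)
      fix \<omega> assume "\<omega> \<in> space M"
      then have "limitin T (\<lambda>s. X s \<omega>) (X t \<omega>) (at_right t)"
        using rc t by (simp add: right_continuous_path_def)
      then have "((\<lambda>s. f (X s \<omega>)) \<longlongrightarrow> f (X t \<omega>)) (at_right t)"
        using continuous_map_limit[OF f(1)] by (simp add: comp_def)
      moreover have "filterlim u (at_right t) sequentially"
        unfolding filterlim_at using u(1) by (auto intro!: u(2) always_eventually)
      ultimately show "(\<lambda>n. f (X (u n) \<omega>)) \<longlonglongrightarrow> f (X t \<omega>)" by (rule filterlim_compose)
    qed
  qed auto
  then show "(\<lambda>n. \<integral>x. f x \<partial>distr M (univ_borel T) (X (u n))) \<longlonglongrightarrow> (\<integral>x. f x \<partial>distr M (univ_borel T) (X t))"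
    using eq t u0 by simp
qed simp

lemma right_markov_realization_imp_markov_process:
  assumes "markov_transition_function (univ_borel T) P" "right_markov_realization T P \<mu> M G X"
  shows "markov_process (univ_borel T) P M G X"
  using assms by (intro markov_property_imp_markov_process) (auto simp: right_markov_realization_def)

text \<open>In a realization started at the point x the law of X s is P s x, so right continuity of
  the paths passes to these expectations by dominated convergence.\<close>

lemma hd1_right_continuous_expectation:
  assumes P: "markov_transition_function (univ_borel T) P" and hd: "hd1 T P"
    and x: "x \<in> topspace T" and t: "0 \<le> t"
    and f: "continuous_map T euclideanreal f" "\<And>x. x \<in> topspace T \<Longrightarrow> 0 \<le> f x \<and> f x \<le> 1"
  shows "((\<lambda>s. \<integral>y. f y \<partial>P s x) \<longlongrightarrow> (\<integral>y. f y \<partial>P t x)) (at_right t)"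
proof -
  let ?\<mu> = "return (univ_borel T) x"
  have "prob_space ?\<mu>" "sets ?\<mu> = sets (univ_borel T)" using x by (auto intro: prob_space_return)
  then obtain M :: "(real \<Rightarrow> 'a) measure" and G X where R: "right_markov_realization T P ?\<mu> M G X"
    using hd unfolding hd1_def by blast
  note mp = right_markov_realization_imp_markov_process[OF P R]
  have law: "distr M (univ_borel T) (X s) = P s x" if "0 \<le> s" for s
    using R x that by (intro markov_process_marginal[OF P mp]) (auto simp: right_markov_realization_def)
  have "((\<lambda>s. \<integral>y. f y \<partial>distr M (univ_borel T) (X s)) \<longlongrightarrow> (\<integral>y. f y \<partial>distr M (univ_borel T) (X t))) (at_right t)"
    using R markov_process.measurable_process[OF mp] f t
    by (intro right_continuous_expectation) (auto simp: right_markov_realization_def)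
  then have "((\<lambda>s. \<integral>y. f y \<partial>distr M (univ_borel T) (X s)) \<longlongrightarrow> (\<integral>y. f y \<partial>P t x)) (at_right t)"
    by (simp add: law[OF t])
  moreover have "\<forall>\<^sub>F s in at_right t. (\<integral>y. f y \<partial>distr M (univ_borel T) (X s)) = (\<integral>y. f y \<partial>P s x)"
    using t law by (auto simp: eventually_at_right_field intro!: exI[of _ "t + 1"])
  ultimately show ?thesis by (rule Lim_transform_eventually)
qed

lemma resolvent_eq_laplace:
  assumes P: "markov_transition_function S P" and x: "x \<in> space S"
    and f: "f \<in> borel_measurable S" "\<And>y. y \<in> space S \<Longrightarrow> 0 \<le> f y \<and> f y \<le> 1"
  shows "resolvent P \<alpha> (\<lambda>y. ennreal (f y)) x =
    (\<integral>\<^sup>+t\<in>{0..}. ennreal (exp (- \<alpha> * t)) * ennreal (\<integral>y. f y \<partial>P t x) \<partial>lebesgue)"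
    and "0 \<le> t \<Longrightarrow> 0 \<le> (\<integral>y. f y \<partial>P t x)" and "0 \<le> t \<Longrightarrow> (\<integral>y. f y \<partial>P t x) \<le> 1"
proof -
  have int: "integrable (P t x) f" if t: "0 \<le> t" for t
  proof -
    interpret prob_space "P t x" using markov_transition_function_at(1)[OF P t x] .
    have "f \<in> borel_measurable (P t x)"
      using f(1) measurable_cong_sets[OF markov_transition_function_at(2)[OF P t x] refl] by blast
    moreover have "AE y in P t x. norm (f y) \<le> 1"
      using f(2) markov_transition_function_at(3)[OF P t x] by (intro AE_I2) (simp add: abs_le_iff)
    ultimately show ?thesis by (intro integrable_const_bound)
  qed
  show "resolvent P \<alpha> (\<lambda>y. ennreal (f y)) x =
    (\<integral>\<^sup>+t\<in>{0..}. ennreal (exp (- \<alpha> * t)) * ennreal (\<integral>y. f y \<partial>P t x) \<partial>lebesgue)"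
    unfolding resolvent_def
  proof (rule nn_integral_cong)
    fix t :: real
    have "(\<integral>\<^sup>+y. ennreal (f y) \<partial>P t x) = ennreal (\<integral>y. f y \<partial>P t x)" if "0 \<le> t"
      using int[OF that] f(2) markov_transition_function_at(3)[OF P that x]
      by (intro nn_integral_eq_integral) auto
    then show "ennreal (exp (- \<alpha> * t)) * (\<integral>\<^sup>+y. ennreal (f y) \<partial>P t x) * indicator {0..} t =
      ennreal (exp (- \<alpha> * t)) * ennreal (\<integral>y. f y \<partial>P t x) * indicator {0..} t"
      by (simp add: indicator_def)
  qed
  show "0 \<le> (\<integral>y. f y \<partial>P t x)" "(\<integral>y. f y \<partial>P t x) \<le> 1" if t: "0 \<le> t"
  proof -
    interpret prob_space "P t x" using markov_transition_function_at(1)[OF P t x] .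
    have sp: "space (P t x) = space S" using markov_transition_function_at(3)[OF P t x] .
    show "0 \<le> (\<integral>y. f y \<partial>P t x)" using f(2) sp by (intro Bochner_Integration.integral_nonneg) auto
    have "(\<integral>y. f y \<partial>P t x) \<le> (\<integral>y. 1 \<partial>P t x)" using int[OF t] f(2) sp by (intro integral_mono) auto
    then show "(\<integral>y. f y \<partial>P t x) \<le> 1" by (simp add: prob_space)
  qed
qed

section \<open>Comparison of the two transition functions\<close>

lemma measurable_inclusion_univ_borel:
  assumes "S \<in> sets (univ_borel T)"
  shows "(\<lambda>x. x) \<in> univ_borel (subtopology T S) \<rightarrow>\<^sub>M univ_borel T"
  using measurable_restrict_space1[of "\<lambda>x. x" "univ_borel T" "univ_borel T" S]
    measurable_cong_sets[OF sets_univ_borel_subtopology[OF assms] refl] by auto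

lemma transition_functions_agree:
  assumes T: "metrizable_space T"
    and P: "markov_transition_function (univ_borel T) P" and hd: "hd1 T P"
    and S: "S \<in> sets (univ_borel T)"
    and P': "markov_transition_function (univ_borel (subtopology T S)) P'" and hd': "hd1 (subtopology T S) P'"
    and res: "\<And>\<alpha> f x. 0 < \<alpha> \<Longrightarrow> f \<in> borel_measurable (univ_borel T) \<Longrightarrow> x \<in> S \<Longrightarrow>
       resolvent P' \<alpha> f x = resolvent P \<alpha> f x"
    and t: "0 \<le> t" and x: "x \<in> S"
  shows "distr (P' t x) (univ_borel T) (\<lambda>x. x) = P t x"
proof -
  let ?T' = "subtopology T S"
  have ST: "S \<subseteq> topspace T" using sets.sets_into_space[OF S] by simp
  have tS: "topspace ?T' = S" using ST by (simp add: Int_absorb1)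
  have xT: "x \<in> topspace T" using x ST by auto
  have xS: "x \<in> space (univ_borel ?T')" "x \<in> space (univ_borel T)" "x \<in> topspace ?T'" using x xT tS by auto
  note at = markov_transition_function_at[OF P t xS(2)] and at' = markov_transition_function_at[OF P' t xS(1)]
  have inc: "(\<lambda>x. x) \<in> P' t x \<rightarrow>\<^sub>M univ_borel T"
    using measurable_inclusion_univ_borel[OF S] measurable_cong_sets[OF at'(2) refl] by blast
  show ?thesis
  proof (rule measure_eqI_continuous_map[OF T])
    show "finite_measure (distr (P' t x) (univ_borel T) (\<lambda>x. x))"
      using prob_space.prob_space_distr[OF at'(1) inc] by (simp add: prob_space.finite_measure)
    show "finite_measure (P t x)" using at(1) by (simp add: prob_space.finite_measure)
    show "sets (P t x) = sets (univ_borel T)" by (rule at(2))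
    fix f assume f: "continuous_map T euclideanreal f" "\<And>x. x \<in> topspace T \<Longrightarrow> 0 \<le> f x \<and> f x \<le> 1"
    \<comment> \<open>One f tests both families: its restriction to S is continuous there, so the
      realizations of P' in S give right continuity for P' just as those in T do for P.\<close>
    have f': "continuous_map ?T' euclideanreal f" "\<And>x. x \<in> topspace ?T' \<Longrightarrow> 0 \<le> f x \<and> f x \<le> 1"
      using f ST tS by (auto intro: continuous_map_from_subtopology)
    note fm = continuous_map_borel_measurable_univ_borel[OF f(1)]
      and fm' = continuous_map_borel_measurable_univ_borel[OF f'(1)]
    have fb: "\<And>x. x \<in> space (univ_borel T) \<Longrightarrow> 0 \<le> f x \<and> f x \<le> 1"
      "\<And>x. x \<in> space (univ_borel ?T') \<Longrightarrow> 0 \<le> f x \<and> f x \<le> 1" using f(2) f'(2) by auto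
    note L = resolvent_eq_laplace[OF P xS(2) fm fb(1)] and L' = resolvent_eq_laplace[OF P' xS(1) fm' fb(2)]
    have "(\<integral>y. f y \<partial>P' t x) = (\<integral>y. f y \<partial>P t x)"
    proof (rule laplace_right_continuous_eq[OF _ _ _ _ _ _ _ t])
      show "((\<lambda>s. \<integral>y. f y \<partial>P' s x) \<longlongrightarrow> (\<integral>y. f y \<partial>P' u x)) (at_right u)" if "0 \<le> u" for u
        by (rule hd1_right_continuous_expectation[OF P' hd' xS(3) that f'])
      show "((\<lambda>s. \<integral>y. f y \<partial>P s x) \<longlongrightarrow> (\<integral>y. f y \<partial>P u x)) (at_right u)" if "0 \<le> u" for u
        by (rule hd1_right_continuous_expectation[OF P hd xT that f])
      fix \<alpha> :: real assume \<alpha>: "0 < \<alpha>"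
      have "resolvent P' \<alpha> (\<lambda>y. ennreal (f y)) x = resolvent P \<alpha> (\<lambda>y. ennreal (f y)) x"
        using fm by (intro res[OF \<alpha> _ x]) simp
      then show "(\<integral>\<^sup>+t\<in>{0..}. ennreal (exp (- \<alpha> * t)) * ennreal (\<integral>y. f y \<partial>P' t x) \<partial>lebesgue)
        = (\<integral>\<^sup>+t\<in>{0..}. ennreal (exp (- \<alpha> * t)) * ennreal (\<integral>y. f y \<partial>P t x) \<partial>lebesgue)"
        by (simp only: L(1) L'(1))
    qed (use L(2,3) L'(2,3) in auto)
    then show "(\<integral>y. f y \<partial>distr (P' t x) (univ_borel T) (\<lambda>x. x)) = (\<integral>y. f y \<partial>P t x)"
      using integral_distr[OF inc fm] by simp
  qed simp
qed

section \<open>Transfer of processes and laws between subspace and whole space\<close>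

lemma measurable_path_map:
  assumes X: "\<And>t. 0 \<le> t \<Longrightarrow> X t \<in> M \<rightarrow>\<^sub>M univ_borel T"
    and rc: "\<And>\<omega>. \<omega> \<in> space M \<Longrightarrow> right_continuous_path T (\<lambda>t. X t \<omega>)"
  shows "(\<lambda>\<omega>. \<lambda>t\<in>{0..}. X t \<omega>) \<in> M \<rightarrow>\<^sub>M path_algebra T"
  unfolding path_algebra_def
proof (rule measurable_measure_of)
  let ?p = "\<lambda>\<omega>. \<lambda>t\<in>{0..}. X t \<omega>"
  show path: "?p \<in> space M \<rightarrow> path_space T"
  proof
    fix \<omega> assume \<omega>: "\<omega> \<in> space M"
    have "limitin T (?p \<omega>) (?p \<omega> t) (at_right t)" if "t \<ge> 0" for t
    proof -
      \<comment> \<open>Cutting the path off at negative times does not affect right limits at t >=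
        0.\<close>
      have "eventually (\<lambda>s. X s \<omega> = ?p \<omega> s) (at_right t)"
        using that by (auto simp: eventually_at_right_field intro!: exI[of _ "t + 1"])
      moreover have "limitin T (\<lambda>t. X t \<omega>) (?p \<omega> t) (at_right t)"
        using rc[OF \<omega>] that by (simp add: right_continuous_path_def)
      ultimately show ?thesis by (rule limitin_transform_eventually)
    qed
    then show "?p \<omega> \<in> path_space T"
      using rc[OF \<omega>] by (auto simp: path_space_def right_continuous_path_def)
  qed
  fix A assume "A \<in> {{w \<in> path_space T. w s \<in> B} | s B. 0 \<le> s \<and> B \<in> sets (univ_borel T)}"
  then obtain s B where s: "0 \<le> s" "B \<in> sets (univ_borel T)" and A: "A = {w \<in> path_space T. w s \<in> B}" by blast
  have "?p -` A \<inter> space M = X s -` B \<inter> space M" unfolding A using path s(1) by auto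
  then show "?p -` A \<inter> space M \<in> sets M" using measurable_sets[OF X[OF s(1)] s(2)] by simp
qed auto

lemma right_markov_realizationI:
  assumes P: "markov_transition_function (univ_borel T) P" and M: "prob_space M"
    and mp: "markov_process (univ_borel T) P M G X"
    and rc: "\<And>\<omega>. \<omega> \<in> space M \<Longrightarrow> right_continuous_path T (\<lambda>t. X t \<omega>)"
    and law: "distr M (univ_borel T) (X 0) = \<mu>"
  shows "right_markov_realization T P \<mu> M G X"
proof -
  interpret markov_process "univ_borel T" P M G X by fact
  have "\<forall>t\<ge>0. subalgebra M (G t)" "\<forall>s t. 0 \<le> s \<and> s \<le> t \<longrightarrow> sets (G s) \<subseteq> sets (G t)"
    "\<forall>t\<ge>0. X t \<in> G t \<rightarrow>\<^sub>M univ_borel T"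
    using filtration filtration_mono adapted by auto
  moreover have "\<forall>\<omega>\<in>space M. right_continuous_path T (\<lambda>t. X t \<omega>)" using rc by auto
  moreover have "markov_property T P M G X" by (rule markov_process_imp_markov_property[OF P M mp])
  ultimately show ?thesis unfolding right_markov_realization_def using M law by (intro conjI)
qed

text \<open>The process is kept and only its state space enlarged. It visits points of S alone,
  where the kernels of P are the images of those of P', and limits in the subspace are limits in
  T.\<close>

lemma right_markov_realization_supertopology:
  assumes S: "S \<in> sets (univ_borel T)"
    and P: "markov_transition_function (univ_borel T) P"
    and P': "markov_transition_function (univ_borel (subtopology T S)) P'"
    and agree: "\<And>t x. 0 \<le> t \<Longrightarrow> x \<in> S \<Longrightarrow> distr (P' t x) (univ_borel T) (\<lambda>x. x) = P t x"
    and R: "right_markov_realization (subtopology T S) P' \<mu> M G X"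
  shows "right_markov_realization T P (distr \<mu> (univ_borel T) (\<lambda>x. x)) M G X"
proof -
  let ?T' = "subtopology T S"
  note inc = measurable_inclusion_univ_borel[OF S]
  interpret mp': markov_process "univ_borel ?T'" P' M G X
    by (rule right_markov_realization_imp_markov_process[OF P' R])
  have XS: "X t \<omega> \<in> S" "X t \<omega> \<in> space (univ_borel ?T')" if "0 \<le> t" "\<omega> \<in> space M" for t \<omega>
    using measurable_space[OF mp'.measurable_process[OF that(1)] that(2)] by auto
  have mp: "markov_process (univ_borel T) P M G X"
  proof
    show "X t \<in> G t \<rightarrow>\<^sub>M univ_borel T" if "0 \<le> t" for t
      using measurable_compose[OF mp'.adapted[OF that] inc] by simp
    fix t s :: real and A and f :: "'a \<Rightarrow> ennreal"
    assume t: "0 \<le> t" and s: "0 \<le> s" and A: "A \<in> sets (G t)" and f: "f \<in> borel_measurable (univ_borel T)"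
    have f': "f \<in> borel_measurable (univ_borel ?T')" using measurable_compose[OF inc f] by simp
    have eq: "(\<integral>\<^sup>+y. f y \<partial>P' s (X t \<omega>)) = (\<integral>\<^sup>+y. f y \<partial>P s (X t \<omega>))" if \<omega>: "\<omega> \<in> space M" for \<omega>
    proof -
      have "(\<lambda>x. x) \<in> P' s (X t \<omega>) \<rightarrow>\<^sub>M univ_borel T"
        using inc measurable_cong_sets[OF markov_transition_function_at(2)[OF P' s XS(2)[OF t \<omega>]] refl] by blast
      then have "(\<integral>\<^sup>+y. f y \<partial>distr (P' s (X t \<omega>)) (univ_borel T) (\<lambda>x. x)) = (\<integral>\<^sup>+y. f y \<partial>P' s (X t \<omega>))"
        using f by (intro nn_integral_distr) auto
      then show ?thesis by (simp add: agree[OF s XS(1)[OF t \<omega>]])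
    qed
    have "(\<integral>\<^sup>+\<omega>\<in>A. f (X (t + s) \<omega>) \<partial>M) = (\<integral>\<^sup>+\<omega>\<in>A. (\<integral>\<^sup>+y. f y \<partial>P' s (X t \<omega>)) \<partial>M)"
      by (rule mp'.markov[OF t s A f'])
    also have "\<dots> = (\<integral>\<^sup>+\<omega>\<in>A. (\<integral>\<^sup>+y. f y \<partial>P s (X t \<omega>)) \<partial>M)"
      by (rule nn_integral_cong) (simp add: eq)
    finally show "(\<integral>\<^sup>+\<omega>\<in>A. f (X (t + s) \<omega>) \<partial>M) = (\<integral>\<^sup>+\<omega>\<in>A. (\<integral>\<^sup>+y. f y \<partial>P s (X t \<omega>)) \<partial>M)" .
  qed (use mp'.filtration mp'.filtration_mono in auto)
  have M: "prob_space M" and law: "distr M (univ_borel ?T') (X 0) = \<mu>"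
    and rc: "\<And>\<omega>. \<omega> \<in> space M \<Longrightarrow> right_continuous_path ?T' (\<lambda>t. X t \<omega>)"
    using R by (auto simp: right_markov_realization_def)
  show ?thesis
  proof (rule right_markov_realizationI[OF P M mp])
    show "right_continuous_path T (\<lambda>t. X t \<omega>)" if "\<omega> \<in> space M" for \<omega>
      using rc[OF that] by (simp add: right_continuous_path_def limitin_subtopology)
    show "distr M (univ_borel T) (X 0) = distr \<mu> (univ_borel T) (\<lambda>x. x)"
      unfolding law[symmetric] using distr_distr[OF inc mp'.measurable_process[OF order_refl]]
      by (simp add: comp_def)
  qed
qed

text \<open>Moves a law carried by S to the subspace and back without loss. It is applied both to
  the kernels P t x and to initial laws.\<close>

lemma restrict_space_univ_borel:
  assumes S: "S \<in> sets (univ_borel T)" and m: "prob_space m" "sets m = sets (univ_borel T)"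
    and full: "emeasure m S = 1"
  shows "prob_space (restrict_space m S)" "sets (restrict_space m S) = sets (univ_borel (subtopology T S))"
    "distr (restrict_space m S) (univ_borel T) (\<lambda>x. x) = m"
proof -
  interpret prob_space m by fact
  have Sm: "S \<in> sets m" using S m(2) by simp
  have ST: "S \<subseteq> space m" using sets.sets_into_space[OF Sm] .
  have sp: "space (restrict_space m S) = S" using ST by (auto simp: space_restrict_space)
  show "prob_space (restrict_space m S)"
    using Sm full sp ST by (intro prob_spaceI) (simp add: emeasure_restrict_space Int_absorb2)
  show s: "sets (restrict_space m S) = sets (univ_borel (subtopology T S))"
    unfolding sets_univ_borel_subtopology[OF S] by (rule sets_restrict_space_cong[OF m(2)])
  have inc: "(\<lambda>x. x) \<in> restrict_space m S \<rightarrow>\<^sub>M univ_borel T"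
    using measurable_inclusion_univ_borel[OF S] measurable_cong_sets[OF s refl] by blast
  show "distr (restrict_space m S) (univ_borel T) (\<lambda>x. x) = m"
  proof (rule measure_eqI)
    fix B assume "B \<in> sets (distr (restrict_space m S) (univ_borel T) (\<lambda>x. x))"
    then have B: "B \<in> sets (univ_borel T)" by simp
    have "emeasure (distr (restrict_space m S) (univ_borel T) (\<lambda>x. x)) B = emeasure (restrict_space m S) (B \<inter> S)"
      by (simp add: emeasure_distr[OF inc B] sp)
    also have "\<dots> = emeasure m (B \<inter> S)" using Sm ST by (intro emeasure_restrict_space) (auto simp: Int_absorb2)
    also have "\<dots> = emeasure m B"
    proof (rule emeasure_eq_AE)
      have "prob S = 1" using full by (simp add: emeasure_eq_measure)
      then have "AE x in m. x \<in> S" by (rule AE_prob_1)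
      then show "AE x in m. x \<in> B \<inter> S \<longleftrightarrow> x \<in> B" by eventually_elim simp
    qed (use B m(2) Sm in auto)
    finally show "emeasure (distr (restrict_space m S) (univ_borel T) (\<lambda>x. x)) B = emeasure m B" .
  qed (simp add: m(2))
qed

lemma emeasure_restrict_univ_borel:
  assumes S: "S \<in> sets (univ_borel T)" and m: "sets m = sets (univ_borel T)"
    and B: "B \<in> sets (univ_borel (subtopology T S))"
  shows "emeasure (restrict_space m S) B = emeasure m B"
proof -
  have "B \<subseteq> S" using sets.sets_into_space[OF B] by simp
  then show ?thesis using S m sets.sets_into_space[OF S] sets_eq_imp_space_eq[OF m]
    by (intro emeasure_restrict_space) (auto simp: Int_absorb2)
qed

lemma full_outer_measure_of_realization:
  assumes P: "markov_transition_function (univ_borel T) P" and PX: "canonical_realization T P PX"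
    and \<mu>: "prob_space \<mu>" "sets \<mu> = sets (univ_borel T)"
    and R: "right_markov_realization T P \<mu> M G X"
    and XS: "\<And>\<omega> t. \<omega> \<in> space M \<Longrightarrow> 0 \<le> t \<Longrightarrow> X t \<omega> \<in> S"
  shows "outer_measure_of (\<mu> \<bind> PX) {w \<in> path_space T. \<forall>t\<ge>0. w t \<in> S} = 1"
proof -
  let ?p = "\<lambda>\<omega>. \<lambda>t\<in>{0..}. X t \<omega>" and ?A = "{w \<in> path_space T. \<forall>t\<ge>0. w t \<in> S}"
  note b = canonical_realization_bind[OF P PX \<mu>]
  interpret M: prob_space M using R by (simp add: right_markov_realization_def)
  interpret B: prob_space "\<mu> \<bind> PX" by (rule b(1))
  have sp: "space (\<mu> \<bind> PX) = path_space T" using sets_eq_imp_space_eq[OF b(2)] by simp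
  have p: "?p \<in> M \<rightarrow>\<^sub>M path_algebra T"
    using R markov_process.measurable_process[OF right_markov_realization_imp_markov_process[OF P R]]
    by (intro measurable_path_map) (auto simp: right_markov_realization_def)
  let ?D = "distr M (path_algebra T) ?p"
  have RD: "right_markov_realization T P \<mu> ?D (path_filtration T) (\<lambda>t w. w t)"
    by (rule right_markov_realization_path_space[OF P R])
  have D: "?D = \<mu> \<bind> PX"
  proof (rule markov_process_law_unique[OF P _ b(2) _ right_markov_realization_imp_markov_process[OF P RD] b(3)])
    show "finite_measure ?D" using RD by (simp add: right_markov_realization_def prob_space.finite_measure)
    show "distr ?D (univ_borel T) (\<lambda>w. w 0) = distr (\<mu> \<bind> PX) (univ_borel T) (\<lambda>w. w 0)"
      unfolding b(4) using RD by (simp add: right_markov_realization_def)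
  qed simp
  show ?thesis
  proof (rule antisym)
    show "outer_measure_of (\<mu> \<bind> PX) ?A \<le> 1"
      using outer_measure_of_mono[of ?A "space (\<mu> \<bind> PX)" "\<mu> \<bind> PX"] sp B.emeasure_space_1
        outer_measure_of_eq[OF sets.top[of "\<mu> \<bind> PX"]] by auto
    show "1 \<le> outer_measure_of (\<mu> \<bind> PX) ?A"
      unfolding outer_measure_of_def
    proof (rule INF_greatest)
      fix C assume "C \<in> {C \<in> sets (\<mu> \<bind> PX). ?A \<subseteq> C}"
      then have C: "C \<in> sets (path_algebra T)" "?A \<subseteq> C" using b(2) by auto
      \<comment> \<open>Every path of the process stays in S, so C contains the whole range of ?p
        and the preimage omits nothing.\<close>
      have "?p -` C \<inter> space M = space M"
        using C(2) XS measurable_space[OF p] by fastforce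
      then have "emeasure ?D C = 1" using C(1) M.emeasure_space_1 by (simp add: emeasure_distr[OF p])
      then show "1 \<le> emeasure (\<mu> \<bind> PX) C" unfolding D by simp
    qed
  qed
qed

section \<open>The restricted transition function and its realization\<close>

lemma quasi_absorbing_transition:
  assumes P: "markov_transition_function (univ_borel T) P" and PX: "canonical_realization T P PX"
    and S: "S \<in> sets (univ_borel T)" and qa: "quasi_absorbing T PX S"
    and t: "0 \<le> t" and x: "x \<in> S"
  shows "emeasure (P t x) S = 1"
proof -
  let ?\<mu> = "return (univ_borel T) x" and ?A = "{w \<in> path_space T. \<forall>t\<ge>0. w t \<in> S}"
  have xT: "x \<in> topspace T" using x sets.sets_into_space[OF S] by auto
  have \<mu>: "prob_space ?\<mu>" "sets ?\<mu> = sets (univ_borel T)" using xT by (auto intro: prob_space_return)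
  note b = canonical_realization_bind[OF P PX \<mu>]
  interpret B: prob_space "?\<mu> \<bind> PX" by (rule b(1))
  note mp = b(3)
  have c: "(\<lambda>w. w t) \<in> (?\<mu> \<bind> PX) \<rightarrow>\<^sub>M univ_borel T" using markov_process.measurable_process[OF mp t] .
  have law: "distr (?\<mu> \<bind> PX) (univ_borel T) (\<lambda>w. w t) = P t x"
    using xT t by (intro markov_process_marginal[OF P mp b(4)]) auto
  have "topspace T - S \<in> sets (univ_borel T)" using sets.compl_sets[OF S] by simp
  then have "emeasure ?\<mu> (topspace T - S) = 0" using x by (simp add: emeasure_return)
  then have "1 = outer_measure_of (?\<mu> \<bind> PX) ?A" using qa \<mu> unfolding quasi_absorbing_def by auto
  \<comment> \<open>The single-time event that w t lies in S is measurable and contains all paths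
    that stay in S. It thus bounds their outer measure from above, and its probability for a start
    at x is P t x S.\<close>
  also have "\<dots> \<le> emeasure (?\<mu> \<bind> PX) ((\<lambda>w. w t) -` S \<inter> space (?\<mu> \<bind> PX))"
    unfolding outer_measure_of_def
    using measurable_sets[OF c S] t sets_eq_imp_space_eq[OF b(2)] by (intro INF_lower) auto
  also have "\<dots> = emeasure (P t x) S" unfolding law[symmetric] by (rule emeasure_distr[OF c S, symmetric])
  finally show ?thesis
    using prob_space.emeasure_le_1[OF markov_transition_function_at(1)[OF P t]] xT by (simp add: antisym)
qed

text \<open>Each P t x with x in S is carried by S, so the intermediate state in the
  Chapman-Kolmogorov identity may be integrated over S alone.\<close>

lemma markov_transition_function_restrict:
  assumes P: "markov_transition_function (univ_borel T) P" and S: "S \<in> sets (univ_borel T)"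
    and full: "\<And>t x. 0 \<le> t \<Longrightarrow> x \<in> S \<Longrightarrow> emeasure (P t x) S = 1"
  shows "markov_transition_function (univ_borel (subtopology T S)) (\<lambda>t x. restrict_space (P t x) S)"
proof -
  let ?M' = "univ_borel (subtopology T S)"
  have ST: "S \<subseteq> topspace T" using sets.sets_into_space[OF S] by simp
  have sp: "space ?M' = S" using ST by (simp add: Int_absorb1)
  have xT: "x \<in> space (univ_borel T)" if "x \<in> S" for x using ST that by auto
  note at = markov_transition_function_at[OF P _ xT]
  have sB: "B \<in> sets (univ_borel T)" if "B \<in> sets ?M'" for B
    using that S ST unfolding sets_univ_borel_subtopology[OF S] by (subst (asm) sets_restrict_space_iff) (auto simp: Int_absorb2)
  note r = restrict_space_univ_borel[OF S at(1,2) full] and er = emeasure_restrict_univ_borel[OF S at(2)]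
  show ?thesis
    unfolding markov_transition_function_def
  proof (intro conjI allI impI ballI)
    fix t :: real assume t: "0 \<le> t"
    show "(\<lambda>x. restrict_space (P t x) S) \<in> ?M' \<rightarrow>\<^sub>M prob_algebra ?M'"
    proof (rule measurable_prob_algebraI)
      show "prob_space (restrict_space (P t x) S)" if "x \<in> space ?M'" for x
        using that t sp by (intro r(1)) auto
      show "(\<lambda>x. restrict_space (P t x) S) \<in> ?M' \<rightarrow>\<^sub>M subprob_algebra ?M'"
      proof (rule measurable_subprob_algebra)
        show "subprob_space (restrict_space (P t x) S)" if "x \<in> space ?M'" for x
          using that t sp by (intro prob_space_imp_subprob_space r(1)) auto
        show "sets (restrict_space (P t x) S) = sets ?M'" if "x \<in> space ?M'" for x
          using that t sp by (intro r(2)) auto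
        fix B assume B: "B \<in> sets ?M'"
        have *: "(\<lambda>x. emeasure (P t x) B) \<in> borel_measurable (univ_borel T)"
          by (rule measurable_emeasure_kernel[OF markov_transition_function_subprob[OF P t] sB[OF B]])
        have "(\<lambda>x. emeasure (P t x) B) \<in> borel_measurable ?M'"
          using measurable_compose[OF measurable_inclusion_univ_borel[OF S] *] by simp
        then show "(\<lambda>x. emeasure (restrict_space (P t x) S) B) \<in> borel_measurable ?M'"
          using er[OF t _ B] sp by (subst measurable_cong) auto
      qed
    qed
  next
    fix t s :: real and x B
    assume t: "0 \<le> t" and s: "0 \<le> s" and x: "x \<in> space ?M'" and B: "B \<in> sets ?M'"
    have xS: "x \<in> S" using x sp by simp
    have ts: "0 \<le> t + s" using t s by simp
    interpret prob_space "P t x" by (rule at(1)[OF t xS])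
    have Sm: "S \<in> sets (P t x)" using S at(2)[OF t xS] by simp
    have "prob S = 1" using full[OF t xS] by (simp add: emeasure_eq_measure)
    then have ae: "AE y in P t x. y \<in> S" by (rule AE_prob_1)
    have "emeasure (restrict_space (P (t + s) x) S) B = (\<integral>\<^sup>+y. emeasure (P s y) B \<partial>P t x)"
      using P t s xT[OF xS] sB[OF B] er[OF ts xS B] unfolding markov_transition_function_def by metis
    also have "\<dots> = (\<integral>\<^sup>+y. emeasure (restrict_space (P s y) S) B * indicator S y \<partial>P t x)"
      using ae by (intro nn_integral_cong_AE) (auto elim!: eventually_mono simp: er[OF s _ B])
    also have "\<dots> = (\<integral>\<^sup>+y. emeasure (restrict_space (P s y) S) B \<partial>restrict_space (P t x) S)"
      using Sm sets.sets_into_space[OF Sm] by (intro nn_integral_restrict_space[symmetric]) (simp add: Int_absorb2)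
    finally show "emeasure (restrict_space (P (t + s) x) S) B
      = (\<integral>\<^sup>+y. emeasure (restrict_space (P s y) S) B \<partial>restrict_space (P t x) S)" .
  qed
qed

text \<open>The process is realized on the set of paths that stay in \<open>S\<close>, which need not be measurable,
  under the trace of the canonical measure.\<close>

lemma hd1_restrict:
  assumes P: "markov_transition_function (univ_borel T) P" and PX: "canonical_realization T P PX"
    and S: "S \<in> sets (univ_borel T)" and qa: "quasi_absorbing T PX S"
  shows "hd1 (subtopology T S) (\<lambda>t x. restrict_space (P t x) S)"
  unfolding hd1_def
proof (intro allI impI, elim conjE)
  let ?T' = "subtopology T S"
  let ?M' = "univ_borel ?T'" and ?P' = "\<lambda>t x. restrict_space (P t x) S"
  fix \<mu>' assume \<mu>': "prob_space \<mu>'" "sets \<mu>' = sets ?M'"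
  note full = quasi_absorbing_transition[OF P PX S qa]
  note P' = markov_transition_function_restrict[OF P S full]
  have ST: "S \<subseteq> topspace T" using sets.sets_into_space[OF S] by simp
  have sp: "space ?M' = S" using ST by (simp add: Int_absorb1)
  have sp\<mu>: "space \<mu>' = S" using sets_eq_imp_space_eq[OF \<mu>'(2)] sp by simp
  have inc: "(\<lambda>x. x) \<in> \<mu>' \<rightarrow>\<^sub>M univ_borel T"
    using measurable_inclusion_univ_borel[OF S] measurable_cong_sets[OF \<mu>'(2) refl] by blast
  define \<mu> where "\<mu> = distr \<mu>' (univ_borel T) (\<lambda>x. x)"
  have \<mu>: "prob_space \<mu>" "sets \<mu> = sets (univ_borel T)"
    unfolding \<mu>_def using prob_space.prob_space_distr[OF \<mu>'(1) inc] by auto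
  have "topspace T - S \<in> sets (univ_borel T)" using sets.compl_sets[OF S] by simp
  then have \<mu>0: "emeasure \<mu> (topspace T - S) = 0"
    unfolding \<mu>_def by (simp add: emeasure_distr[OF inc] sp\<mu> Int_commute Int_Diff)
  define D where "D = \<mu> \<bind> PX"
  define \<Omega>' where "\<Omega>' = {w \<in> path_space T. \<forall>t\<ge>0. w t \<in> S}"
  note b = canonical_realization_bind[OF P PX \<mu>, folded D_def]
  have spD: "space D = path_space T" using sets_eq_imp_space_eq[OF b(2)] by simp
  have "outer_measure_of D \<Omega>' = 1"
    using qa \<mu> \<mu>0 unfolding quasi_absorbing_def D_def \<Omega>'_def by auto
  then obtain Q where Q: "space Q = \<Omega>'" "sets Q = sets (restrict_space D \<Omega>')" "(\<lambda>x. x) \<in> Q \<rightarrow>\<^sub>M D"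
    and QD: "distr Q D (\<lambda>x. x) = D"
    using trace_measure[OF b(1), of \<Omega>'] spD by (auto simp: \<Omega>'_def)
  \<comment> \<open>This identity carries the Markov property from \<open>D\<close> to
    \<open>Q\<close>: whatever is measurable for \<open>D\<close> has the same integral under
    both.\<close>
  have nn: "(\<integral>\<^sup>+w. h w \<partial>Q) = (\<integral>\<^sup>+w. h w \<partial>D)" if "h \<in> borel_measurable D" for h
    using nn_integral_distr[OF Q(3), of h] that QD by simp
  have pQ: "prob_space Q"
  proof
    have "emeasure Q (space Q) = emeasure (distr Q D (\<lambda>x. x)) (space D)"
      using Q(1) spD sets.top[of D] by (subst emeasure_distr[OF Q(3)]) (auto simp: \<Omega>'_def intro!: arg_cong[where f = "emeasure Q"])
    then show "emeasure Q (space Q) = 1" unfolding QD using prob_space.emeasure_space_1[OF b(1)] by simp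
  qed
  interpret D: markov_process "univ_borel T" P D "path_filtration T" "\<lambda>t w. w t" by (rule b(3))
  \<comment> \<open>The filtration is traced as well, so an event of \<open>G t\<close> is an event
    of the path filtration intersected with \<Omega>' and can be extended back to all paths.\<close>
  define G where "G t = restrict_space (path_filtration T t) \<Omega>'" for t
  have spG: "space (G t) = \<Omega>'" for t by (auto simp: G_def space_restrict_space \<Omega>'_def)
  have cG: "(\<lambda>w. w t) \<in> G t \<rightarrow>\<^sub>M ?M'" if t: "0 \<le> t" for t
  proof (rule measurableI)
    show "w t \<in> space ?M'" if "w \<in> space (G t)" for w using that t spG sp by (auto simp: \<Omega>'_def)
    fix B assume "B \<in> sets ?M'"
    then obtain C where C: "C \<in> sets (univ_borel T)" "B = S \<inter> C"
      unfolding sets_univ_borel_subtopology[OF S] sets_restrict_space by auto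
    have "(\<lambda>w. w t) -` B \<inter> space (G t) = \<Omega>' \<inter> ((\<lambda>w. w t) -` C \<inter> space (path_filtration T t))"
      using t by (auto simp: spG C(2) \<Omega>'_def)
    then show "(\<lambda>w. w t) -` B \<inter> space (G t) \<in> sets (G t)"
      using measurable_sets[OF D.adapted[OF t] C(1)] unfolding G_def sets_restrict_space by blast
  qed
  have mp: "markov_process ?M' ?P' Q G (\<lambda>t w. w t)"
  proof
    show "subalgebra Q (G t)" if "0 \<le> t" for t
    proof -
      have "sets (path_filtration T t) \<subseteq> sets D" using D.sets_filtration[OF that] by blast
      then have "sets (G t) \<subseteq> sets Q" unfolding G_def Q(2) sets_restrict_space by (rule image_mono)
      then show ?thesis using spG Q(1) by (simp add: subalgebra_def)
    qed
    show "sets (G s) \<subseteq> sets (G t)" if "0 \<le> s" "s \<le> t" for s t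
      unfolding G_def sets_restrict_space by (rule image_mono[OF D.filtration_mono[OF that]])
    show "(\<lambda>w. w t) \<in> G t \<rightarrow>\<^sub>M ?M'" if "0 \<le> t" for t by (rule cG[OF that])
    fix t s :: real and A and f :: "'a \<Rightarrow> ennreal"
    assume t: "0 \<le> t" and s: "0 \<le> s" and A: "A \<in> sets (G t)" and f: "f \<in> borel_measurable ?M'"
    obtain C where C: "C \<in> sets (path_filtration T t)" "A = \<Omega>' \<inter> C"
      using A unfolding G_def sets_restrict_space by auto
    have ts: "0 \<le> t + s" using t s by simp
    have CD: "C \<in> sets D" using D.sets_filtration[OF t C(1)] .
    \<comment> \<open>Functions on S are extended by 0, because the Markov property under
      \<open>D\<close> needs a function on all of T.\<close>
    define g where "g y = f y * indicator S y" for y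
    have g: "g \<in> borel_measurable (univ_borel T)"
      using f S ST measurable_cong_sets[OF sets_univ_borel_subtopology[OF S] refl, of "borel :: ennreal measure"]
      unfolding g_def by (subst borel_measurable_restrict_space_iff_ennreal[symmetric]) (auto simp: Int_absorb2)
    have hm: "(\<lambda>w. h (w u) * indicator C w) \<in> borel_measurable D"
      if "0 \<le> u" "h \<in> borel_measurable (univ_borel T)" for u and h :: "'a \<Rightarrow> ennreal"
      using measurable_compose[OF D.measurable_process[OF that(1)] that(2)] CD
      by (intro borel_measurable_times_ennreal) auto
    have wS: "w u \<in> S" if "w \<in> space Q" "0 \<le> u" for w u using that Q(1) by (auto simp: \<Omega>'_def)
    \<comment> \<open>On \<Omega>' the functions f and g agree along paths, and so do the indicators
      of A and C. After this replacement the integrals can be moved to \<open>D\<close>, where C is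
      an event, and back.\<close>
    have "(\<integral>\<^sup>+w\<in>A. f (w (t + s)) \<partial>Q) = (\<integral>\<^sup>+w\<in>C. g (w (t + s)) \<partial>Q)"
      by (rule nn_integral_cong) (use wS ts Q(1) C(2) in \<open>auto simp: g_def indicator_def\<close>)
    also have "\<dots> = (\<integral>\<^sup>+w\<in>C. g (w (t + s)) \<partial>D)" by (rule nn[OF hm[OF ts g]])
    also have "\<dots> = (\<integral>\<^sup>+w\<in>C. (\<integral>\<^sup>+y. g y \<partial>P s (w t)) \<partial>D)" by (rule D.markov[OF t s C(1) g])
    also have "\<dots> = (\<integral>\<^sup>+w\<in>C. (\<integral>\<^sup>+y. g y \<partial>P s (w t)) \<partial>Q)"
      by (rule nn[OF hm[OF t markov_transition_function_nn_integral_measurable[OF P s g]], symmetric])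
    also have "\<dots> = (\<integral>\<^sup>+w\<in>A. (\<integral>\<^sup>+y. f y \<partial>?P' s (w t)) \<partial>Q)"
    proof (rule nn_integral_cong)
      fix w assume w: "w \<in> space Q"
      have "w t \<in> space (univ_borel T)" using wS[OF w t] ST by auto
      then have "S \<in> sets (P s (w t))" using S markov_transition_function_at(2)[OF P s] by simp
      then have "(\<integral>\<^sup>+y. f y \<partial>?P' s (w t)) = (\<integral>\<^sup>+y. g y \<partial>P s (w t))"
        unfolding g_def using sets.sets_into_space by (intro nn_integral_restrict_space) (simp add: Int_absorb2)
      then show "(\<integral>\<^sup>+y. g y \<partial>P s (w t)) * indicator C w = (\<integral>\<^sup>+y. f y \<partial>?P' s (w t)) * indicator A w"
        using w Q(1) C(2) by (simp add: indicator_def)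
    qed
    finally show "(\<integral>\<^sup>+w\<in>A. f (w (t + s)) \<partial>Q) = (\<integral>\<^sup>+w\<in>A. (\<integral>\<^sup>+y. f y \<partial>?P' s (w t)) \<partial>Q)" .
  qed
  have c0: "(\<lambda>w. w 0) \<in> Q \<rightarrow>\<^sub>M ?M'" using markov_process.measurable_process[OF mp] by simp
  have "distr Q ?M' (\<lambda>w. w 0) = \<mu>'"
  proof (rule measure_eqI)
    fix B assume "B \<in> sets (distr Q ?M' (\<lambda>w. w 0))"
    then have B: "B \<in> sets ?M'" by simp
    then obtain C where C: "C \<in> sets (univ_borel T)" "B = S \<inter> C"
      unfolding sets_univ_borel_subtopology[OF S] sets_restrict_space by auto
    have BT: "B \<in> sets (univ_borel T)" using C S by auto
    have c: "(\<lambda>w. w 0) \<in> D \<rightarrow>\<^sub>M univ_borel T" using D.measurable_process by simp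
    have "emeasure (distr Q ?M' (\<lambda>w. w 0)) B = emeasure Q ((\<lambda>w. w 0) -` B \<inter> space Q)"
      by (rule emeasure_distr[OF c0 B])
    also have "\<dots> = emeasure (distr Q D (\<lambda>x. x)) ((\<lambda>w. w 0) -` B \<inter> space D)"
      using measurable_sets[OF c BT] Q(1) spD
      by (subst emeasure_distr[OF Q(3)]) (auto simp: \<Omega>'_def intro!: arg_cong[where f = "emeasure Q"])
    also have "\<dots> = emeasure (distr D (univ_borel T) (\<lambda>w. w 0)) B"
      unfolding QD by (rule emeasure_distr[OF c BT, symmetric])
    also have "\<dots> = emeasure \<mu>' B"
      unfolding b(4) unfolding \<mu>_def using emeasure_distr[OF inc BT] B \<mu>'(2) by simp
    finally show "emeasure (distr Q ?M' (\<lambda>w. w 0)) B = emeasure \<mu>' B" .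
  qed (simp add: \<mu>'(2))
  moreover have "right_continuous_path ?T' (\<lambda>t. w t)" if "w \<in> space Q" for w
  proof -
    have w: "right_continuous_path T w" "\<And>t. 0 \<le> t \<Longrightarrow> w t \<in> S"
      using that Q(1) by (auto simp: \<Omega>'_def path_space_def)
    \<comment> \<open>A limit in the subspace requires the path to be in S near the limit point;
      from the right of t only times above t >= 0 are seen.\<close>
    have "eventually (\<lambda>s. w s \<in> S) (at_right t)" if "0 \<le> t" for t
      using that w(2) by (auto simp: eventually_at_right_field intro!: exI[of _ "t + 1"])
    then show ?thesis using w by (simp add: right_continuous_path_def limitin_subtopology)
  qed
  ultimately have "right_markov_realization ?T' ?P' \<mu>' Q G (\<lambda>t w. w t)"
    by (intro right_markov_realizationI[OF P' pQ mp])
  then show "\<exists>(M :: (real \<Rightarrow> 'a) measure) G X. right_markov_realization ?T' ?P' \<mu>' M G X" by blast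
qed

theorem theorem2p4:
  fixes T :: "'a topology"
    and P :: "real \<Rightarrow> 'a \<Rightarrow> 'a measure"
    and PX :: "'a \<Rightarrow> (real \<Rightarrow> 'a) measure"
    and N :: "'a set"
    and U' :: "real \<Rightarrow> ('a \<Rightarrow> ennreal) \<Rightarrow> 'a \<Rightarrow> ennreal"
  assumes "radon_space T"
    and "markov_transition_function (univ_borel T) P"
    and "normal_transition_function (univ_borel T) P"
    and "hd1 T P"
    and "canonical_realization T P PX"
    and "N \<in> sets (univ_borel T)"
    and "weakly_negligible T (resolvent P) N"
    and "resolvent_restriction T N (resolvent P) U'"
  shows "let E' = topspace T - N; T' = subtopology T E'; M' = univ_borel T' in
    ((\<exists>P'. markov_transition_function M' P' \<and> hd1 T' P' \<and> has_resolvent M' P' U')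
       \<longleftrightarrow> quasi_absorbing T PX E') \<and>
    (\<forall>P'. markov_transition_function M' P' \<and> hd1 T' P' \<and> has_resolvent M' P' U' \<longrightarrow>
       (\<forall>t\<ge>0. \<forall>x\<in>E'. \<forall>B\<in>sets M'. emeasure (P' t x) B = emeasure (P t x) B))"
proof -
  note P = assms(2) and PX = assms(5)
  define S where "S = topspace T - N"
  let ?T' = "subtopology T S"
  let ?M' = "univ_borel ?T'"
  have S: "S \<in> sets (univ_borel T)" using sets.compl_sets[OF assms(6)] by (simp add: S_def)
  have ST: "S \<subseteq> topspace T" by (auto simp: S_def)
  have sp: "space ?M' = S" using ST by (simp add: Int_absorb1)
  note inc = measurable_inclusion_univ_borel[OF S]
  have U': "U' \<alpha> g x = resolvent P \<alpha> f x"
    if "0 < \<alpha>" "g \<in> borel_measurable ?M'" "f \<in> borel_measurable (univ_borel T)" "\<And>y. y \<in> S \<Longrightarrow> f y = g y" "x \<in> S"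
    for \<alpha> f g x
    using assms(8) that unfolding resolvent_restriction_def S_def by blast
  have agree: "distr (P' t x) (univ_borel T) (\<lambda>x. x) = P t x"
    if P': "markov_transition_function ?M' P'" "hd1 ?T' P'" "has_resolvent ?M' P' U'" and t: "0 \<le> t" and x: "x \<in> S"
    for P' t x
  proof (rule transition_functions_agree[OF radon_space_imp_metrizable[OF assms(1)] P assms(4) S P'(1,2) _ t x])
    fix \<alpha> :: real and f :: "'a \<Rightarrow> ennreal" and x assume \<alpha>: "0 < \<alpha>" and f: "f \<in> borel_measurable (univ_borel T)" and x: "x \<in> S"
    have f': "f \<in> borel_measurable ?M'" using measurable_compose[OF inc f] by simp
    \<comment> \<open>Here f plays two parts: as a function on S it is an argument of the restricted
      resolvent, and on T it is its own extension.\<close>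
    have "resolvent P' \<alpha> f x = U' \<alpha> f x" using P'(3) \<alpha> f' x sp unfolding has_resolvent_def by blast
    then show "resolvent P' \<alpha> f x = resolvent P \<alpha> f x" using U'[OF \<alpha> f' f _ x] by simp
  qed
  have "emeasure (P' t x) B = emeasure (P t x) B"
    if P': "markov_transition_function ?M' P'" "hd1 ?T' P'" "has_resolvent ?M' P' U'"
      and t: "0 \<le> t" and x: "x \<in> S" and B: "B \<in> sets ?M'" for P' t x B
  proof -
    have xM: "x \<in> space ?M'" using x sp by simp
    note at = markov_transition_function_at[OF P'(1) t xM]
    have inc': "(\<lambda>x. x) \<in> P' t x \<rightarrow>\<^sub>M univ_borel T" using inc measurable_cong_sets[OF at(2) refl] by blast
    obtain C where C: "C \<in> sets (univ_borel T)" "B = S \<inter> C"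
      using B unfolding sets_univ_borel_subtopology[OF S] sets_restrict_space by auto
    have BT: "B \<in> sets (univ_borel T)" using C S by auto
    have "emeasure (P t x) B = emeasure (P' t x) (B \<inter> space (P' t x))"
      using emeasure_distr[OF inc' BT] by (simp add: agree[OF P' t x])
    also have "B \<inter> space (P' t x) = B" using C(2) at(3) sp by auto
    finally show ?thesis by simp
  qed
  moreover have "quasi_absorbing T PX S"
    if P': "markov_transition_function ?M' P'" "hd1 ?T' P'" "has_resolvent ?M' P' U'" for P'
    unfolding quasi_absorbing_def
  proof (intro allI impI, elim conjE)
    fix \<mu> assume \<mu>: "prob_space \<mu>" "sets \<mu> = sets (univ_borel T)" and \<mu>0: "emeasure \<mu> (topspace T - S) = 0"
    interpret prob_space \<mu> by (rule \<mu>(1))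
    have sp\<mu>: "space \<mu> = topspace T" using sets_eq_imp_space_eq[OF \<mu>(2)] by simp
    have "prob S = 1" using prob_compl[of S] S \<mu>(2) \<mu>0 sp\<mu> by (simp add: measure_def)
    then have "emeasure \<mu> S = 1" by (simp add: emeasure_eq_measure)
    note r = restrict_space_univ_borel[OF S \<mu> this]
    \<comment> \<open>(HD1) for P' is used with \<mu> viewed as a law on S. Regarded in T, the
      resulting process realizes P with initial law \<mu> and never leaves S.\<close>
    obtain M :: "(real \<Rightarrow> 'a) measure" and G X where R: "right_markov_realization ?T' P' (restrict_space \<mu> S) M G X"
      using P'(2) r(1,2) unfolding hd1_def by blast
    have "right_markov_realization T P \<mu> M G X"
      using right_markov_realization_supertopology[OF S P P'(1) agree[OF P'] R] r(3) by simp
    then show "outer_measure_of (\<mu> \<bind> PX) {w \<in> path_space T. \<forall>t\<ge>0. w t \<in> S} = 1"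
      using R by (intro full_outer_measure_of_realization[OF P PX \<mu>])
        (auto simp: right_markov_realization_def right_continuous_path_def)
  qed
  moreover have "\<exists>P'. markov_transition_function ?M' P' \<and> hd1 ?T' P' \<and> has_resolvent ?M' P' U'"
    if qa: "quasi_absorbing T PX S"
  proof (intro exI conjI)
    let ?P' = "\<lambda>t x. restrict_space (P t x) S"
    show "markov_transition_function ?M' ?P'"
      by (rule markov_transition_function_restrict[OF P S quasi_absorbing_transition[OF P PX S qa]])
    show "hd1 ?T' ?P'" by (rule hd1_restrict[OF P PX S qa])
    show "has_resolvent ?M' ?P' U'"
      unfolding has_resolvent_def
    proof (intro allI impI ballI)
      fix \<alpha> :: real and f :: "'a \<Rightarrow> ennreal" and x assume \<alpha>: "0 < \<alpha>" and f: "f \<in> borel_measurable ?M'" and x: "x \<in> space ?M'"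
      \<comment> \<open>Extension by 0 again: restricted kernels integrate f as the original ones
        integrate g, so the two resolvents agree, and g is an admissible extension for
        \<open>U'\<close>.\<close>
      define g where "g y = f y * indicator S y" for y
      have xS: "x \<in> S" "x \<in> space (univ_borel T)" using x ST by auto
      have g: "g \<in> borel_measurable (univ_borel T)"
        using f S ST measurable_cong_sets[OF sets_univ_borel_subtopology[OF S] refl, of "borel :: ennreal measure"]
        unfolding g_def by (subst borel_measurable_restrict_space_iff_ennreal[symmetric]) (auto simp: Int_absorb2)
      have "(\<integral>\<^sup>+y. f y \<partial>?P' t x) = (\<integral>\<^sup>+y. g y \<partial>P t x)" if "0 \<le> t" for t
        unfolding g_def using S ST markov_transition_function_at(2,3)[OF P that xS(2)]
        by (intro nn_integral_restrict_space) (simp add: Int_absorb2)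
      then have "resolvent ?P' \<alpha> f x = resolvent P \<alpha> g x"
        unfolding resolvent_def by (intro nn_integral_cong) (simp add: indicator_def)
      also have "\<dots> = U' \<alpha> f x" using U'[OF \<alpha> f g _ xS(1)] by (simp add: g_def)
      finally show "resolvent ?P' \<alpha> f x = U' \<alpha> f x" .
    qed
  qed
  ultimately show ?thesis unfolding Let_def S_def[symmetric] by blast
qed

end
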